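(* Let $\overline M$ be a $7$-dimensional Riemannian manifold with a $G_2$-structure of type $\mathcal X_3$. Let $\iota:M\to\overline M$ be an orientable hypersurface with unit normal vector field $n$, with the induced $SU(3)$-structure determined by $n$ and a smooth function $\theta$ on $M$. Then $M$ is of type $\mathcal W_1^++\mathcal W_1^-+\mathcal W_2^++\mathcal W_2^-+\mathcal W_3+\mathcal W_5$. Moreover, the $SU(3)$-structure on $M$ is of the type given on the left if and only if the condition on the right holds: 1. $\mathcal W_1^++\mathcal W_1^-+\mathcal W_2^++\mathcal W_2^-+\mathcal W_3$: $d\theta=\overline r(\varphi)(\iota_*\cdot,n)$. 2. $\mathcal W_1^++\mathcal W_1^-+\mathcal W_2^++\mathcal W_2^-+\mathcal W_5$: $(I_{(1)}+I_{(2)})\iota^*\overline r(\varphi)=(1-I)B$. 3. $\mathcal W_1^++\mathcal W_1^-+\mathcal W_2^++\mathcal W_3+\mathcal W_5$: $3\cos\theta\,(1+I)\iota^*\overline r(\varphi)+3\sin\theta\,(1+I)B=\left(6h\sin\theta-\cos\theta\,\overline r(\varphi)(n,n)\right)\langle\cdot,\cdot\rangle$. 4. $\mathcal W_1^++\mathcal W_1^-+\mathcal W_2^-+\mathcal W_3+\mathcal W_5$: $-3\sin\theta\,(1+I)\iota^*\overline r(\varphi)+3\cos\theta\,(1+I)B=\left(6h\cos\theta+\sin\theta\,\overline r(\varphi)(n,n)\right)\langle\cdot,\cdot\rangle$. 5. $\mathcal W_1^++\mathcal W_2^++\mathcal W_2^-+\mathcal W_3+\mathcal W_5$: $\cos\theta\,\overline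 r(\varphi)(n,n)=6h\sin\theta$. 6. $\mathcal W_1^-+\mathcal W_2^++\mathcal W_2^-+\mathcal W_3+\mathcal W_5$: $\sin\theta\,\overline r(\varphi)(n,n)=-6h\cos\theta$. 7. $\mathcal W_1^++\mathcal W_1^-+\mathcal W_3+\mathcal W_5$: $3(1+I)\iota^*\overline r(\varphi)=-\overline r(\varphi)(n,n)\langle\cdot,\cdot\rangle$ and $(1+I)B=2h\langle\cdot,\cdot\rangle$. 8. $\mathcal W_2^++\mathcal W_2^-+\mathcal W_3+\mathcal W_5$: $\overline r(\varphi)(n,n)=0$ and $M$ is a minimal variety.
   Context: $G_2$-structures: a $G_2$-structure on a Riemannian $7$-manifold $(\overline M,\langle\cdot,\cdot\rangle)$ is given by a global three-form $\varphi$ such that locally there is an orthonormal frame $\{e_0,\dots,e_6\}$ (indices in $\mathbb Z_7$) with $\varphi=\sum_ie_i\wedge e_{i+1}\wedge e_{i+3}$ (vectors are identified with one-forms via the metric). $\langle P(x,y),z\rangle=\varphi(x,y,z)$, and $*\varphi=-\sum_{i}e_{i+2}\wedge e_{i+4}\wedge e_{i+5}\wedge e_{i+6}$ (Hodge dual for the orientation $e_0\wedge\dots\wedge e_6$). $\overline\nabla$ is the Levi-Civita connection and $\overline r(\varphi)(x,y)=\frac14\langle\overline\nabla_x\varphi,y\lrcorner*\varphi\rangle$, where $\langle a,b\rangle=\frac1{p!}\sum a(e_{i_1},\dots)b(e_{i_1},\dots)$ for $p$-forms. Type $\mathcal X_3$: $\overline r(\varphi)$ is symmetric and trace-free. Induced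 structure on $M$: the induced metric, $Ix=P(n,x)$, and $\Psi=\psi_++i\psi_-$ with $\psi_+=\cos\theta\,\iota^*\varphi-\sin\theta\,\iota^*(n\lrcorner*\varphi)$, $\psi_-=\sin\theta\,\iota^*\varphi+\cos\theta\,\iota^*(n\lrcorner*\varphi)$. $B(x,y)=\langle II(x,y),n\rangle=\langle\overline\nabla_xy,n\rangle$ is the second fundamental form, $h=\frac16\mathrm{Tr}\,B$ (so $h=\langle H,n\rangle$, $H$ the mean curvature); minimal variety means $h=0$. For a bilinear form $b$ on $M$, $(I_{(1)}b)(x,y)=-b(Ix,y)$, $(I_{(2)}b)(x,y)=-b(x,Iy)$, $(Ib)(x,y)=b(Ix,Iy)$; for a one-form $\mu$, $(I\mu)(x)=-\mu(Ix)$. Types of $SU(3)$-structure: $\nabla$ is the Levi-Civita connection of $M$, $\omega(x,y)=\langle x,Iy\rangle$. $\nabla\omega$ lies in $\{\alpha\mid\alpha(x,y,z)=-\alpha(x,z,y)=-\alpha(x,Iy,Iz)\}=\mathcal W_1\oplus\mathcal W_2\oplus\mathcal W_3\oplus\mathcal W_4$ (Gray–Hervella), where $\mathcal W_1$: $\alpha$ totally skew; $\mathcal W_2$: cyclic sum of $\alpha(x,y,z)$ is zero; $\mathcal W_3$: $\alpha(Ix,Iy,z)=\alpha(x,y,z)$ and $\sum_i\alpha(e_i,e_i,z)=0$; $\mathcal W_4$: $\alpha(x,y,z)=\langle x,y\rangle\tau(z)-\langle x,z\rangle\tau(y)-\langle x,Iy\rangle\tau(Iz)+\langle x,Iz\rangle\tau(Iy)$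 for some one-form $\tau$. With $r(\alpha)(x,y)=\frac12\langle x\lrcorner\alpha,y\lrcorner\psi_+\rangle$, for $i=1,2$ one has $\mathcal W_i=\mathcal W_i^+\oplus\mathcal W_i^-$, where $\mathcal W_i^+$ (resp. $\mathcal W_i^-$) is the set of $\alpha\in\mathcal W_i$ with $r(\alpha)$ symmetric (resp. skew-symmetric). The $\mathcal W_5$-part of the torsion is the one-form $\eta$ determined by requiring that the metric connection $\nabla+\eta+\xi$, with $\eta_XY=(I\eta)(X)IY$ and $\xi_XY=-\frac12I(\nabla_XI)Y$, makes $\omega,\psi_+,\psi_-$ parallel; equivalently $(I\eta)(X)=-\frac1{12}\langle\nabla_X\psi_+,\psi_-\rangle$. $M$ is of type $\mathcal U$, a sum of some of $\mathcal W_1^\pm,\mathcal W_2^\pm,\mathcal W_3,\mathcal W_4,\mathcal W_5$, if the components of $\nabla\omega$ in the $\mathcal W$'s not occurring in $\mathcal U$ vanish everywhere and, when $\mathcal W_5$ does not occur, $\eta=0$. *)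

theory Defs
  imports "HOL-Analysis.Analysis"
begin

section \<open>Smooth manifolds\<close>

text \<open>On open sets \<open>S\<close> this is the usual notion of a \<open>C\<^sup>k\<close> map.\<close>

primrec Ck_on :: "nat \<Rightarrow> 'a::real_normed_vector set \<Rightarrow> ('a \<Rightarrow> 'b::real_normed_vector) \<Rightarrow> bool" where
  "Ck_on 0 S f \<longleftrightarrow> continuous_on S f"
| "Ck_on (Suc k) S f \<longleftrightarrow>
     (\<forall>x\<in>S. f differentiable (at x)) \<and> (\<forall>v. Ck_on k S (\<lambda>x. frechet_derivative f (at x) v))"

definition smooth_on :: "'a::real_normed_vector set \<Rightarrow> ('a \<Rightarrow> 'b::real_normed_vector) \<Rightarrow> bool" where
  "smooth_on S f \<longleftrightarrow> (\<forall>k. Ck_on k S f)"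

type_synonym ('m, 'n) chart = "'m set \<times> ('m \<Rightarrow> real ^ 'n)"

definition chart_inv :: "('m, 'n::finite) chart \<Rightarrow> real ^ 'n \<Rightarrow> 'm" where
  "chart_inv c = inv_into (fst c) (snd c)"

definition is_chart :: "('m::topological_space, 'n::finite) chart \<Rightarrow> bool" where
  "is_chart c \<longleftrightarrow> open (fst c) \<and> open (snd c ` fst c) \<and>
     homeomorphism (fst c) (snd c ` fst c) (snd c) (chart_inv c)"

definition smooth_atlas :: "('m::topological_space, 'n::finite) chart set \<Rightarrow> bool" where
  "smooth_atlas A \<longleftrightarrow> (\<forall>c\<in>A. is_chart c) \<and> (\<Union>c\<in>A. fst c) = UNIV \<and>
     (\<forall>c\<in>A. \<forall>d\<in>A. smooth_on (snd c ` (fst c \<inter> fst d)) (snd d \<circ> chart_inv c))"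

text \<open>
  Each point \<open>p\<close> has a preferred chart \<open>chart_at A p\<close>, arbitrary among the charts of the atlas
  around \<open>p\<close>. The tangent space at \<open>p\<close> is modelled by \<open>real ^ 'n\<close>, a tangent vector being
  given by its components in the preferred chart at \<open>p\<close>. So a vector field is a function
  \<open>'m \<Rightarrow> real ^ 'n\<close> and a tensor field is a function of a point and of tangent vectors there; the
  preferred charts at nearby points are unrelated, hence smoothness and derivatives of such
  fields always refer to their components in one fixed chart.
\<close>

definition chart_at :: "('m, 'n::finite) chart set \<Rightarrow> 'm \<Rightarrow> ('m, 'n) chart" where
  "chart_at A p = (SOME c. c \<in> A \<and> p \<in> fst c)"

definition differential ::
    "('m, 'n::finite) chart set \<Rightarrow> ('b, 'k::finite) chart set \<Rightarrow> ('m \<Rightarrow> 'b) \<Rightarrow> 'm \<Rightarrow> real ^ 'n \<Rightarrow> real ^ 'k"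
where
  "differential A B f p =
     frechet_derivative (snd (chart_at B (f p)) \<circ> f \<circ> chart_inv (chart_at A p))
       (at (snd (chart_at A p) p))"

definition differential_fun ::
    "('m, 'n::finite) chart set \<Rightarrow> ('m \<Rightarrow> 'v::real_normed_vector) \<Rightarrow> 'm \<Rightarrow> real ^ 'n \<Rightarrow> 'v" where
  "differential_fun A f p =
     frechet_derivative (f \<circ> chart_inv (chart_at A p)) (at (snd (chart_at A p) p))"

text \<open>\<open>components A c p x\<close> are the components in the chart \<open>c\<close> of the tangent vector \<open>x\<close> at
  \<open>p\<close>; \<open>coord_vector A c p v\<close> is the tangent vector at \<open>p\<close> whose components in \<open>c\<close> are \<open>v\<close>.\<close>

definition components ::
    "('m, 'n::finite) chart set \<Rightarrow> ('m, 'n) chart \<Rightarrow> 'm \<Rightarrow> real ^ 'n \<Rightarrow> real ^ 'n" where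
  "components A c p = differential_fun A (snd c) p"

definition coord_vector ::
    "('m, 'n::finite) chart set \<Rightarrow> ('m, 'n) chart \<Rightarrow> 'm \<Rightarrow> real ^ 'n \<Rightarrow> real ^ 'n" where
  "coord_vector A c p = frechet_derivative (snd (chart_at A p) \<circ> chart_inv c) (at (snd c p))"

definition smooth_function :: "('m, 'n::finite) chart set \<Rightarrow> ('m \<Rightarrow> real) \<Rightarrow> bool" where
  "smooth_function A f \<longleftrightarrow> (\<forall>c\<in>A. smooth_on (snd c ` fst c) (f \<circ> chart_inv c))"

definition smooth_map ::
    "('m::topological_space, 'n::finite) chart set \<Rightarrow> ('b::topological_space, 'k::finite) chart set \<Rightarrow>
     ('m \<Rightarrow> 'b) \<Rightarrow> bool" where
  "smooth_map A B f \<longleftrightarrow> continuous_on UNIV f \<and>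
     (\<forall>c\<in>A. \<forall>d\<in>B. smooth_on (snd c ` (fst c \<inter> f -` fst d)) (snd d \<circ> f \<circ> chart_inv c))"

definition smooth_vector_field_on ::
    "('m, 'n::finite) chart set \<Rightarrow> 'm set \<Rightarrow> ('m \<Rightarrow> real ^ 'n) \<Rightarrow> bool" where
  "smooth_vector_field_on A U X \<longleftrightarrow>
     (\<forall>c\<in>A. smooth_on (snd c ` (fst c \<inter> U))
              (\<lambda>u. components A c (chart_inv c u) (X (chart_inv c u))))"

text \<open>Smoothness of a vector field along a map, that is, \<open>V p\<close> is tangent to the target at \<open>f p\<close>.\<close>

definition smooth_along ::
    "('m, 'n::finite) chart set \<Rightarrow> ('b, 'k::finite) chart set \<Rightarrow> ('m \<Rightarrow> 'b) \<Rightarrow> ('m \<Rightarrow> real ^ 'k) \<Rightarrow> bool"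
where
  "smooth_along A B f V \<longleftrightarrow>
     (\<forall>c\<in>A. \<forall>d\<in>B. smooth_on (snd c ` (fst c \<inter> f -` fst d))
        (\<lambda>u. components B d (f (chart_inv c u)) (V (chart_inv c u))))"

type_synonym 'v form2 = "'v \<Rightarrow> 'v \<Rightarrow> real"
type_synonym 'v form3 = "'v \<Rightarrow> 'v \<Rightarrow> 'v \<Rightarrow> real"
type_synonym 'v form4 = "'v \<Rightarrow> 'v \<Rightarrow> 'v \<Rightarrow> 'v \<Rightarrow> real"

text \<open>Components, in the chart \<open>c\<close> at the point with coordinates \<open>u\<close>, of covariant tensor fields
  of degree 2 and 3 and of an endomorphism field.\<close>

definition local2 ::
    "('m, 'n::finite) chart set \<Rightarrow> ('m, 'n) chart \<Rightarrow> ('m \<Rightarrow> (real ^ 'n) form2) \<Rightarrow>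
     real ^ 'n \<Rightarrow> (real ^ 'n) form2" where
  "local2 A c T u x y = (let q = chart_inv c u; e = coord_vector A c q in T q (e x) (e y))"

definition local3 ::
    "('m, 'n::finite) chart set \<Rightarrow> ('m, 'n) chart \<Rightarrow> ('m \<Rightarrow> (real ^ 'n) form3) \<Rightarrow>
     real ^ 'n \<Rightarrow> (real ^ 'n) form3" where
  "local3 A c T u x y z = (let q = chart_inv c u; e = coord_vector A c q in T q (e x) (e y) (e z))"

definition local_end ::
    "('m, 'n::finite) chart set \<Rightarrow> ('m, 'n) chart \<Rightarrow> ('m \<Rightarrow> real ^ 'n \<Rightarrow> real ^ 'n) \<Rightarrow>
     real ^ 'n \<Rightarrow> real ^ 'n \<Rightarrow> real ^ 'n" where
  "local_end A c J u x =
     (let q = chart_inv c u in components A c q (J q (coord_vector A c q x)))"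

section \<open>Riemannian metrics and the Levi-Civita connection\<close>

definition trilinear :: "('v::real_vector) form3 \<Rightarrow> bool" where
  "trilinear a \<longleftrightarrow> (\<forall>y z. linear (\<lambda>x. a x y z)) \<and> (\<forall>x z. linear (\<lambda>y. a x y z)) \<and> (\<forall>x y. linear (a x y))"

definition riemannian_metric :: "('m, 'n::finite) chart set \<Rightarrow> ('m \<Rightarrow> (real ^ 'n) form2) \<Rightarrow> bool" where
  "riemannian_metric A g \<longleftrightarrow>
     (\<forall>p. bilinear (g p) \<and> (\<forall>x y. g p x y = g p y x) \<and> (\<forall>x. x \<noteq> 0 \<longrightarrow> g p x x > 0)) \<and>
     (\<forall>c\<in>A. \<forall>x y. smooth_on (snd c ` fst c) (\<lambda>u. local2 A c g u x y))"

definition riemannian_manifold ::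
    "('m::topological_space, 'n::finite) chart set \<Rightarrow> ('m \<Rightarrow> (real ^ 'n) form2) \<Rightarrow> bool" where
  "riemannian_manifold A g \<longleftrightarrow> smooth_atlas A \<and> riemannian_metric A g"

text \<open>The Levi-Civita connection in the chart \<open>c\<close>: \<open>christoffel A g c u x y\<close> is the covariant
  derivative, in direction \<open>x\<close>, of the coordinate field with constant components \<open>y\<close>. It is given
  by the Koszul formula, in which the Lie brackets of coordinate fields vanish.\<close>

definition christoffel ::
    "('m, 'n::finite) chart set \<Rightarrow> ('m \<Rightarrow> (real ^ 'n) form2) \<Rightarrow> ('m, 'n) chart \<Rightarrow>
     real ^ 'n \<Rightarrow> real ^ 'n \<Rightarrow> real ^ 'n \<Rightarrow> real ^ 'n" where
  "christoffel A g c u x y = (THE w. \<forall>z.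
     2 * local2 A c g u w z =
       frechet_derivative (\<lambda>u. local2 A c g u y z) (at u) x
     + frechet_derivative (\<lambda>u. local2 A c g u x z) (at u) y
     - frechet_derivative (\<lambda>u. local2 A c g u x y) (at u) z)"

definition nabla2 ::
    "('m, 'n::finite) chart set \<Rightarrow> ('m \<Rightarrow> (real ^ 'n) form2) \<Rightarrow> ('m \<Rightarrow> (real ^ 'n) form2) \<Rightarrow>
     'm \<Rightarrow> real ^ 'n \<Rightarrow> (real ^ 'n) form2" where
  "nabla2 A g T p x y z =
     (let c = chart_at A p; u = snd c p; \<Gamma> = christoffel A g c u in
        frechet_derivative (\<lambda>u. local2 A c T u y z) (at u) x
      - T p (\<Gamma> x y) z - T p y (\<Gamma> x z))"

definition nabla3 ::
    "('m, 'n::finite) chart set \<Rightarrow> ('m \<Rightarrow> (real ^ 'n) form2) \<Rightarrow> ('m \<Rightarrow> (real ^ 'n) form3) \<Rightarrow>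
     'm \<Rightarrow> real ^ 'n \<Rightarrow> (real ^ 'n) form3" where
  "nabla3 A g T p x y z w =
     (let c = chart_at A p; u = snd c p; \<Gamma> = christoffel A g c u in
        frechet_derivative (\<lambda>u. local3 A c T u y z w) (at u) x
      - T p (\<Gamma> x y) z w - T p y (\<Gamma> x z) w - T p y z (\<Gamma> x w))"

definition nabla_end ::
    "('m, 'n::finite) chart set \<Rightarrow> ('m \<Rightarrow> (real ^ 'n) form2) \<Rightarrow> ('m \<Rightarrow> real ^ 'n \<Rightarrow> real ^ 'n) \<Rightarrow>
     'm \<Rightarrow> real ^ 'n \<Rightarrow> real ^ 'n \<Rightarrow> real ^ 'n" where
  "nabla_end A g J p x y =
     (let c = chart_at A p; u = snd c p; \<Gamma> = christoffel A g c u in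
        frechet_derivative (\<lambda>u. local_end A c J u y) (at u) x
      + \<Gamma> x (J p y) - J p (\<Gamma> x y))"

text \<open>The covariant derivative, for the Levi-Civita connection of the target, of a vector field
  \<open>V\<close> along the map \<open>f\<close>.\<close>

definition nabla_along ::
    "('m, 'n::finite) chart set \<Rightarrow> ('b, 'k::finite) chart set \<Rightarrow> ('b \<Rightarrow> (real ^ 'k) form2) \<Rightarrow>
     ('m \<Rightarrow> 'b) \<Rightarrow> ('m \<Rightarrow> real ^ 'k) \<Rightarrow> 'm \<Rightarrow> real ^ 'n \<Rightarrow> real ^ 'k" where
  "nabla_along A B g f V p x =
     (let d = chart_at B (f p) in
        differential_fun A (\<lambda>q. components B d (f q) (V q)) p x
      + christoffel B g d (snd d (f p)) (differential A B f p x) (V p))"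

section \<open>Linear algebra on a tangent space\<close>

definition orthonormal :: "'v form2 \<Rightarrow> ('i \<Rightarrow> 'v) \<Rightarrow> bool" where
  "orthonormal g e \<longleftrightarrow> (\<forall>i j. g (e i) (e j) = (if i = j then 1 else 0))"

text \<open>The choice of the orthonormal basis is immaterial for the traces and inner products below.\<close>

definition onb :: "(real ^ 'n::finite) form2 \<Rightarrow> 'n \<Rightarrow> real ^ 'n" where
  "onb g = (SOME e. orthonormal g e)"

definition trace_form :: "(real ^ 'n::finite) form2 \<Rightarrow> (real ^ 'n) form2 \<Rightarrow> real" where
  "trace_form g b = (\<Sum>i\<in>UNIV. b (onb g i) (onb g i))"

definition inner2 :: "(real ^ 'n::finite) form2 \<Rightarrow> (real ^ 'n) form2 \<Rightarrow> (real ^ 'n) form2 \<Rightarrow> real" where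
  "inner2 g a b = 1 / fact 2 *
     (\<Sum>i\<in>UNIV. \<Sum>j\<in>UNIV. a (onb g i) (onb g j) * b (onb g i) (onb g j))"

definition inner3 :: "(real ^ 'n::finite) form2 \<Rightarrow> (real ^ 'n) form3 \<Rightarrow> (real ^ 'n) form3 \<Rightarrow> real" where
  "inner3 g a b = 1 / fact 3 *
     (\<Sum>i\<in>UNIV. \<Sum>j\<in>UNIV. \<Sum>k\<in>UNIV.
        a (onb g i) (onb g j) (onb g k) * b (onb g i) (onb g j) (onb g k))"

text \<open>Wedge products of one-forms, with the convention
  \<open>(a\<^sub>1 \<and> \<dots> \<and> a\<^sub>k) (x\<^sub>1, \<dots>, x\<^sub>k) = det (a\<^sub>i x\<^sub>j)\<close>.\<close>

definition wedge2 :: "('v \<Rightarrow> real) \<Rightarrow> ('v \<Rightarrow> real) \<Rightarrow> 'v form2" where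
  "wedge2 a b x y = a x * b y - a y * b x"

definition wedge3 :: "('v \<Rightarrow> real) \<Rightarrow> ('v \<Rightarrow> real) \<Rightarrow> ('v \<Rightarrow> real) \<Rightarrow> 'v form3" where
  "wedge3 a b c x y z = a x * wedge2 b c y z - a y * wedge2 b c x z + a z * wedge2 b c x y"

definition wedge4 :: "('v \<Rightarrow> real) \<Rightarrow> ('v \<Rightarrow> real) \<Rightarrow> ('v \<Rightarrow> real) \<Rightarrow> ('v \<Rightarrow> real) \<Rightarrow> 'v form4" where
  "wedge4 a b c d x y z w =
     a x * wedge3 b c d y z w - a y * wedge3 b c d x z w + a z * wedge3 b c d x y w - a w * wedge3 b c d x y z"

text \<open>Operators on bilinear forms induced by an endomorphism \<open>J\<close>.\<close>

definition I_first :: "('v \<Rightarrow> 'v) \<Rightarrow> 'v form2 \<Rightarrow> 'v form2" where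
  "I_first J b x y = - b (J x) y"

definition I_second :: "('v \<Rightarrow> 'v) \<Rightarrow> 'v form2 \<Rightarrow> 'v form2" where
  "I_second J b x y = - b x (J y)"

definition I_both :: "('v \<Rightarrow> 'v) \<Rightarrow> 'v form2 \<Rightarrow> 'v form2" where
  "I_both J b x y = b (J x) (J y)"

definition I_one :: "('v \<Rightarrow> 'v) \<Rightarrow> ('v \<Rightarrow> real) \<Rightarrow> 'v \<Rightarrow> real" where
  "I_one J \<mu> x = - \<mu> (J x)"

section \<open>\<open>G\<^sub>2\<close>-structures\<close>

text \<open>Frames are indexed by the numeral type \<open>7\<close>, whose addition is that of the integers modulo 7.\<close>

definition g2_form :: "'v form2 \<Rightarrow> (7 \<Rightarrow> 'v) \<Rightarrow> 'v form3" where
  "g2_form g e x y z = (\<Sum>i\<in>UNIV. wedge3 (g (e i)) (g (e (i + 1))) (g (e (i + 3))) x y z)"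

definition g2_dual_form :: "'v form2 \<Rightarrow> (7 \<Rightarrow> 'v) \<Rightarrow> 'v form4" where
  "g2_dual_form g e x y z w =
     - (\<Sum>i\<in>UNIV. wedge4 (g (e (i + 2))) (g (e (i + 4))) (g (e (i + 5))) (g (e (i + 6))) x y z w)"

definition three_form :: "('m, 'n::finite) chart set \<Rightarrow> ('m \<Rightarrow> (real ^ 'n) form3) \<Rightarrow> bool" where
  "three_form A \<phi> \<longleftrightarrow>
     (\<forall>p. trilinear (\<phi> p) \<and> (\<forall>x y z. \<phi> p y x z = - \<phi> p x y z \<and> \<phi> p x z y = - \<phi> p x y z)) \<and>
     (\<forall>c\<in>A. \<forall>x y z. smooth_on (snd c ` fst c) (\<lambda>u. local3 A c \<phi> u x y z))"

definition g2_structure ::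
    "('m::topological_space, 7) chart set \<Rightarrow> ('m \<Rightarrow> (real ^ 7) form2) \<Rightarrow> ('m \<Rightarrow> (real ^ 7) form3) \<Rightarrow> bool"
where
  "g2_structure A g \<phi> \<longleftrightarrow> three_form A \<phi> \<and>
     (\<forall>p. \<exists>U e. open U \<and> p \<in> U \<and> (\<forall>i. smooth_vector_field_on A U (\<lambda>q. e q i)) \<and>
        (\<forall>q\<in>U. orthonormal (g q) (e q) \<and> \<phi> q = g2_form (g q) (e q)))"

text \<open>The Hodge dual of \<open>\<phi>\<close> at a point; it is the same for all frames adapted to \<open>\<phi>\<close>.\<close>

definition star_phi :: "(real ^ 7) form2 \<Rightarrow> (real ^ 7) form3 \<Rightarrow> (real ^ 7) form4" where
  "star_phi g \<phi> = (THE s. \<exists>e. orthonormal g e \<and> \<phi> = g2_form g e \<and> s = g2_dual_form g e)"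

definition cross_product ::
    "(real ^ 7) form2 \<Rightarrow> (real ^ 7) form3 \<Rightarrow> real ^ 7 \<Rightarrow> real ^ 7 \<Rightarrow> real ^ 7" where
  "cross_product g \<phi> x y = (THE w. \<forall>z. g w z = \<phi> x y z)"

definition rbar ::
    "('m, 7) chart set \<Rightarrow> ('m \<Rightarrow> (real ^ 7) form2) \<Rightarrow> ('m \<Rightarrow> (real ^ 7) form3) \<Rightarrow>
     'm \<Rightarrow> (real ^ 7) form2" where
  "rbar A g \<phi> p x y = 1 / 4 * inner3 (g p) (nabla3 A g \<phi> p x) (star_phi (g p) (\<phi> p) y)"

definition type_X3 ::
    "('m, 7) chart set \<Rightarrow> ('m \<Rightarrow> (real ^ 7) form2) \<Rightarrow> ('m \<Rightarrow> (real ^ 7) form3) \<Rightarrow> bool" where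
  "type_X3 A g \<phi> \<longleftrightarrow>
     (\<forall>p. (\<forall>x y. rbar A g \<phi> p x y = rbar A g \<phi> p y x) \<and> trace_form (g p) (rbar A g \<phi> p) = 0)"

section \<open>Types of \<open>SU(3)\<close>-structures\<close>

datatype su3_class = W1p | W1m | W2p | W2m | W3 | W4 | W5

definition kaehler_form :: "'v form2 \<Rightarrow> ('v \<Rightarrow> 'v) \<Rightarrow> 'v form2" where
  "kaehler_form g J x y = g x (J y)"

definition r_form :: "(real ^ 6) form2 \<Rightarrow> (real ^ 6) form3 \<Rightarrow> (real ^ 6) form3 \<Rightarrow> (real ^ 6) form2" where
  "r_form g \<psi> \<alpha> x y = 1 / 2 * inner2 g (\<alpha> x) (\<psi> y)"

definition gh_space :: "('v::real_vector \<Rightarrow> 'v) \<Rightarrow> 'v form3 set" where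
  "gh_space J = {\<alpha>. trilinear \<alpha> \<and>
     (\<forall>x y z. \<alpha> x y z = - \<alpha> x z y \<and> \<alpha> x y z = - \<alpha> x (J y) (J z))}"

definition gh_W1 :: "('v::real_vector \<Rightarrow> 'v) \<Rightarrow> 'v form3 set" where
  "gh_W1 J = {\<alpha> \<in> gh_space J. \<forall>x y z. \<alpha> x y z = - \<alpha> y x z}"

definition gh_W2 :: "('v::real_vector \<Rightarrow> 'v) \<Rightarrow> 'v form3 set" where
  "gh_W2 J = {\<alpha> \<in> gh_space J. \<forall>x y z. \<alpha> x y z + \<alpha> y z x + \<alpha> z x y = 0}"

definition gh_W3 :: "(real ^ 6) form2 \<Rightarrow> (real ^ 6 \<Rightarrow> real ^ 6) \<Rightarrow> (real ^ 6) form3 set" where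
  "gh_W3 g J = {\<alpha> \<in> gh_space J. (\<forall>x y z. \<alpha> (J x) (J y) z = \<alpha> x y z) \<and>
     (\<forall>z. trace_form g (\<lambda>x y. \<alpha> x y z) = 0)}"

definition gh_W4 :: "('v::real_vector) form2 \<Rightarrow> ('v \<Rightarrow> 'v) \<Rightarrow> 'v form3 set" where
  "gh_W4 g J = {\<alpha> \<in> gh_space J. \<exists>\<tau>. linear \<tau> \<and>
     (\<forall>x y z. \<alpha> x y z = g x y * \<tau> z - g x z * \<tau> y - g x (J y) * \<tau> (J z) + g x (J z) * \<tau> (J y))}"

text \<open>\<open>W5\<close> is not a summand of the space in which the covariant derivative of the Kaehler form
  lies, hence the zero space in the last case.\<close>

definition su3_space ::
    "(real ^ 6) form2 \<Rightarrow> (real ^ 6 \<Rightarrow> real ^ 6) \<Rightarrow> (real ^ 6) form3 \<Rightarrow> su3_class \<Rightarrow> (real ^ 6) form3 set"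
where
  "su3_space g J \<psi> k =
     (let sym = {\<alpha>. \<forall>x y. r_form g \<psi> \<alpha> x y = r_form g \<psi> \<alpha> y x};
          skew = {\<alpha>. \<forall>x y. r_form g \<psi> \<alpha> x y = - r_form g \<psi> \<alpha> y x}
      in case k of
           W1p \<Rightarrow> gh_W1 J \<inter> sym
         | W1m \<Rightarrow> gh_W1 J \<inter> skew
         | W2p \<Rightarrow> gh_W2 J \<inter> sym
         | W2m \<Rightarrow> gh_W2 J \<inter> skew
         | W3 \<Rightarrow> gh_W3 g J
         | W4 \<Rightarrow> gh_W4 g J
         | W5 \<Rightarrow> {\<lambda>x y z. 0})"

text \<open>\<open>eta_xi A g J \<eta> p x y = \<eta>\<^sub>x y + \<xi>\<^sub>x y\<close>, the difference of the metric connection defined by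
  \<open>\<eta>\<close> and the Levi-Civita connection.\<close>

definition eta_xi ::
    "('m, 6) chart set \<Rightarrow> ('m \<Rightarrow> (real ^ 6) form2) \<Rightarrow> ('m \<Rightarrow> real ^ 6 \<Rightarrow> real ^ 6) \<Rightarrow>
     (real ^ 6 \<Rightarrow> real) \<Rightarrow> 'm \<Rightarrow> real ^ 6 \<Rightarrow> real ^ 6 \<Rightarrow> real ^ 6" where
  "eta_xi A g J \<eta> p x y =
     I_one (J p) \<eta> x *\<^sub>R J p y + (- 1 / 2) *\<^sub>R J p (nabla_end A g J p x y)"

definition parallel2_at ::
    "('m, 6) chart set \<Rightarrow> ('m \<Rightarrow> (real ^ 6) form2) \<Rightarrow> (real ^ 6 \<Rightarrow> real ^ 6 \<Rightarrow> real ^ 6) \<Rightarrow>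
     ('m \<Rightarrow> (real ^ 6) form2) \<Rightarrow> 'm \<Rightarrow> bool" where
  "parallel2_at A g E T p \<longleftrightarrow>
     (\<forall>x y z. nabla2 A g T p x y z - T p (E x y) z - T p y (E x z) = 0)"

definition parallel3_at ::
    "('m, 6) chart set \<Rightarrow> ('m \<Rightarrow> (real ^ 6) form2) \<Rightarrow> (real ^ 6 \<Rightarrow> real ^ 6 \<Rightarrow> real ^ 6) \<Rightarrow>
     ('m \<Rightarrow> (real ^ 6) form3) \<Rightarrow> 'm \<Rightarrow> bool" where
  "parallel3_at A g E T p \<longleftrightarrow>
     (\<forall>x y z w. nabla3 A g T p x y z w - T p (E x y) z w - T p y (E x z) w - T p y z (E x w) = 0)"

definition W5_part ::
    "('m, 6) chart set \<Rightarrow> ('m \<Rightarrow> (real ^ 6) form2) \<Rightarrow> ('m \<Rightarrow> real ^ 6 \<Rightarrow> real ^ 6) \<Rightarrow>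
     ('m \<Rightarrow> (real ^ 6) form3) \<Rightarrow> ('m \<Rightarrow> (real ^ 6) form3) \<Rightarrow> 'm \<Rightarrow> real ^ 6 \<Rightarrow> real" where
  "W5_part A g J \<psi>p \<psi>m p = (THE \<eta>. linear \<eta> \<and>
     parallel2_at A g (eta_xi A g J \<eta> p) (\<lambda>q. kaehler_form (g q) (J q)) p \<and>
     parallel3_at A g (eta_xi A g J \<eta> p) \<psi>p p \<and>
     parallel3_at A g (eta_xi A g J \<eta> p) \<psi>m p)"

definition su3_type ::
    "('m, 6) chart set \<Rightarrow> ('m \<Rightarrow> (real ^ 6) form2) \<Rightarrow> ('m \<Rightarrow> real ^ 6 \<Rightarrow> real ^ 6) \<Rightarrow>
     ('m \<Rightarrow> (real ^ 6) form3) \<Rightarrow> ('m \<Rightarrow> (real ^ 6) form3) \<Rightarrow> su3_class set \<Rightarrow> bool" where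
  "su3_type A g J \<psi>p \<psi>m U \<longleftrightarrow>
     (\<forall>p. \<exists>\<alpha>. (\<forall>k. \<alpha> k \<in> su3_space (g p) (J p) (\<psi>p p) k) \<and>
        (\<forall>x y z. nabla2 A g (\<lambda>q. kaehler_form (g q) (J q)) p x y z = (\<Sum>k\<in>UNIV. \<alpha> k x y z)) \<and>
        (\<forall>k. k \<notin> U \<longrightarrow> \<alpha> k = (\<lambda>x y z. 0))) \<and>
     (W5 \<notin> U \<longrightarrow> (\<forall>p x. W5_part A g J \<psi>p \<psi>m p x = 0))"

section \<open>Hypersurfaces of manifolds with a \<open>G\<^sub>2\<close>-structure\<close>

definition immersed_hypersurface ::
    "('m::topological_space, 6) chart set \<Rightarrow> ('b::topological_space, 7) chart set \<Rightarrow> ('m \<Rightarrow> 'b) \<Rightarrow> bool"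
where
  "immersed_hypersurface A B \<iota> \<longleftrightarrow>
     smooth_atlas A \<and> smooth_map A B \<iota> \<and> (\<forall>p. inj (differential A B \<iota> p))"

definition unit_normal_field ::
    "('m, 6) chart set \<Rightarrow> ('b, 7) chart set \<Rightarrow> ('b \<Rightarrow> (real ^ 7) form2) \<Rightarrow> ('m \<Rightarrow> 'b) \<Rightarrow>
     ('m \<Rightarrow> real ^ 7) \<Rightarrow> bool" where
  "unit_normal_field A B g \<iota> n \<longleftrightarrow> smooth_along A B \<iota> n \<and>
     (\<forall>p. g (\<iota> p) (n p) (n p) = 1 \<and> (\<forall>x. g (\<iota> p) (n p) (differential A B \<iota> p x) = 0))"

definition pullback2 ::
    "('m, 6) chart set \<Rightarrow> ('b, 7) chart set \<Rightarrow> ('m \<Rightarrow> 'b) \<Rightarrow> ('b \<Rightarrow> (real ^ 7) form2) \<Rightarrow>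
     'm \<Rightarrow> (real ^ 6) form2" where
  "pullback2 A B \<iota> b p x y = b (\<iota> p) (differential A B \<iota> p x) (differential A B \<iota> p y)"

definition pullback3 ::
    "('m, 6) chart set \<Rightarrow> ('b, 7) chart set \<Rightarrow> ('m \<Rightarrow> 'b) \<Rightarrow> ('m \<Rightarrow> (real ^ 7) form3) \<Rightarrow>
     'm \<Rightarrow> (real ^ 6) form3" where
  "pullback3 A B \<iota> b p x y z =
     b p (differential A B \<iota> p x) (differential A B \<iota> p y) (differential A B \<iota> p z)"

definition induced_I ::
    "('m, 6) chart set \<Rightarrow> ('b, 7) chart set \<Rightarrow> ('b \<Rightarrow> (real ^ 7) form2) \<Rightarrow> ('b \<Rightarrow> (real ^ 7) form3) \<Rightarrow>
     ('m \<Rightarrow> 'b) \<Rightarrow> ('m \<Rightarrow> real ^ 7) \<Rightarrow> 'm \<Rightarrow> real ^ 6 \<Rightarrow> real ^ 6" where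
  "induced_I A B g \<phi> \<iota> n p x = (THE w.
     differential A B \<iota> p w = cross_product (g (\<iota> p)) (\<phi> (\<iota> p)) (n p) (differential A B \<iota> p x))"

definition psi_plus ::
    "('m, 6) chart set \<Rightarrow> ('b, 7) chart set \<Rightarrow> ('b \<Rightarrow> (real ^ 7) form2) \<Rightarrow> ('b \<Rightarrow> (real ^ 7) form3) \<Rightarrow>
     ('m \<Rightarrow> 'b) \<Rightarrow> ('m \<Rightarrow> real ^ 7) \<Rightarrow> ('m \<Rightarrow> real) \<Rightarrow> 'm \<Rightarrow> (real ^ 6) form3" where
  "psi_plus A B g \<phi> \<iota> n \<theta> p x y z =
     cos (\<theta> p) * pullback3 A B \<iota> (\<lambda>q. \<phi> (\<iota> q)) p x y z
   - sin (\<theta> p) * pullback3 A B \<iota> (\<lambda>q. star_phi (g (\<iota> q)) (\<phi> (\<iota> q)) (n q)) p x y z"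

definition psi_minus ::
    "('m, 6) chart set \<Rightarrow> ('b, 7) chart set \<Rightarrow> ('b \<Rightarrow> (real ^ 7) form2) \<Rightarrow> ('b \<Rightarrow> (real ^ 7) form3) \<Rightarrow>
     ('m \<Rightarrow> 'b) \<Rightarrow> ('m \<Rightarrow> real ^ 7) \<Rightarrow> ('m \<Rightarrow> real) \<Rightarrow> 'm \<Rightarrow> (real ^ 6) form3" where
  "psi_minus A B g \<phi> \<iota> n \<theta> p x y z =
     sin (\<theta> p) * pullback3 A B \<iota> (\<lambda>q. \<phi> (\<iota> q)) p x y z
   + cos (\<theta> p) * pullback3 A B \<iota> (\<lambda>q. star_phi (g (\<iota> q)) (\<phi> (\<iota> q)) (n q)) p x y z"

text \<open>The tangent vector \<open>y\<close> at \<open>p\<close> is extended to the coordinate field with constant components.\<close>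

definition second_fundamental_form ::
    "('m, 6) chart set \<Rightarrow> ('b, 7) chart set \<Rightarrow> ('b \<Rightarrow> (real ^ 7) form2) \<Rightarrow> ('m \<Rightarrow> 'b) \<Rightarrow>
     ('m \<Rightarrow> real ^ 7) \<Rightarrow> 'm \<Rightarrow> (real ^ 6) form2" where
  "second_fundamental_form A B g \<iota> n p x y =
     g (\<iota> p)
       (nabla_along A B g \<iota> (\<lambda>q. differential A B \<iota> q (coord_vector A (chart_at A p) q y)) p x)
       (n p)"

definition mean_curvature ::
    "('m, 6) chart set \<Rightarrow> ('b, 7) chart set \<Rightarrow> ('b \<Rightarrow> (real ^ 7) form2) \<Rightarrow> ('m \<Rightarrow> 'b) \<Rightarrow>
     ('m \<Rightarrow> real ^ 7) \<Rightarrow> 'm \<Rightarrow> real" where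
  "mean_curvature A B g \<iota> n p =
     1 / 6 * trace_form (pullback2 A B \<iota> g p) (second_fundamental_form A B g \<iota> n p)"

definition minimal_variety ::
    "('m, 6) chart set \<Rightarrow> ('b, 7) chart set \<Rightarrow> ('b \<Rightarrow> (real ^ 7) form2) \<Rightarrow> ('m \<Rightarrow> 'b) \<Rightarrow>
     ('m \<Rightarrow> real ^ 7) \<Rightarrow> bool" where
  "minimal_variety A B g \<iota> n \<longleftrightarrow> (\<forall>p. mean_curvature A B g \<iota> n p = 0)"

definition induced_su3_type ::
    "('m, 6) chart set \<Rightarrow> ('b, 7) chart set \<Rightarrow> ('b \<Rightarrow> (real ^ 7) form2) \<Rightarrow> ('b \<Rightarrow> (real ^ 7) form3) \<Rightarrow>
     ('m \<Rightarrow> 'b) \<Rightarrow> ('m \<Rightarrow> real ^ 7) \<Rightarrow> ('m \<Rightarrow> real) \<Rightarrow> su3_class set \<Rightarrow> bool" where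
  "induced_su3_type A B g \<phi> \<iota> n \<theta> =
     su3_type A (pullback2 A B \<iota> g) (induced_I A B g \<phi> \<iota> n)
       (psi_plus A B g \<phi> \<iota> n \<theta>) (psi_minus A B g \<phi> \<iota> n \<theta>)"

end

theory Submission
  imports Defs
begin

text \<open>
  At a point of \<open>M\<close> choose a frame adapted to the \<open>G\<^sub>2\<close>-structure whose first vector is \<open>n\<close>. Since
  \<open>\<nabla>\<phi>\<close> always has the form \<open>\<nabla>\<^sub>x \<phi> = R(x) \<lrcorner> *\<phi>\<close> with \<open>\<langle>R(x), y\<rangle> = r(x, y)\<close>, the Gauss and Weingarten formulas
  give \<open>\<nabla>\<^sub>x \<omega> = d \<lrcorner> \<iota>\<^sup>*\<phi>\<close> with \<open>\<langle>d, y\<rangle> = B(x, y) + r(x, I y)\<close>, that is \<open>\<nabla>\<^sub>x \<omega> = C x \<lrcorner> \<psi>\<^sub>+\<close> for the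
  endomorphism \<open>C\<close> with
  \<open>\<langle>C x, y\<rangle> = cos \<theta> (B(x, y) + r(x, I y)) + sin \<theta> (B(x, I y) - r(x, y))\<close>.
  The components of \<open>\<nabla>\<omega>\<close> are the pieces of \<open>C\<close>: multiples of the identity and of \<open>I\<close> for \<open>W\<^sub>1\<close>, the symmetric and
  the skew rest of the part commuting with \<open>I\<close> for \<open>W\<^sub>2\<close>, the symmetric and the skew part anticommuting with \<open>I\<close>
  for \<open>W\<^sub>3\<close> and \<open>W\<^sub>4\<close>. As \<open>B\<close> and \<open>r\<close> are symmetric, there is no \<open>W\<^sub>4\<close>-part. Finally
  \<open>(\<nabla>\<^sub>x - \<xi>\<^sub>x) \<psi>\<^sub>+ = (r(x, n) - d\<theta>(x)) \<psi>\<^sub>-\<close>, which determines \<open>\<eta>\<close>.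
\<close>

section \<open>Inner products and orthonormal frames\<close>

text \<open>The algebra rests on adapted frames: there every identity becomes a polynomial identity
  in coordinates. A frame adapted to \<phi> with first vector n is built from the octonionic
  identities of the cross product. Omitting n leaves a frame of the hypersurface in which the
  pullback of \<phi> is the real part of a complex volume form \<Omega>. The angle then costs
  nothing: \<open>\<psi>\<^sub>+\<close> is the real part of exp(i \<theta>) \<Omega>, which is the
  same model form in a rotated frame, so C is classified only once.

  The obstacle on the analytic side is that tangent vectors are components in preferred charts that
  are unrelated at neighbouring points. Hence only component functions in one fixed chart are
  differentiated, and product rules along a map into that chart turn the result into covariant
  derivatives at the base point. Objects given by definite descriptions, such as I, get their
  differentiability from tensors that determine them.\<close>

lemma bilinearI:
  assumes "\<And>x y z. b (x + y) z = b x z + b y z" "\<And>r x z. b (r *\<^sub>R x) z = r *\<^sub>R b x z"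
    and "\<And>x y z. b x (y + z) = b x y + b x z" "\<And>r x z. b x (r *\<^sub>R z) = r *\<^sub>R b x z"
  shows "bilinear b"
  by (simp add: bilinear_def linear_iff assms)

lemma trilinearI:
  fixes a :: "('v::real_vector) form3"
  assumes "\<And>x x' y z. a (x + x') y z = a x y z + a x' y z" "\<And>r x y z. a (r *\<^sub>R x) y z = r * a x y z"
    and "\<And>x y y' z. a x (y + y') z = a x y z + a x y' z" "\<And>r x y z. a x (r *\<^sub>R y) z = r * a x y z"
    and "\<And>x y z z'. a x y (z + z') = a x y z + a x y z'" "\<And>r x y z. a x y (r *\<^sub>R z) = r * a x y z"
  shows "trilinear a"
  by (simp add: trilinear_def linear_iff assms)

lemma trilinearD:
  assumes "trilinear a"
  shows "linear (\<lambda>x. a x y z)" "linear (\<lambda>y. a x y z)" "linear (a x y)"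
  using assms by (auto simp: trilinear_def)

lemmas trilinear_simps = trilinearD [THEN linear_add] trilinearD [THEN linear_cmul] trilinearD [THEN linear_neg]
  trilinearD [THEN linear_diff] trilinearD [THEN linear_0]

lemmas bilinear_simps = bilinear_ladd bilinear_radd bilinear_lmul bilinear_rmul bilinear_lneg bilinear_rneg

locale inner_form =
  fixes g :: "('v::real_vector) form2"
  assumes bilinear_g: "bilinear g" and sym: "g x y = g y x" and pos: "x \<noteq> 0 \<Longrightarrow> g x x > 0"
begin

lemmas g_simps [simp] =
  bilinear_ladd [OF bilinear_g] bilinear_radd [OF bilinear_g]
  bilinear_lsub [OF bilinear_g] bilinear_rsub [OF bilinear_g]
  bilinear_lneg [OF bilinear_g] bilinear_rneg [OF bilinear_g]
  bilinear_lzero [OF bilinear_g] bilinear_rzero [OF bilinear_g]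
  bilinear_lmul [OF bilinear_g] bilinear_rmul [OF bilinear_g]

lemma linear_g: "linear (g x)" "linear (\<lambda>x. g x y)"
  using bilinear_g by (auto simp: bilinear_def)

lemma sum_left: "g (sum f S) y = (\<Sum>i\<in>S. g (f i) y)"
  using linear_sum [OF linear_g(2)] .

lemma sum_right: "g x (sum f S) = (\<Sum>i\<in>S. g x (f i))"
  using linear_sum [OF linear_g(1)] .

lemma eqI: "(\<And>z. g x z = g y z) \<Longrightarrow> x = y"
  using pos [of "x - y"] by (metis eq_iff_diff_eq_0 g_simps(3) less_irrefl)

end

locale frame = inner_form g for g :: "(real ^ 'n::finite) form2" +
  fixes e :: "'n \<Rightarrow> real ^ 'n"
  assumes orthonormal: "orthonormal g e"
begin

lemma on: "g (e i) (e j) = (if i = j then 1 else 0)"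
  using orthonormal by (simp add: orthonormal_def)

lemma g_frame_sum: "g (e j) (\<Sum>i\<in>UNIV. a i *\<^sub>R e i) = a j"
  by (simp add: sum_right on if_distrib [of "\<lambda>t. a _ * t"] cong: if_cong)

text \<open>Frame and coordinates share the index type, so the injective map from coefficients to
  vectors is an endomorphism of a finite-dimensional space and hence surjective.\<close>

lemma expand: "x = (\<Sum>i\<in>UNIV. g (e i) x *\<^sub>R e i)"
proof -
  define T :: "real ^ 'n \<Rightarrow> real ^ 'n" where "T = (\<lambda>a. \<Sum>i\<in>UNIV. a $ i *\<^sub>R e i)"
  have "linear T"
    by (simp add: T_def linear_iff scaleR_add_left sum.distrib scaleR_sum_right)
  moreover have "inj T"
    by (rule injI) (metis T_def g_frame_sum vec_eq_iff)
  ultimately have "surj T"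
    by (rule linear_inj_imp_surj)
  then obtain a where a: "x = T a" by blast
  then have "g (e i) x = a $ i" for i
    by (simp add: T_def g_frame_sum)
  then show ?thesis using a by (simp add: T_def)
qed

lemma frame_eqI:
  assumes "\<And>i. g (e i) x = g (e i) y" shows "x = y"
proof -
  have "(\<Sum>i\<in>UNIV. g (e i) x *\<^sub>R e i) = (\<Sum>i\<in>UNIV. g (e i) y *\<^sub>R e i)"
    by (simp add: assms)
  then show ?thesis by (simp only: expand [symmetric])
qed

lemma parseval: "g x y = (\<Sum>i\<in>UNIV. g (e i) x * g (e i) y)"
proof -
  have "g x y = g (\<Sum>i\<in>UNIV. g (e i) x *\<^sub>R e i) y" by (simp only: expand [symmetric])
  then show ?thesis by (simp add: sum_left)
qed

lemma linear_expand:
  assumes "linear f" shows "f x = (\<Sum>i\<in>UNIV. g (e i) x *\<^sub>R f (e i))"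
proof -
  have "f x = f (\<Sum>i\<in>UNIV. g (e i) x *\<^sub>R e i)" by (simp only: expand [symmetric])
  then show ?thesis by (simp add: linear_sum [OF assms] linear_cmul [OF assms])
qed

lemma riesz:
  assumes "linear f" shows "\<exists>!w. \<forall>z. g w z = f z"
proof
  show *: "\<forall>z. g (\<Sum>i\<in>UNIV. f (e i) *\<^sub>R e i) z = f z"
  proof
    fix z show "g (\<Sum>i\<in>UNIV. f (e i) *\<^sub>R e i) z = f z"
      using linear_expand [OF assms, of z] by (simp add: sum_left mult.commute)
  qed
  fix w assume "\<forall>z. g w z = f z"
  with * show "w = (\<Sum>i\<in>UNIV. f (e i) *\<^sub>R e i)"
    by (intro eqI) simp
qed

lemma onb_frame: "frame g (onb g)"
  by unfold_locales (metis onb_def orthonormal someI)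

text \<open>The coefficient matrix between two orthonormal frames is orthogonal, so a trace depends
  on the metric only. This makes the arbitrary choice in \<open>onb\<close> harmless.\<close>

lemma sum_frames:
  fixes b :: "(real ^ 'n) form2"
  assumes "frame g e'" "bilinear b"
  shows "(\<Sum>i\<in>UNIV. b (e' i) (e' i)) = (\<Sum>i\<in>UNIV. b (e i) (e i))"
proof -
  interpret e': frame g e' by fact
  have lin: "linear (b x)" "linear (\<lambda>x. b x y)" for x y
    using assms by (auto simp: bilinear_def)
  have "b (e' i) (e' i) = (\<Sum>j\<in>UNIV. \<Sum>k\<in>UNIV. (g (e j) (e' i) * g (e k) (e' i)) * b (e j) (e k))" for i
    by (subst linear_expand [OF lin(2)], subst linear_expand [OF lin(1)])
       (simp add: sum_distrib_left mult.assoc)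
  then have "(\<Sum>i\<in>UNIV. b (e' i) (e' i)) =
      (\<Sum>i\<in>UNIV. \<Sum>j\<in>UNIV. \<Sum>k\<in>UNIV. (g (e j) (e' i) * g (e k) (e' i)) * b (e j) (e k))"
    by simp
  also have "\<dots> = (\<Sum>j\<in>UNIV. \<Sum>i\<in>UNIV. \<Sum>k\<in>UNIV. (g (e j) (e' i) * g (e k) (e' i)) * b (e j) (e k))"
    by (rule sum.swap)
  also have "\<dots> = (\<Sum>j\<in>UNIV. \<Sum>k\<in>UNIV. \<Sum>i\<in>UNIV. (g (e j) (e' i) * g (e k) (e' i)) * b (e j) (e k))"
    by (rule sum.cong [OF refl], rule sum.swap)
  also have "\<dots> = (\<Sum>j\<in>UNIV. \<Sum>k\<in>UNIV. g (e j) (e k) * b (e j) (e k))"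
  proof (intro sum.cong refl)
    fix j k
    have "g (e j) (e k) = (\<Sum>i\<in>UNIV. g (e j) (e' i) * g (e k) (e' i))"
      using e'.parseval [of "e j" "e k"] by (simp only: sym [of "e' _" "e _"])
    then show "(\<Sum>i\<in>UNIV. g (e j) (e' i) * g (e k) (e' i) * b (e j) (e k)) = g (e j) (e k) * b (e j) (e k)"
      by (simp only: sum_distrib_right)
  qed
  also have "\<dots> = (\<Sum>i\<in>UNIV. b (e i) (e i))"
    by (simp add: on if_distrib [of "\<lambda>t. t * _"] cong: if_cong)
  finally show ?thesis .
qed

lemma trace_form_frame: "bilinear b \<Longrightarrow> trace_form g b = (\<Sum>i\<in>UNIV. b (e i) (e i))"
  unfolding trace_form_def using sum_frames onb_frame by blast

text \<open>The frame is exchanged one slot at a time: with the other slot fixed, the sum is the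
  trace of a bilinear form.\<close>

lemma inner2_frame:
  assumes a: "bilinear a" and b: "bilinear b"
  shows "inner2 g a b = 1 / 2 * (\<Sum>i\<in>UNIV. \<Sum>j\<in>UNIV. a (e i) (e j) * b (e i) (e j))"
proof -
  note [simp] = bilinear_simps [OF a] bilinear_simps [OF b]
  let ?o = "onb g"
  have "(\<Sum>i\<in>UNIV. \<Sum>j\<in>UNIV. a (?o i) (?o j) * b (?o i) (?o j))
      = (\<Sum>i\<in>UNIV. \<Sum>j\<in>UNIV. a (?o i) (e j) * b (?o i) (e j))"
    by (rule sum.cong [OF refl], rule sum_frames [OF onb_frame, of "\<lambda>y z. a (?o _) y * b (?o _) z"])
       (rule bilinearI; simp add: algebra_simps)
  also have "\<dots> = (\<Sum>i\<in>UNIV. \<Sum>j\<in>UNIV. a (e i) (e j) * b (e i) (e j))"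
    by (rule sum_frames [OF onb_frame, of "\<lambda>x z. \<Sum>j\<in>UNIV. a x (e j) * b z (e j)"])
       (rule bilinearI; simp add: algebra_simps sum.distrib sum_distrib_left)
  finally show ?thesis by (simp add: inner2_def)
qed

lemma inner3_frame:
  assumes a: "trilinear a" and b: "trilinear b"
  shows "inner3 g a b =
    1 / 6 * (\<Sum>i\<in>UNIV. \<Sum>j\<in>UNIV. \<Sum>k\<in>UNIV. a (e i) (e j) (e k) * b (e i) (e j) (e k))"
proof -
  note [simp] = trilinear_simps [OF a] trilinear_simps [OF b]
  let ?o = "onb g"
  have "(\<Sum>i\<in>UNIV. \<Sum>j\<in>UNIV. \<Sum>k\<in>UNIV. a (?o i) (?o j) (?o k) * b (?o i) (?o j) (?o k))
      = (\<Sum>i\<in>UNIV. \<Sum>j\<in>UNIV. \<Sum>k\<in>UNIV. a (?o i) (?o j) (e k) * b (?o i) (?o j) (e k))"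
    by (rule sum.cong [OF refl], rule sum.cong [OF refl],
        rule sum_frames [OF onb_frame, of "\<lambda>y z. a (?o _) (?o _) y * b (?o _) (?o _) z"])
       (rule bilinearI; simp add: algebra_simps)
  also have "\<dots> = (\<Sum>i\<in>UNIV. \<Sum>j\<in>UNIV. \<Sum>k\<in>UNIV. a (?o i) (e j) (e k) * b (?o i) (e j) (e k))"
    by (rule sum.cong [OF refl],
        rule sum_frames [OF onb_frame, of "\<lambda>y z. \<Sum>k\<in>UNIV. a (?o _) y (e k) * b (?o _) z (e k)"])
       (rule bilinearI; simp add: algebra_simps sum.distrib sum_distrib_left)
  also have "\<dots> = (\<Sum>i\<in>UNIV. \<Sum>j\<in>UNIV. \<Sum>k\<in>UNIV. a (e i) (e j) (e k) * b (e i) (e j) (e k))"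
    by (rule sum_frames [OF onb_frame,
          of "\<lambda>x z. \<Sum>j\<in>UNIV. \<Sum>k\<in>UNIV. a x (e j) (e k) * b z (e j) (e k)"])
       (rule bilinearI; simp add: algebra_simps sum.distrib sum_distrib_left)
  finally show ?thesis by (simp add: inner3_def fact_numeral)
qed

end

section \<open>Pointwise \<open>G\<^sub>2\<close> geometry\<close>

lemma exhaust_7:
  fixes x :: 7
  shows "x = 0 \<or> x = 1 \<or> x = 2 \<or> x = 3 \<or> x = 4 \<or> x = 5 \<or> x = 6"
proof (induct x)
  case (of_int z)
  then have "0 \<le> z" and "z < 7" by simp_all
  then have "z = 0 \<or> z = 1 \<or> z = 2 \<or> z = 3 \<or> z = 4 \<or> z = 5 \<or> z = 6" by arith
  then show ?case by auto
qed

lemma UNIV_7: "UNIV = {0, 1, 2, 3, 4, 5, 6 :: 7}"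
  using exhaust_7 by auto

lemma forall_7: "(\<forall>i::7. P i) \<longleftrightarrow> P 0 \<and> P 1 \<and> P 2 \<and> P 3 \<and> P 4 \<and> P 5 \<and> P 6"
  unfolding ball_UNIV [symmetric] UNIV_7 by simp

lemma sum_7: "sum f (UNIV::7 set) = f 0 + f 1 + f 2 + f 3 + f 4 + f 5 + f 6"
  unfolding UNIV_7 by (simp add: ac_simps)

text \<open>Index sums such as \<open>i + 3\<close> evaluate to numerals above 6; these are brought
  back to the seven frame indices.\<close>

lemma numeral_7: "(7::7) = 0" "(8::7) = 1" "(9::7) = 2" "(10::7) = 3" "(11::7) = 4" "(12::7) = 5"
  by simp_all

lemma wedge3_skew: "wedge3 a b c y x z = - wedge3 a b c x y z" "wedge3 a b c x z y = - wedge3 a b c x y z"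
  by (simp_all add: wedge3_def wedge2_def algebra_simps)

lemma wedge4_skew:
  "wedge4 a b c d y x z w = - wedge4 a b c d x y z w"
  "wedge4 a b c d x z y w = - wedge4 a b c d x y z w"
  "wedge4 a b c d x y w z = - wedge4 a b c d x y z w"
  by (simp_all add: wedge4_def wedge3_def wedge2_def algebra_simps)

lemma (in inner_form) wedge_simps:
  "wedge3 (g a) (g b) (g c) (x + x') y z = wedge3 (g a) (g b) (g c) x y z + wedge3 (g a) (g b) (g c) x' y z"
  "wedge3 (g a) (g b) (g c) (r *\<^sub>R x) y z = r * wedge3 (g a) (g b) (g c) x y z"
  "wedge3 (g a) (g b) (g c) x (y + y') z = wedge3 (g a) (g b) (g c) x y z + wedge3 (g a) (g b) (g c) x y' z"
  "wedge3 (g a) (g b) (g c) x (r *\<^sub>R y) z = r * wedge3 (g a) (g b) (g c) x y z"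
  "wedge3 (g a) (g b) (g c) x y (z + z') = wedge3 (g a) (g b) (g c) x y z + wedge3 (g a) (g b) (g c) x y z'"
  "wedge3 (g a) (g b) (g c) x y (r *\<^sub>R z) = r * wedge3 (g a) (g b) (g c) x y z"
  "wedge4 (g a) (g b) (g c) (g d) (x + x') y z w = wedge4 (g a) (g b) (g c) (g d) x y z w + wedge4 (g a) (g b) (g c) (g d) x' y z w"
  "wedge4 (g a) (g b) (g c) (g d) (r *\<^sub>R x) y z w = r * wedge4 (g a) (g b) (g c) (g d) x y z w"
  "wedge4 (g a) (g b) (g c) (g d) x (y + y') z w = wedge4 (g a) (g b) (g c) (g d) x y z w + wedge4 (g a) (g b) (g c) (g d) x y' z w"
  "wedge4 (g a) (g b) (g c) (g d) x (r *\<^sub>R y) z w = r * wedge4 (g a) (g b) (g c) (g d) x y z w"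
  "wedge4 (g a) (g b) (g c) (g d) x y (z + z') w = wedge4 (g a) (g b) (g c) (g d) x y z w + wedge4 (g a) (g b) (g c) (g d) x y z' w"
  "wedge4 (g a) (g b) (g c) (g d) x y (r *\<^sub>R z) w = r * wedge4 (g a) (g b) (g c) (g d) x y z w"
  "wedge4 (g a) (g b) (g c) (g d) x y z (w + w') = wedge4 (g a) (g b) (g c) (g d) x y z w + wedge4 (g a) (g b) (g c) (g d) x y z w'"
  "wedge4 (g a) (g b) (g c) (g d) x y z (r *\<^sub>R w) = r * wedge4 (g a) (g b) (g c) (g d) x y z w"
  by (simp_all add: wedge4_def wedge3_def wedge2_def algebra_simps)

text \<open>Coordinates of the octonionic cross product. The three index pairs complete
  \<open>k\<close> to the three lines {i, i + 1, i + 3} of the Fano plane through \<open>k\<close>,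
  in cyclic order.\<close>

definition cross7 :: "(7 \<Rightarrow> real) \<Rightarrow> (7 \<Rightarrow> real) \<Rightarrow> 7 \<Rightarrow> real" where
  "cross7 x y k = wedge2 (\<lambda>x. x (k + 1)) (\<lambda>x. x (k + 3)) x y
     + wedge2 (\<lambda>x. x (k + 2)) (\<lambda>x. x (k + 6)) x y + wedge2 (\<lambda>x. x (k + 4)) (\<lambda>x. x (k + 5)) x y"

lemma g2_form_cross7:
  "g2_form g e x y z = (\<Sum>k\<in>UNIV. cross7 (\<lambda>i. g (e i) x) (\<lambda>i. g (e i) y) k * g (e k) z)"
  apply (simp only: g2_form_def sum_7 wedge3_def wedge2_def cross7_def)
  apply (simp add: numeral_7)
  by algebra

text \<open>The dual form measures the failure of the Lagrange identity for the cross product. Read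
  backwards, this expresses the dual form by the metric and \<phi> alone.\<close>

lemma cross7_cross7:
  "(\<Sum>k\<in>UNIV. cross7 (\<lambda>i. g (e i) x) (\<lambda>i. g (e i) y) k * cross7 (\<lambda>i. g (e i) z) (\<lambda>i. g (e i) w) k) =
   (\<Sum>k\<in>UNIV. g (e k) x * g (e k) z) * (\<Sum>k\<in>UNIV. g (e k) y * g (e k) w)
   - (\<Sum>k\<in>UNIV. g (e k) x * g (e k) w) * (\<Sum>k\<in>UNIV. g (e k) y * g (e k) z)
   - g2_dual_form g e x y z w"
  apply (simp only: g2_dual_form_def sum_7 wedge4_def wedge3_def wedge2_def cross7_def)
  apply (simp add: numeral_7)
  by algebra

locale g2_frame = frame g e for g :: "(real ^ 7) form2" and e +
  fixes \<phi> :: "(real ^ 7) form3"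
  assumes phi: "\<phi> = g2_form g e"
begin

abbreviation "P \<equiv> cross_product g \<phi>"

lemma phi_simps [simp]:
  "\<phi> (x + x') y z = \<phi> x y z + \<phi> x' y z" "\<phi> (r *\<^sub>R x) y z = r * \<phi> x y z"
  "\<phi> x (y + y') z = \<phi> x y z + \<phi> x y' z" "\<phi> x (r *\<^sub>R y) z = r * \<phi> x y z"
  "\<phi> x y (z + z') = \<phi> x y z + \<phi> x y z'" "\<phi> x y (r *\<^sub>R z) = r * \<phi> x y z"
  unfolding phi g2_form_def by (simp_all add: wedge_simps sum.distrib sum_distrib_left)

lemma trilinear_phi: "trilinear \<phi>"
  by (rule trilinearI) simp_all

lemmas phi_neg [simp] = trilinearD [OF trilinear_phi, THEN linear_neg]

lemma phi_skew: "\<phi> y x z = - \<phi> x y z" "\<phi> x z y = - \<phi> x y z"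
  unfolding phi g2_form_def
  by (simp_all only: wedge3_skew(1) [of _ _ _ y x] wedge3_skew(2) [of _ _ _ x z] sum_negf)

lemma phi_cyc: "\<phi> y z x = \<phi> x y z"
  by (metis phi_skew minus_minus)

lemma P: "g (P x y) z = \<phi> x y z"
proof -
  have "\<exists>!w. \<forall>z. g w z = \<phi> x y z"
    by (rule riesz) (rule trilinearD(3) [OF trilinear_phi])
  from theI' [OF this] show ?thesis
    unfolding cross_product_def by blast
qed

lemma P_coord: "g (e k) (P x y) = cross7 (\<lambda>i. g (e i) x) (\<lambda>i. g (e i) y) k"
proof -
  have "g (e k) (P x y) = \<phi> x y (e k)" by (simp add: sym [of "e k"] P)
  then show ?thesis
    by (simp add: phi g2_form_cross7 on if_distrib [of "\<lambda>t. _ * t"] cong: if_cong)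
qed

lemma P_inner: "g (P x y) (P z w) = g x z * g y w - g x w * g y z - g2_dual_form g e x y z w"
  by (simp only: parseval [of "P x y"] P_coord cross7_cross7 parseval [of x] parseval [of y])

text \<open>By \<open>P_inner\<close> the dual form is determined by the metric and the cross
  product, neither of which refers to a frame. So all adapted frames agree and the definite
  description is meaningful.\<close>

lemma star_phi: "star_phi g \<phi> = g2_dual_form g e"
  unfolding star_phi_def
proof (rule the_equality)
  show "\<exists>e'. orthonormal g e' \<and> \<phi> = g2_form g e' \<and> g2_dual_form g e = g2_dual_form g e'"
    using orthonormal phi by blast
  fix s assume "\<exists>e'. orthonormal g e' \<and> \<phi> = g2_form g e' \<and> s = g2_dual_form g e'"
  then obtain e' where e': "orthonormal g e'" "\<phi> = g2_form g e'" "s = g2_dual_form g e'" by blast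
  interpret e': g2_frame g e' \<phi> by unfold_locales fact+
  show "s = g2_dual_form g e"
    unfolding e'(3)
  proof (intro ext)
    fix x y z w
    show "g2_dual_form g e' x y z w = g2_dual_form g e x y z w"
      using P_inner [of x y z w] e'.P_inner [of x y z w] by simp
  qed
qed

lemma dual_simps [simp]:
  "g2_dual_form g e (x + x') y z w = g2_dual_form g e x y z w + g2_dual_form g e x' y z w"
  "g2_dual_form g e (r *\<^sub>R x) y z w = r * g2_dual_form g e x y z w"
  "g2_dual_form g e x (y + y') z w = g2_dual_form g e x y z w + g2_dual_form g e x y' z w"
  "g2_dual_form g e x (r *\<^sub>R y) z w = r * g2_dual_form g e x y z w"
  "g2_dual_form g e x y (z + z') w = g2_dual_form g e x y z w + g2_dual_form g e x y z' w"
  "g2_dual_form g e x y (r *\<^sub>R z) w = r * g2_dual_form g e x y z w"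
  "g2_dual_form g e x y z (w + w') = g2_dual_form g e x y z w + g2_dual_form g e x y z w'"
  "g2_dual_form g e x y z (r *\<^sub>R w) = r * g2_dual_form g e x y z w"
  unfolding g2_dual_form_def by (simp_all add: wedge_simps sum.distrib sum_distrib_left)

lemma dual_skew:
  "g2_dual_form g e y x z w = - g2_dual_form g e x y z w"
  "g2_dual_form g e x z y w = - g2_dual_form g e x y z w"
  "g2_dual_form g e x y w z = - g2_dual_form g e x y z w"
  unfolding g2_dual_form_def
  by (simp_all only: wedge4_skew(1) [of _ _ _ _ y x] wedge4_skew(2) [of _ _ _ _ x z]
      wedge4_skew(3) [of _ _ _ _ x y w] sum_negf)

lemma trilinear_dual: "trilinear (g2_dual_form g e x)"
  by (rule trilinearI) simp_all

text \<open>Every index occurs in four of the seven terms of the dual form, whence the factor 4; it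
  cancels the 1/4 in \<open>rbar\<close>.\<close>

lemma inner3_dual: "inner3 g (g2_dual_form g e x) (g2_dual_form g e y) = 4 * g x y"
proof -
  define F where "F i j k = g2_dual_form g e x (e i) (e j) (e k) * g2_dual_form g e y (e i) (e j) (e k)" for i j k
  \<comment> \<open>Both factors change sign under an exchange, so the full sum is 6 times the sum
    over the 35 increasing triples, which cancels the 1/6.\<close>
  have swap: "F j i k = F i j k" "F i k j = F i j k" for i j k
    by (simp_all add: F_def dual_skew(2) [of _ "e j" "e i"] dual_skew(3) [of _ _ "e k" "e j"])
  have diag: "F i i k = 0" "F i k i = 0" "F k i i = 0" for i k
    using dual_skew(2) [of x "e i" "e i" "e k"] dual_skew(3) [of x "e k" "e i" "e i"] swap(2) [of i k i]
    by (simp_all add: F_def)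
  have "inner3 g (g2_dual_form g e x) (g2_dual_form g e y) = 1 / 6 * (\<Sum>i\<in>UNIV. \<Sum>j\<in>UNIV. \<Sum>k\<in>UNIV. F i j k)"
    by (simp add: inner3_frame trilinear_dual F_def)
  also have "\<dots> = F 0 1 2 + F 0 1 3 + F 0 1 4 + F 0 1 5 + F 0 1 6 + F 0 2 3 + F 0 2 4 + F 0 2 5 + F 0 2 6 + F 0 3 4 + F 0 3 5 + F 0 3 6 + F 0 4 5 + F 0 4 6 + F 0 5 6 + F 1 2 3 + F 1 2 4 + F 1 2 5 + F 1 2 6 + F 1 3 4 + F 1 3 5 + F 1 3 6 + F 1 4 5 + F 1 4 6 + F 1 5 6 + F 2 3 4 + F 2 3 5 + F 2 3 6 + F 2 4 5 + F 2 4 6 + F 2 5 6 + F 3 4 5 + F 3 4 6 + F 3 5 6 + F 4 5 6"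
    by (simp add: sum_7 diag swap)
  also have "\<dots> = 4 * g x y"
    by (simp add: F_def g2_dual_form_def sum_7 wedge4_def wedge3_def wedge2_def on numeral_7 parseval [of x])
  finally show ?thesis .
qed

text \<open>The tangent space to the orbit of \<open>\<phi>\<close> under the rotation group consists of contractions of
  the dual form, since \<open>so(7)\<close> is the sum of \<open>g\<^sub>2\<close> and a copy of the seven-dimensional
  representation.\<close>

lemma derivation_dual:
  fixes a :: "7 \<Rightarrow> 7 \<Rightarrow> real"
  assumes skew: "\<And>i j. a i j = - a j i"
    and \<alpha>: "\<And>i x. \<alpha> i x = (\<Sum>j\<in>UNIV. a i j * g (e j) x)"
  shows "\<exists>s. \<forall>x y z. (\<Sum>i\<in>UNIV. wedge3 (\<alpha> i) (g (e (i + 1))) (g (e (i + 3))) x y z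
      + wedge3 (g (e i)) (\<alpha> (i + 1)) (g (e (i + 3))) x y z
      + wedge3 (g (e i)) (g (e (i + 1))) (\<alpha> (i + 3)) x y z) = g2_dual_form g e s x y z"
proof (intro exI allI)
  \<comment> \<open>The components are half the contraction of \<open>a\<close> with \<phi>: this is
    the projection of \<open>so(7)\<close> onto its seven-dimensional summand, with kernel
    \<open>g\<^sub>2\<close>.\<close>
  let ?s = "\<Sum>k\<in>UNIV. (a (k + 1) (k + 3) + a (k + 2) (k + 6) + a (k + 4) (k + 5)) *\<^sub>R e k"
  fix x y z
  have diag: "a i i = 0" for i using skew [of i i] by simp
  note sk = skew [of 1 0] skew [of 2 0] skew [of 3 0] skew [of 4 0] skew [of 5 0] skew [of 6 0] skew [of 2 1] skew [of 3 1] skew [of 4 1] skew [of 5 1] skew [of 6 1] skew [of 3 2] skew [of 4 2] skew [of 5 2] skew [of 6 2] skew [of 4 3] skew [of 5 3] skew [of 6 3] skew [of 5 4] skew [of 6 4] skew [of 6 5]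
  have coord: "g (e i) ?s = a (i + 1) (i + 3) + a (i + 2) (i + 6) + a (i + 4) (i + 5)" for i
    by (rule g_frame_sum)
  show "(\<Sum>i\<in>UNIV. wedge3 (\<alpha> i) (g (e (i + 1))) (g (e (i + 3))) x y z
      + wedge3 (g (e i)) (\<alpha> (i + 1)) (g (e (i + 3))) x y z
      + wedge3 (g (e i)) (g (e (i + 1))) (\<alpha> (i + 3)) x y z) = g2_dual_form g e ?s x y z"
    unfolding g2_dual_form_def wedge4_def wedge3_def wedge2_def coord
    apply (simp only: sum_7 \<alpha>)
    apply (simp add: numeral_7 diag sk)
    by algebra
qed

lemma P_eqI: "(\<And>z. \<phi> x y z = g w z) \<Longrightarrow> P x y = w"
  by (rule eqI) (simp add: P)

lemma P_simps [simp]: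
  "P (- x) y = - P x y" "P x (- y) = - P x y"
  by (rule P_eqI, simp add: P)+

lemma P_skew: "P y x = - P x y"
  by (rule P_eqI) (simp add: P phi_skew(1) [of y x])

lemma P_self [simp]: "P x x = 0"
  by (rule P_eqI) (use phi_skew(1) [of x x] in simp)

lemma phi_self [simp]: "\<phi> x x y = 0" "\<phi> x y x = 0" "\<phi> y x x = 0"
  using phi_skew(1) [of x x y] phi_skew(2) [of y x x] phi_cyc [of x y x] by simp_all

lemma dual_self [simp]:
  "g2_dual_form g e x x y z = 0" "g2_dual_form g e x y x z = 0" "g2_dual_form g e x y z x = 0"
  "g2_dual_form g e y x x z = 0"
  using dual_skew(1) [of x x y z] dual_skew(2) [of x x y z] dual_skew(3) [of x y x z]
    dual_skew(2) [of y x x z] dual_skew(2) [of x y x z] by simp_all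

text \<open>The double product contains a term of the dual form that is alternating in
  \<open>x\<close> and \<open>z\<close>; it cancels on symmetrising. What remains is the polarised
  form of \<open>P_P\<close>.\<close>

lemma P_anti: "P x (P z y) = - P z (P x y) + (- 2 * g x z) *\<^sub>R y + g x y *\<^sub>R z + g z y *\<^sub>R x"
proof (rule P_eqI)
  fix w
  have *: "\<phi> u (P v y) w = g u y * g w v - g u v * g w y + g2_dual_form g e u w v y" for u v
  proof -
    have "\<phi> u (P v y) w = - g (P u w) (P v y)"
      by (simp add: P phi_skew(2) [of u "P v y" w])
    then show ?thesis by (simp add: P_inner algebra_simps)
  qed
  have "g2_dual_form g e z w x y = - g2_dual_form g e x w z y"
    by (metis dual_skew(1,2) minus_minus)
  then show "\<phi> x (P z y) w = g (- P z (P x y) + (- 2 * g x z) *\<^sub>R y + g x y *\<^sub>R z + g z y *\<^sub>R x) w"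
    by (simp add: P * sym [of w] sym [of z x] algebra_simps)
qed

lemma P_P: "P x (P x y) = (- g x x) *\<^sub>R y + g x y *\<^sub>R x"
proof (rule eqI)
  fix z
  show "g (P x (P x y)) z = g ((- g x x) *\<^sub>R y + g x y *\<^sub>R x) z"
    using arg_cong [OF P_anti [of x x y], of "\<lambda>w. g w z"]
    by (simp only: g_simps) (simp add: algebra_simps)
qed

text \<open>The three linear conditions are padded with zeros to an endomorphism. It misses
  \<open>axis 3 1\<close>, so it is not surjective and therefore has a kernel.\<close>

lemma exists_unit_orthogonal: "\<exists>v. g v v = 1 \<and> g a v = 0 \<and> g b v = 0 \<and> g c v = 0"
proof -
  define T :: "real ^ 7 \<Rightarrow> real ^ 7" where
    "T v = (\<chi> i. if i = 0 then g a v else if i = 1 then g b v else if i = 2 then g c v else 0)" for v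
  have "linear T"
    by (auto simp: T_def linear_iff vec_eq_iff)
  moreover have "\<not> surj T"
  proof
    assume "surj T"
    then obtain v where "T v = axis 3 1" by (metis surjD)
    then have "T v $ 3 = 1" by (simp add: axis_def)
    then show False by (simp add: T_def)
  qed
  ultimately obtain v where "v \<noteq> 0" and v: "T v = 0"
    by (metis linear_inj_imp_surj linear_injective_0)
  have z: "g a v = 0" "g b v = 0" "g c v = 0"
    using v [THEN arg_cong [where f = "\<lambda>w. w $ 0"]] v [THEN arg_cong [where f = "\<lambda>w. w $ 1"]]
      v [THEN arg_cong [where f = "\<lambda>w. w $ 2"]] by (simp_all add: T_def)
  have "g v v > 0" using \<open>v \<noteq> 0\<close> by (rule pos)
  then have "g (v /\<^sub>R sqrt (g v v)) (v /\<^sub>R sqrt (g v v)) = 1"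
    by (simp add: field_simps)
  with z show ?thesis by (intro exI [of _ "v /\<^sub>R sqrt (g v v)"]) simp
qed

text \<open>As with octonions, an orthonormal triple whose third vector is also orthogonal to the
  product of the first two generates everything: its products complete the frame, and the identities
  of \<open>P\<close> fix the whole multiplication table, that is, \<phi>.\<close>

lemma adapted_frame:
  assumes "g v v = 1"
  obtains f where "g2_frame g f \<phi>" "f 0 = v"
proof -
  obtain e1 where e1: "g e1 e1 = 1" "g v e1 = 0" using exists_unit_orthogonal by blast
  obtain e2 where e2: "g e2 e2 = 1" "g v e2 = 0" "g e1 e2 = 0" "g (P v e1) e2 = 0"
    using exists_unit_orthogonal by blast
  \<comment> \<open>The numbering follows the lines {0, 1, 3}, {1, 2, 4}, {4, 5, 0} and {6, 0, 2} of
    \<phi>.\<close>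
  define f :: "7 \<Rightarrow> real ^ 7" where
    "f i = (if i = 0 then v else if i = 1 then e1 else if i = 2 then e2 else if i = 3 then P v e1
      else if i = 4 then P e1 e2 else if i = 5 then P v (P e1 e2) else P v e2)" for i
  have f: "f 3 = P (f 0) (f 1)" "f 4 = P (f 1) (f 2)" "f 5 = P (f 0) (f 4)" "f 6 = P (f 0) (f 2)"
    by (simp_all add: f_def)
  have g1: "g (f 0) (f 0) = 1" "g (f 1) (f 1) = 1" "g (f 2) (f 2) = 1"
    "g (f 0) (f 1) = 0" "g (f 0) (f 2) = 0" "g (f 1) (f 2) = 0"
    and phi012: "\<phi> (f 0) (f 1) (f 2) = 0"
    using assms e1 e2 by (simp_all add: f_def P)
  have P_inner': "g (P x y) (P x z) = g x x * g y z - g x z * g y x" for x y z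
    by (simp add: P_inner)
  have P_inner'': "g (P y x) (P x z) = - (g x x * g y z - g x z * g y x)"
    "g (P x y) (P z x) = - (g x x * g y z - g x z * g y x)"
    "g (P y x) (P z x) = g x x * g y z - g x z * g y x" for x y z
    by (simp_all add: P_inner' P_skew [of y x] P_skew [of z x])
  note ss = sym [of "f 1" "f 0"] sym [of "f 2" "f 0"] sym [of "f 3" "f 0"] sym [of "f 4" "f 0"] sym [of "f 5" "f 0"] sym [of "f 6" "f 0"] sym [of "f 2" "f 1"] sym [of "f 3" "f 1"] sym [of "f 4" "f 1"] sym [of "f 5" "f 1"] sym [of "f 6" "f 1"] sym [of "f 3" "f 2"] sym [of "f 4" "f 2"] sym [of "f 5" "f 2"] sym [of "f 6" "f 2"] sym [of "f 4" "f 3"] sym [of "f 5" "f 3"] sym [of "f 6" "f 3"] sym [of "f 5" "f 4"] sym [of "f 6" "f 4"] sym [of "f 6" "f 5"]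
  have P': "g x (P y z) = \<phi> y z x" for x y z by (simp add: sym [of x] P)
  have g3: "g (f 0) (f 3) = 0" "g (f 1) (f 3) = 0" "g (f 2) (f 3) = 0"
    by (simp_all add: f(1) P' phi012)
  have g6: "g (f 0) (f 6) = 0" "g (f 1) (f 6) = 0" "g (f 2) (f 6) = 0"
    using phi_skew(2) [of "f 0" "f 2" "f 1"] phi012 by (simp_all add: f(4) P')
  have g4: "g (f 0) (f 4) = 0" "g (f 1) (f 4) = 0" "g (f 2) (f 4) = 0"
    using phi_cyc [of "f 1" "f 2" "f 0"] phi012 by (simp_all add: f(2) P')
  have g346: "g (f 3) (f 3) = 1" "g (f 6) (f 6) = 1" "g (f 4) (f 4) = 1" "g (f 3) (f 6) = 0"
    by (simp_all add: f(1,2,4) P_inner' g1 ss)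
  have g34: "g (f 3) (f 4) = 0"
    by (simp add: f(1,2) P_inner'' g1 ss)
  have g46: "g (f 4) (f 6) = 0"
    by (simp add: f(2,4) P_inner'' g1 ss)
  have "\<phi> (f 0) (f 4) (f 1) = - g (f 3) (f 4)"
    by (simp add: f(1) P phi_skew(2) [of "f 0" "f 4"])
  moreover have "\<phi> (f 0) (f 4) (f 2) = - g (f 4) (f 6)"
    by (simp add: f(4) P' phi_skew(2) [of "f 0" "f 4"])
  ultimately have g5: "g (f 0) (f 5) = 0" "g (f 1) (f 5) = 0" "g (f 2) (f 5) = 0" "g (f 4) (f 5) = 0"
    using g34 g46 by (simp_all add: f(3) P')
  have g55: "g (f 5) (f 5) = 1"
    by (simp add: f(3) P_inner' g1 g4 g346)
  have g35: "g (f 3) (f 5) = 0" "g (f 5) (f 6) = 0"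
    by (simp_all add: f(1,3,4) P_inner' g1 g4 ss)
  note g = g1 g3 g4 g5 g6 g34 g35 g46 g346 g55
  have on': "orthonormal g f"
    using g by (simp add: orthonormal_def forall_7 ss)
  have gg: "g (f i) (f j) = (if i = j then 1 else 0)" for i j
    using on' by (simp add: orthonormal_def)
  note P_anti' = P_anti [of "f _" "f _" "f _", unfolded gg]
  note P_P' = P_P [of "f _" "f _", unfolded gg]
  \<comment> \<open>The other products follow in stages. For orthonormal vectors, \<open>P_P\<close>
    turns \<open>P x y = z\<close> into \<open>P x z = - y\<close>, and \<open>P_anti\<close>
    exchanges the two outer factors of a nested product.\<close>
  have p0: "P (f 0) (f 1) = f 3" "P (f 0) (f 2) = f 6" "P (f 0) (f 4) = f 5"
    "P (f 1) (f 2) = f 4" by (simp_all add: f)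
  have p1: "P (f 0) (f 3) = - f 1" "P (f 0) (f 6) = - f 2" "P (f 0) (f 5) = - f 4" "P (f 1) (f 4) = - f 2"
    using P_P' [of 0 1] P_P' [of 0 2] P_P' [of 0 4] P_P' [of 1 2] by (simp_all add: p0)
  have p2: "P (f 1) (f 3) = f 0" "P (f 2) (f 4) = f 1" "P (f 2) (f 6) = f 0" "P (f 4) (f 5) = f 0"
    using P_P' [of 1 0] P_P' [of 2 1] P_P' [of 2 0] P_P' [of 4 0]
    by (simp_all add: P_skew [of "f 1" "f 0"] P_skew [of "f 2" "f 1"] P_skew [of "f 2" "f 0"] P_skew [of "f 4" "f 0"] p0)
  have p3: "P (f 1) (f 5) = f 6" "P (f 1) (f 6) = - f 5" "P (f 2) (f 3) = f 5" "P (f 2) (f 5) = - f 3"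
    using P_anti' [of 1 0 4] P_anti' [of 1 0 2] P_anti' [of 2 0 1] P_anti' [of 2 0 4]
    by (simp_all add: P_skew [of "f 2" "f 1"] p0 p1 p2)
  have p4: "P (f 3) (f 4) = f 6" "P (f 3) (f 5) = f 2"
    using P_anti' [of 3 1 2] P_P' [of 3 2]
    by (simp_all add: P_skew [of "f 3" "f 2"] p0 p3)
  have p5: "P (f 3) (f 6) = - f 4" "P (f 4) (f 6) = f 3" "P (f 5) (f 6) = f 1"
    using P_P' [of 3 4] P_P' [of 4 3] P_P' [of 5 1]
    by (simp_all add: P_skew [of "f 4" "f 3"] P_skew [of "f 5" "f 1"] p3 p4)
  have pp: "\<phi> (f i) (f j) z = g (P (f i) (f j)) z" for i j z by (simp add: P)
  note ps = p0 p1 p2 p3 p4 p5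
  note sk = P_skew [of "f 1" "f 0"] P_skew [of "f 2" "f 0"] P_skew [of "f 3" "f 0"] P_skew [of "f 4" "f 0"] P_skew [of "f 5" "f 0"] P_skew [of "f 6" "f 0"] P_skew [of "f 2" "f 1"] P_skew [of "f 3" "f 1"] P_skew [of "f 4" "f 1"] P_skew [of "f 5" "f 1"] P_skew [of "f 6" "f 1"] P_skew [of "f 3" "f 2"] P_skew [of "f 4" "f 2"] P_skew [of "f 5" "f 2"] P_skew [of "f 6" "f 2"] P_skew [of "f 4" "f 3"] P_skew [of "f 5" "f 3"] P_skew [of "f 6" "f 3"] P_skew [of "f 5" "f 4"] P_skew [of "f 6" "f 4"] P_skew [of "f 6" "f 5"]
  interpret f: frame g f by unfold_locales (rule on')
  have "\<phi> x y z = g2_form g f x y z" for x y z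
  proof -
    have "\<phi> x y z = (\<Sum>i\<in>UNIV. \<Sum>j\<in>UNIV. g (f i) x * (g (f j) y * g (P (f i) (f j)) z))"
      by (subst f.linear_expand [OF trilinearD(1) [OF trilinear_phi]],
          subst f.linear_expand [OF trilinearD(2) [OF trilinear_phi]])
         (simp add: pp sum_distrib_left)
    also have "\<dots> = g2_form g f x y z"
      apply (simp only: sum_7 sk ps g2_form_def wedge3_def wedge2_def)
      apply (simp add: numeral_7)
      by algebra
    finally show ?thesis .
  qed
  then have "g2_frame g f \<phi>" by unfold_locales (intro ext)
  moreover have "f 0 = v" by (simp add: f_def)
  ultimately show ?thesis by (rule that)
qed

end

section \<open>Pointwise \<open>SU(3)\<close> geometry\<close>

lemma exhaust_6:
  fixes x :: 6
  shows "x = 0 \<or> x = 1 \<or> x = 2 \<or> x = 3 \<or> x = 4 \<or> x = 5"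
proof (induct x)
  case (of_int z)
  then have "0 \<le> z" and "z < 6" by simp_all
  then have "z = 0 \<or> z = 1 \<or> z = 2 \<or> z = 3 \<or> z = 4 \<or> z = 5" by arith
  then show ?case by auto
qed

lemma UNIV_6: "UNIV = {0, 1, 2, 3, 4, 5 :: 6}"
  using exhaust_6 by auto

lemma forall_6: "(\<forall>i::6. P i) \<longleftrightarrow> P 0 \<and> P 1 \<and> P 2 \<and> P 3 \<and> P 4 \<and> P 5"
  unfolding ball_UNIV [symmetric] UNIV_6 by simp

lemma sum_6: "sum f (UNIV::6 set) = f 0 + f 1 + f 2 + f 3 + f 4 + f 5"
  unfolding UNIV_6 by (simp add: ac_simps)

lemma (in frame) operator_of_form:
  fixes b :: "(real ^ 'n) form2"
  assumes "bilinear b"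
  obtains T where "linear T" "\<And>x y. g (T x) y = b x y"
proof
  note [simp] = bilinear_ladd [OF assms] bilinear_lmul [OF assms]
  show "linear (\<lambda>x. \<Sum>i\<in>UNIV. b x (e i) *\<^sub>R e i)"
    by (simp add: linear_iff scaleR_add_left sum.distrib scaleR_sum_right)
  show "g (\<Sum>i\<in>UNIV. b x (e i) *\<^sub>R e i) y = b x y" for x y
  proof -
    have "linear (b x)" using assms by (simp add: bilinear_def)
    from linear_expand [OF this, of y] show ?thesis by (simp add: sum_left mult.commute)
  qed
qed

text \<open>The real part of \<open>dz\<^sub>1 \<and> dz\<^sub>2 \<and> dz\<^sub>3\<close> for the complex coordinates
  \<open>z\<^sub>1 = x\<^sub>0 + i x\<^sub>1\<close>, \<open>z\<^sub>2 = x\<^sub>2 + i x\<^sub>3\<close>, \<open>z\<^sub>3 = x\<^sub>4 + i x\<^sub>5\<close>.\<close>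

definition re_volume :: "(real ^ 6) form2 \<Rightarrow> (6 \<Rightarrow> real ^ 6) \<Rightarrow> (real ^ 6) form3" where
  "re_volume g e x y z = wedge3 (g (e 0)) (g (e 2)) (g (e 4)) x y z - wedge3 (g (e 0)) (g (e 3)) (g (e 5)) x y z
     - wedge3 (g (e 1)) (g (e 2)) (g (e 5)) x y z - wedge3 (g (e 1)) (g (e 3)) (g (e 4)) x y z"

text \<open>The flat model: \<open>J\<close> is multiplication by i in the complex coordinates of
  \<open>re_volume\<close>.\<close>

locale su3_frame = frame g e for g :: "(real ^ 6) form2" and e +
  fixes J :: "real ^ 6 \<Rightarrow> real ^ 6" and \<psi> :: "(real ^ 6) form3"
  assumes J_def: "J x = - g (e 1) x *\<^sub>R e 0 + g (e 0) x *\<^sub>R e 1 - g (e 3) x *\<^sub>R e 2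
      + g (e 2) x *\<^sub>R e 3 - g (e 5) x *\<^sub>R e 4 + g (e 4) x *\<^sub>R e 5"
    and psi: "\<psi> = re_volume g e"
begin

lemma J_coord: "g (e 0) (J x) = - g (e 1) x" "g (e 1) (J x) = g (e 0) x"
  "g (e 2) (J x) = - g (e 3) x" "g (e 3) (J x) = g (e 2) x"
  "g (e 4) (J x) = - g (e 5) x" "g (e 5) (J x) = g (e 4) x"
  by (simp_all add: J_def on)

lemma J_frame: "J (e 0) = e 1" "J (e 1) = - e 0" "J (e 2) = e 3" "J (e 3) = - e 2"
  "J (e 4) = e 5" "J (e 5) = - e 4"
  by (simp_all add: J_def on)

lemma linear_J: "linear J"
  unfolding linear_iff J_def by (simp add: algebra_simps)

lemmas J_simps [simp] = linear_add [OF linear_J] linear_diff [OF linear_J] linear_neg [OF linear_J]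
  linear_cmul [OF linear_J] linear_0 [OF linear_J]

lemma coord_eqI:
  assumes "g (e 0) x = g (e 0) y" "g (e 1) x = g (e 1) y" "g (e 2) x = g (e 2) y"
    "g (e 3) x = g (e 3) y" "g (e 4) x = g (e 4) y" "g (e 5) x = g (e 5) y"
  shows "x = y"
proof -
  have "\<forall>i. g (e i) x = g (e i) y" using assms by (simp add: forall_6)
  then show ?thesis by (intro frame_eqI) simp
qed

lemma J_J [simp]: "J (J x) = - x"
  by (rule coord_eqI) (simp_all add: J_coord)

lemma J_isometry [simp]: "g (J x) (J y) = g x y"
  by (simp add: parseval [of x] parseval [of "J x"] sum_6 J_coord)

lemma J_skew: "g x (J y) = - g (J x) y"
  using J_isometry [of "J x" y] by simp

lemma g_J_self [simp]: "g (J x) x = 0" "g x (J x) = 0"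
  using J_skew [of x x] sym [of x "J x"] by simp_all

lemma psi_simps [simp]:
  "\<psi> (x + x') y z = \<psi> x y z + \<psi> x' y z" "\<psi> (r *\<^sub>R x) y z = r * \<psi> x y z"
  "\<psi> x (y + y') z = \<psi> x y z + \<psi> x y' z" "\<psi> x (r *\<^sub>R y) z = r * \<psi> x y z"
  "\<psi> x y (z + z') = \<psi> x y z + \<psi> x y z'" "\<psi> x y (r *\<^sub>R z) = r * \<psi> x y z"
  unfolding psi re_volume_def by (simp_all add: wedge_simps algebra_simps)

lemma trilinear_psi: "trilinear \<psi>"
  by (rule trilinearI) simp_all

lemma bilinear_psi: "bilinear (\<psi> x)"
  by (rule bilinearI) simp_all

lemmas psi_neg [simp] = trilinearD [OF trilinear_psi, THEN linear_neg] trilinearD [OF trilinear_psi, THEN linear_diff]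
  trilinearD [OF trilinear_psi, THEN linear_0]

lemma psi_skew: "\<psi> y x z = - \<psi> x y z" "\<psi> x z y = - \<psi> x y z"
  unfolding psi re_volume_def
  by (simp_all only: wedge3_skew(1) [of _ _ _ y x] wedge3_skew(2) [of _ _ _ x z])

lemma psi_cyc: "\<psi> y z x = \<psi> x y z"
  by (metis psi_skew minus_minus)

lemma psi_self [simp]: "\<psi> x x y = 0" "\<psi> x y x = 0" "\<psi> y x x = 0"
  using psi_skew(1) [of x x y] psi_skew(2) [of y x x] psi_cyc [of x y x] by simp_all

text \<open>Since \<psi> is the real part of a complex trilinear form, a factor i may sit in any
  argument.\<close>

lemma psi_J: "\<psi> x (J y) z = \<psi> (J x) y z" "\<psi> x y (J z) = \<psi> (J x) y z"
  unfolding psi re_volume_def wedge3_def wedge2_def by (simp_all add: J_coord algebra_simps)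

text \<open>Contraction with \<psi> is a similarity and so injective. The factor 2 cancels the 1/2
  in \<open>r_form\<close>, which makes the form of \<psi> (C x) equal to that of
  \<open>C\<close>.\<close>

lemma inner_psi: "inner2 g (\<psi> x) (\<psi> y) = 2 * g x y"
  unfolding inner2_frame [OF bilinear_psi bilinear_psi] unfolding psi re_volume_def wedge3_def wedge2_def
  by (simp add: sum_6 on parseval [of x])

lemma psi_nondegenerate:
  assumes "\<psi> x = \<psi> y" shows "x = y"
proof (rule eqI)
  fix z show "g x z = g y z" using inner_psi [of x z] inner_psi [of y z] assms by simp
qed

lemma r_form_psi: "(\<And>x. \<alpha> x = \<psi> (C x)) \<Longrightarrow> r_form g \<psi> \<alpha> x y = g (C x) y"
  by (simp add: r_form_def inner_psi)

text \<open>Such a form is the real part of a complex bilinear alternating form on a complex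
  three-space. These forms have real dimension six, just as the contractions of \<psi>.\<close>

lemma J_anti_invariant_psi:
  assumes \<beta>: "bilinear \<beta>" and skew: "\<And>y z. \<beta> y z = - \<beta> z y" and J: "\<And>y z. \<beta> y z = - \<beta> (J y) (J z)"
  shows "\<exists>b. \<beta> = \<psi> b"
proof (intro exI ext)
  \<comment> \<open>Each coefficient is read off from one value of \<psi> that is 1 or -1, for
    instance \<psi> (e 0) (e 2) (e 4) = 1 and \<psi> (e 1) (e 3) (e 4) = -1.\<close>
  let ?b = "\<beta> (e 2) (e 4) *\<^sub>R e 0 - \<beta> (e 3) (e 4) *\<^sub>R e 1 + \<beta> (e 4) (e 0) *\<^sub>R e 2
    - \<beta> (e 4) (e 1) *\<^sub>R e 3 + \<beta> (e 0) (e 2) *\<^sub>R e 4 - \<beta> (e 0) (e 3) *\<^sub>R e 5"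
  fix y z
  note [simp] = bilinear_lneg [OF \<beta>] bilinear_rneg [OF \<beta>]
  have J1: "\<beta> (J y) z = \<beta> y (J z)" for y z
    using J [of "J y" z] by simp
  have diag: "\<beta> y y = 0" for y using skew [of y y] by simp
  have z: "\<beta> y (J y) = 0" for y
    using J1 [of y y] skew [of y "J y"] by simp
  note t = skew [of "e 1" "e 0"] skew [of "e 2" "e 0"] skew [of "e 3" "e 0"] skew [of "e 4" "e 0"]
    skew [of "e 5" "e 0"] skew [of "e 2" "e 1"] skew [of "e 3" "e 1"] skew [of "e 4" "e 1"] skew [of "e 5" "e 1"]
    skew [of "e 3" "e 2"] skew [of "e 4" "e 2"] skew [of "e 5" "e 2"] skew [of "e 4" "e 3"] skew [of "e 5" "e 3"]
    skew [of "e 5" "e 4"]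
  have v: "\<beta> (e 0) (e 1) = 0" "\<beta> (e 2) (e 3) = 0" "\<beta> (e 4) (e 5) = 0"
    using z [of "e 0"] z [of "e 2"] z [of "e 4"] by (simp_all add: J_frame)
  have w: "\<beta> (e 1) (e 3) = - \<beta> (e 0) (e 2)" "\<beta> (e 1) (e 5) = - \<beta> (e 0) (e 4)" "\<beta> (e 3) (e 5) = - \<beta> (e 2) (e 4)"
    using J [of "e 0" "e 2"] J [of "e 0" "e 4"] J [of "e 2" "e 4"] by (simp_all add: J_frame)
  have u: "\<beta> (e 1) (e 2) = \<beta> (e 0) (e 3)" "\<beta> (e 0) (e 5) = \<beta> (e 1) (e 4)" "\<beta> (e 2) (e 5) = \<beta> (e 3) (e 4)"
    using J1 [of "e 0" "e 2"] J1 [of "e 0" "e 4"] J1 [of "e 2" "e 4"] by (simp_all add: J_frame)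
  have lin: "linear (\<lambda>y. \<beta> y z)" "linear (\<beta> y)" for y z
    using \<beta> by (auto simp: bilinear_def)
  have "\<beta> y z = (\<Sum>i\<in>UNIV. \<Sum>j\<in>UNIV. g (e i) y * (g (e j) z * \<beta> (e i) (e j)))"
    by (subst linear_expand [OF lin(1)], subst linear_expand [OF lin(2)]) (simp add: sum_distrib_left)
  also have "\<dots> = \<psi> ?b y z"
    apply (simp only: sum_6 diag t v w u psi re_volume_def wedge3_def wedge2_def)
    apply (simp add: on)
    by algebra
  finally show "\<beta> y z = \<psi> ?b y z" .
qed

text \<open>Contraction with \<psi> is injective, so the pointwise chosen \<open>C\<close> inherits
  linearity from \<alpha>.\<close>

lemma gh_space_rep:
  assumes "\<alpha> \<in> gh_space J"
  obtains C where "linear C" "\<And>x. \<alpha> x = \<psi> (C x)"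
proof -
  have tri: "trilinear \<alpha>" and sk: "\<And>x y z. \<alpha> x y z = - \<alpha> x z y" and J: "\<And>x y z. \<alpha> x y z = - \<alpha> x (J y) (J z)"
    using assms unfolding gh_space_def by blast+
  have "\<exists>b. \<alpha> x = \<psi> b" for x
  proof (rule J_anti_invariant_psi)
    show "bilinear (\<alpha> x)" using tri by (simp add: bilinear_def trilinear_def)
  qed (fact sk J)+
  then obtain C where C: "\<And>x. \<alpha> x = \<psi> (C x)" by metis
  have "linear C"
  proof (rule linearI; rule psi_nondegenerate; intro ext)
    show "\<psi> (C (x + y)) u v = \<psi> (C x + C y) u v" for x y u v
      using linear_add [OF trilinearD(1) [OF tri, of u v], of x y] by (simp add: C)
    show "\<psi> (C (r *\<^sub>R x)) u v = \<psi> (r *\<^sub>R C x) u v" for r x u v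
      using linear_cmul [OF trilinearD(1) [OF tri, of u v], of r x] by (simp add: C)
  qed
  then show thesis using C by (rule that)
qed

lemma gh_spaceI:
  assumes "linear C" shows "(\<lambda>x. \<psi> (C x)) \<in> gh_space J"
proof -
  have "trilinear (\<lambda>x. \<psi> (C x))"
    by (rule trilinearI) (simp_all add: linear_add [OF assms] linear_cmul [OF assms])
  moreover have "\<psi> (C x) y z = - \<psi> (C x) z y" for x y z
    by (rule psi_skew(2))
  moreover have "\<psi> (C x) y z = - \<psi> (C x) (J y) (J z)" for x y z
    by (simp only: psi_J) simp
  ultimately show ?thesis unfolding gh_space_def by blast
qed

text \<open>For \<open>C\<close> commuting with \<open>J\<close>, \<open>tr_re C\<close> and
  \<open>tr_im C\<close> are the real and imaginary parts of the complex trace.\<close>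

definition tr_re :: "(real ^ 6 \<Rightarrow> real ^ 6) \<Rightarrow> real" where
  "tr_re C = g (C (e 0)) (e 0) + g (C (e 2)) (e 2) + g (C (e 4)) (e 4)"

definition tr_im :: "(real ^ 6 \<Rightarrow> real ^ 6) \<Rightarrow> real" where
  "tr_im C = g (C (e 0)) (e 1) + g (C (e 2)) (e 3) + g (C (e 4)) (e 5)"

lemma commuting_frame:
  assumes "\<And>x. C (J x) = J (C x)" "linear C"
  shows "C (e 1) = J (C (e 0))" "C (e 3) = J (C (e 2))" "C (e 5) = J (C (e 4))"
  using assms(1) [of "e 0"] assms(1) [of "e 2"] assms(1) [of "e 4"] by (simp_all add: J_frame)

text \<open>A complex linear map acts on the complex volume form as a derivation, and this is
  multiplication by its complex trace; the real part is taken here.\<close>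

lemma cyclic_commuting:
  assumes "\<And>x. C (J x) = J (C x)" "linear C"
  shows "\<psi> (C x) y z + \<psi> (C y) z x + \<psi> (C z) x y = \<psi> (tr_re C *\<^sub>R x + tr_im C *\<^sub>R J x) y z"
proof -
  have C: "C x = g (e 0) x *\<^sub>R C (e 0) + g (e 1) x *\<^sub>R J (C (e 0)) + g (e 2) x *\<^sub>R C (e 2)
    + g (e 3) x *\<^sub>R J (C (e 2)) + g (e 4) x *\<^sub>R C (e 4) + g (e 5) x *\<^sub>R J (C (e 4))" for x
    using linear_expand [OF assms(2), of x] commuting_frame [OF assms] by (simp add: sum_6)
  show ?thesis
    unfolding C [of x] C [of y] C [of z] tr_re_def tr_im_def sym [of "C _"]
    unfolding psi re_volume_def wedge3_def wedge2_def
    apply (simp add: J_coord)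
    by algebra
qed

lemma trace_commuting:
  assumes "\<And>x. C (J x) = J (C x)" "linear C"
  shows "(\<Sum>i\<in>UNIV. g (C (e i)) (e i)) = 2 * tr_re C" "(\<Sum>i\<in>UNIV. g (C (e i)) (J (e i))) = 2 * tr_im C"
proof -
  have *: "g (J x) (e 1) = g x (e 0)" "g (J x) (e 3) = g x (e 2)" "g (J x) (e 5) = g x (e 4)" for x
    using J_isometry [of x "e 0"] J_isometry [of x "e 2"] J_isometry [of x "e 4"]
    by (simp_all only: J_frame)
  have **: "g (J x) (e 0) = - g x (e 1)" "g (J x) (e 2) = - g x (e 3)" "g (J x) (e 4) = - g x (e 5)" for x
    using J_skew [of x "e 0"] J_skew [of x "e 2"] J_skew [of x "e 4"]
    by (simp_all only: J_frame minus_minus)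
  show "(\<Sum>i\<in>UNIV. g (C (e i)) (e i)) = 2 * tr_re C" "(\<Sum>i\<in>UNIV. g (C (e i)) (J (e i))) = 2 * tr_im C"
    by (simp_all add: sum_6 commuting_frame [OF assms] tr_re_def tr_im_def J_frame * **)
qed

end

section \<open>The Gray-Hervella classes as algebraic properties of the endomorphism C\<close>

context su3_frame begin

lemma commutes_iff: "(\<forall>x. C (J x) = J (C x)) \<longleftrightarrow> (\<forall>x y. g (C (J x)) (J y) = g (C x) y)"
proof
  assume *: "\<forall>x y. g (C (J x)) (J y) = g (C x) y"
  show "\<forall>x. C (J x) = J (C x)"
  proof (intro allI eqI)
    fix x z show "g (C (J x)) z = g (J (C x)) z"
      using * [rule_format, of x "- J z"] by (simp add: J_skew)
  qed
qed simp

lemma anticommutes: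
  assumes "\<And>x y. g (C (J x)) (J y) = - g (C x) y"
  shows "C (J x) = - J (C x)"
proof (rule eqI)
  fix z show "g (C (J x)) z = g (- J (C x)) z"
    using assms [of x "- J z"] by (simp add: J_skew)
qed

text \<open>Total skewness exchanges the argument of \<open>C\<close> with a slot of \<psi>, and
  \<open>J\<close> moves freely between slots; together they carry \<open>J\<close> through
  \<open>C\<close>.\<close>

lemma gh_W1_commutes:
  assumes "linear C" "(\<lambda>x. \<psi> (C x)) \<in> gh_W1 J"
  shows "C (J x) = J (C x)"
proof -
  have sk: "\<psi> (C x) y z = - \<psi> (C y) x z" for x y z
    using assms(2) unfolding gh_W1_def mem_Collect_eq by blast
  have "\<psi> (C (J x)) y z = \<psi> (J (C x)) y z" for y z
  proof -
    have "\<psi> (C (J x)) y z = - \<psi> (C y) (J x) z" by (rule sk)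
    also have "\<dots> = - \<psi> (C y) x (J z)" by (simp only: psi_J)
    also have "\<dots> = \<psi> (C x) y (J z)" by (simp add: sk [of y])
    finally show ?thesis by (simp only: psi_J)
  qed
  then show ?thesis by (intro psi_nondegenerate ext)
qed

text \<open>For totally skew forms the cyclic sum is three times the form, while
  \<open>cyclic_commuting\<close> evaluates it by the complex trace. So \<open>C\<close> is a
  complex multiple of the identity.\<close>

lemma gh_W1_form:
  assumes "linear C" "(\<lambda>x. \<psi> (C x)) \<in> gh_W1 J"
  shows "\<exists>a b. \<forall>x. C x = a *\<^sub>R x + b *\<^sub>R J x"
proof (intro exI allI)
  note comm = gh_W1_commutes [OF assms]
  have sk: "\<psi> (C x) y z = - \<psi> (C y) x z" for x y z
    using assms(2) unfolding gh_W1_def mem_Collect_eq by blast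
  fix x
  have "\<psi> (3 *\<^sub>R C x) y z = \<psi> (tr_re C *\<^sub>R x + tr_im C *\<^sub>R J x) y z" for y z
  proof -
    have "\<psi> (C y) z x = \<psi> (C x) y z" "\<psi> (C z) x y = \<psi> (C x) y z"
      using sk [of x y z] sk [of x z y] psi_skew(2) [of "C y" z x] psi_skew(2) [of "C x" z y] by simp_all
    then show ?thesis
      using cyclic_commuting [OF comm assms(1), of x y z] by simp
  qed
  then have "3 *\<^sub>R C x = tr_re C *\<^sub>R x + tr_im C *\<^sub>R J x"
    by (intro psi_nondegenerate ext)
  then have "(1/3) *\<^sub>R (3 *\<^sub>R C x) = (1/3) *\<^sub>R (tr_re C *\<^sub>R x + tr_im C *\<^sub>R J x)" by simp
  then show "C x = (tr_re C / 3) *\<^sub>R x + (tr_im C / 3) *\<^sub>R J x"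
    by (simp add: scaleR_add_right)
qed

text \<open>Comparing the cyclic sum with its value at \<open>(x, J y, J z)\<close> shows that the part of \<open>C\<close>
  anticommuting with \<open>J\<close> vanishes; here \<open>C - J C J\<close> is twice the commuting part.\<close>

lemma gh_W2_commutes:
  assumes "linear C" "(\<lambda>x. \<psi> (C x)) \<in> gh_W2 J"
  shows "C (J x) = J (C x)"
proof -
  define S where "S x y z = \<psi> (C x) y z + \<psi> (C y) z x + \<psi> (C z) x y" for x y z
  define D where "D x = C x - J (C (J x))" for x
  have S: "S x y z = 0" for x y z
    using assms(2) by (simp add: gh_W2_def S_def)
  have 1: "2 * \<psi> (C x) y z + \<psi> (D y) z x + \<psi> (D z) x y = 0" for x y z
  proof -
    have "S x y z - S x (J y) (J z) = 2 * \<psi> (C x) y z + \<psi> (D y) z x + \<psi> (D z) x y"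
      by (simp add: S_def D_def psi_J)
    then show ?thesis by (simp add: S)
  qed
  have "\<psi> (D x) y z = \<psi> (2 *\<^sub>R C x) y z" for x y z
  proof -
    have E: "2 * \<psi> (C x) y z + \<psi> (D y) z x + \<psi> (D z) x y = 0"
      "2 * \<psi> (C y) z x + \<psi> (D z) x y + \<psi> (D x) y z = 0"
      "2 * \<psi> (C z) x y + \<psi> (D x) y z + \<psi> (D y) z x = 0" by (rule 1)+
    have "\<psi> (C x) y z + \<psi> (C y) z x + \<psi> (C z) x y = 0" using S [of x y z] by (simp add: S_def)
    \<comment> \<open>Adding the three relations shows that the three \<open>D\<close>-terms sum to
      zero; the first relation then gives the claim.\<close>
    with E have "\<psi> (D x) y z = 2 * \<psi> (C x) y z" by linarith
    then show ?thesis by simp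
  qed
  then have "D x = 2 *\<^sub>R C x" by (intro psi_nondegenerate ext)
  then have "J (C (J x)) = - C x" by (simp add: D_def scaleR_2 eq_neg_iff_add_eq_0 algebra_simps)
  then have "J (J (C (J x))) = J (- C x)" by simp
  then show ?thesis by simp
qed

lemma gh_W2_traces:
  assumes "linear C" "(\<lambda>x. \<psi> (C x)) \<in> gh_W2 J"
  shows "tr_re C = 0" "tr_im C = 0"
proof -
  have "\<psi> (tr_re C *\<^sub>R x + tr_im C *\<^sub>R J x) y z = \<psi> 0 y z" for x y z
    using cyclic_commuting [OF gh_W2_commutes [OF assms] assms(1), of x y z] assms(2)
    by (simp add: gh_W2_def)
  then have *: "tr_re C *\<^sub>R e 0 + tr_im C *\<^sub>R J (e 0) = 0"
    by (intro psi_nondegenerate ext)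
  show "tr_re C = 0" "tr_im C = 0"
    using arg_cong [OF *, of "g (e 0)"] arg_cong [OF *, of "g (e 1)"] by (simp_all add: J_frame on)
qed

lemma gh_W3_anticommutes:
  assumes "(\<lambda>x. \<psi> (C x)) \<in> gh_W3 g J"
  shows "C (J x) = - J (C x)"
proof -
  have "\<psi> (J (C (J x))) y z = \<psi> (C x) y z" for y z
    using assms by (auto simp: gh_W3_def psi_J)
  then have "J (C (J x)) = C x" by (intro psi_nondegenerate ext)
  then have "J (J (C (J x))) = J (C x)" by simp
  then have "- C (J x) = J (C x)" by simp
  then show ?thesis by (metis minus_minus)
qed

lemma gh_W1I: "(\<lambda>x. \<psi> (a *\<^sub>R x + b *\<^sub>R J x)) \<in> gh_W1 J"
proof -
  have "linear (\<lambda>x. a *\<^sub>R x + b *\<^sub>R J x)" by (simp add: linear_iff algebra_simps)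
  moreover have "\<psi> (a *\<^sub>R x + b *\<^sub>R J x) y z = - \<psi> (a *\<^sub>R y + b *\<^sub>R J y) x z" for x y z
    using psi_skew(1) [of x "J y" z] psi_J(1) [of x y z] psi_skew(1) [of x y z] by simp
  ultimately show ?thesis unfolding gh_W1_def mem_Collect_eq using gh_spaceI by blast
qed

lemma gh_W2I:
  assumes "linear C" "\<And>x y. g (C (J x)) (J y) = g (C x) y"
    and "(\<Sum>i\<in>UNIV. g (C (e i)) (e i)) = 0" "(\<Sum>i\<in>UNIV. g (C (e i)) (J (e i))) = 0"
  shows "(\<lambda>x. \<psi> (C x)) \<in> gh_W2 J"
proof -
  have comm: "C (J x) = J (C x)" for x using commutes_iff assms(2) by blast
  show ?thesis
    using cyclic_commuting [OF comm assms(1)] trace_commuting [OF comm assms(1)] assms(3,4)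
    by (simp add: gh_W2_def gh_spaceI [OF assms(1)])
qed

text \<open>The trace condition contracts the symmetric \<open>C\<close> with the skew \<psi>, so it
  holds automatically. Symmetry is what separates this class from \<open>W4\<close>.\<close>

lemma gh_W3I:
  assumes "linear C" "\<And>x y. g (C (J x)) (J y) = - g (C x) y" "\<And>x y. g (C x) y = g (C y) x"
  shows "(\<lambda>x. \<psi> (C x)) \<in> gh_W3 g J"
proof -
  have "\<psi> (C (J x)) (J y) z = \<psi> (C x) y z" for x y z
    by (simp add: anticommutes [where C = C, OF assms(2)] psi_J)
  moreover have "trace_form g (\<lambda>x y. \<psi> (C x) y z) = 0" for z
  proof -
    have "bilinear (\<lambda>x y. \<psi> (C x) y z)"
      by (rule bilinearI) (simp_all add: linear_add [OF assms(1)] linear_cmul [OF assms(1)])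
    then have "trace_form g (\<lambda>x y. \<psi> (C x) y z) = (\<Sum>i\<in>UNIV. \<psi> (C (e i)) (e i) z)"
      by (rule trace_form_frame)
    also have "\<dots> = (\<Sum>i\<in>UNIV. \<Sum>j\<in>UNIV. g (e j) (C (e i)) * \<psi> (e j) (e i) z)"
      by (subst linear_expand [OF trilinearD(1) [OF trilinear_psi]]) simp
    also have "\<dots> = 0"
      by (simp add: sum_6 sym [of "e _" "C _"] psi_skew(1) [of "e 1" "e 0"] psi_skew(1) [of "e 2" "e 0"]
        psi_skew(1) [of "e 3" "e 0"] psi_skew(1) [of "e 4" "e 0"] psi_skew(1) [of "e 5" "e 0"]
        psi_skew(1) [of "e 2" "e 1"] psi_skew(1) [of "e 3" "e 1"] psi_skew(1) [of "e 4" "e 1"]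
        psi_skew(1) [of "e 5" "e 1"] psi_skew(1) [of "e 3" "e 2"] psi_skew(1) [of "e 4" "e 2"]
        psi_skew(1) [of "e 5" "e 2"] psi_skew(1) [of "e 4" "e 3"] psi_skew(1) [of "e 5" "e 3"]
        psi_skew(1) [of "e 5" "e 4"] assms(3) [of "e 1" "e 0"] assms(3) [of "e 2" "e 0"]
        assms(3) [of "e 3" "e 0"] assms(3) [of "e 4" "e 0"] assms(3) [of "e 5" "e 0"]
        assms(3) [of "e 2" "e 1"] assms(3) [of "e 3" "e 1"] assms(3) [of "e 4" "e 1"]
        assms(3) [of "e 5" "e 1"] assms(3) [of "e 3" "e 2"] assms(3) [of "e 4" "e 2"]
        assms(3) [of "e 5" "e 2"] assms(3) [of "e 4" "e 3"] assms(3) [of "e 5" "e 3"] assms(3) [of "e 5" "e 4"])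
    finally show ?thesis .
  qed
  ultimately show ?thesis by (simp add: gh_W3_def gh_spaceI [OF assms(1)])
qed

lemma UNIV_su3_class: "UNIV = {W1p, W1m, W2p, W2m, W3, W4, W5}"
  using su3_class.exhaust by auto

lemma sum_su3_class: "sum f (UNIV :: su3_class set) = f W1p + f W1m + f W2p + f W2m + f W3 + f W4 + f W5"
  unfolding UNIV_su3_class by (simp add: ac_simps)

text \<open>The frame consists of pairs x, J x whose contributions cancel. Hence the part of
  \<open>C\<close> anticommuting with \<open>J\<close> does not enter the traces that determine the
  \<open>W1\<close> components.\<close>

lemma sum_J_invariant:
  assumes "bilinear b" "\<And>x y. b (J x) (J y) = - b x y"
  shows "(\<Sum>i\<in>UNIV. b (e i) (e i)) = 0" "(\<Sum>i\<in>UNIV. b (e i) (J (e i))) = 0"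
  using assms(2) [of "e 0" "e 0"] assms(2) [of "e 2" "e 2"] assms(2) [of "e 4" "e 4"]
    assms(2) [of "e 0" "e 1"] assms(2) [of "e 2" "e 3"] assms(2) [of "e 4" "e 5"]
  by (simp_all add: sum_6 J_frame bilinear_lneg [OF assms(1)] bilinear_rneg [OF assms(1)])

text \<open>The components of \<open>\<alpha> x = \<psi> (C x)\<close> are read off from the bilinear form \<open>c x y = g (C x) y\<close>.\<close>

lemma su3_decomposition:
  fixes U
  assumes "linear C"
  defines "c \<equiv> \<lambda>x y. g (C x) y"
  defines "s \<equiv> \<lambda>x y. (c x y + c y x + c (J x) (J y) + c (J y) (J x)) / 4"
  defines "k \<equiv> \<lambda>x y. (c x y - c y x + c (J x) (J y) - c (J y) (J x)) / 4"
  defines "a \<equiv> (\<Sum>i\<in>UNIV. c (e i) (e i)) / 6"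
  defines "b \<equiv> (\<Sum>i\<in>UNIV. c (e i) (J (e i))) / 6"
  assumes symm: "\<And>x y. c x y - c (J x) (J y) = c y x - c (J y) (J x)" and U: "W4 \<notin> U"
  shows "(\<exists>\<alpha>. (\<forall>k. \<alpha> k \<in> su3_space g J \<psi> k) \<and> (\<forall>x y z. \<psi> (C x) y z = (\<Sum>k\<in>UNIV. \<alpha> k x y z)) \<and>
        (\<forall>k. k \<notin> U \<longrightarrow> \<alpha> k = (\<lambda>x y z. 0))) \<longleftrightarrow>
    (W1p \<notin> U \<longrightarrow> a = 0) \<and> (W1m \<notin> U \<longrightarrow> b = 0) \<and> (W2p \<notin> U \<longrightarrow> (\<forall>x y. s x y = a * g x y)) \<and>
    (W2m \<notin> U \<longrightarrow> (\<forall>x y. k x y = b * g (J x) y)) \<and> (W3 \<notin> U \<longrightarrow> (\<forall>x y. c x y = c (J x) (J y)))"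
    (is "?L \<longleftrightarrow> ?R")
proof
  assume ?L
  then obtain \<alpha> where \<alpha>: "\<And>k. \<alpha> k \<in> su3_space g J \<psi> k"
    "\<And>x y z. \<psi> (C x) y z = (\<Sum>k\<in>UNIV. \<alpha> k x y z)" "\<And>k. k \<notin> U \<Longrightarrow> \<alpha> k = (\<lambda>x y z. 0)" by blast
  have m: "\<alpha> W1p \<in> gh_W1 J" "\<alpha> W1m \<in> gh_W1 J" "\<alpha> W2p \<in> gh_W2 J" "\<alpha> W2m \<in> gh_W2 J" "\<alpha> W3 \<in> gh_W3 g J"
    and rs: "r_form g \<psi> (\<alpha> W1p) x y = r_form g \<psi> (\<alpha> W1p) y x" "r_form g \<psi> (\<alpha> W1m) x y = - r_form g \<psi> (\<alpha> W1m) y x"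
      "r_form g \<psi> (\<alpha> W2p) x y = r_form g \<psi> (\<alpha> W2p) y x" "r_form g \<psi> (\<alpha> W2m) x y = - r_form g \<psi> (\<alpha> W2m) y x"
    and z5: "\<alpha> W5 = (\<lambda>x y z. 0)" for x y
    using \<alpha>(1) [of W1p] \<alpha>(1) [of W1m] \<alpha>(1) [of W2p] \<alpha>(1) [of W2m] \<alpha>(1) [of W3] \<alpha>(1) [of W5]
    unfolding su3_space_def Let_def su3_class.case by blast+
  have gh: "\<alpha> W1p \<in> gh_space J" "\<alpha> W1m \<in> gh_space J" "\<alpha> W2p \<in> gh_space J" "\<alpha> W2m \<in> gh_space J" "\<alpha> W3 \<in> gh_space J"
    using m by (auto simp: gh_W1_def gh_W2_def gh_W3_def)
  obtain A1 where A1: "linear A1" "\<And>x. \<alpha> W1p x = \<psi> (A1 x)" using gh_space_rep [OF gh(1)] by blast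
  obtain B1 where B1: "linear B1" "\<And>x. \<alpha> W1m x = \<psi> (B1 x)" using gh_space_rep [OF gh(2)] by blast
  obtain A2 where A2: "linear A2" "\<And>x. \<alpha> W2p x = \<psi> (A2 x)" using gh_space_rep [OF gh(3)] by blast
  obtain B2 where B2: "linear B2" "\<And>x. \<alpha> W2m x = \<psi> (B2 x)" using gh_space_rep [OF gh(4)] by blast
  obtain A3 where A3: "linear A3" "\<And>x. \<alpha> W3 x = \<psi> (A3 x)" using gh_space_rep [OF gh(5)] by blast
  have eq: "\<alpha> W1p = (\<lambda>x. \<psi> (A1 x))" "\<alpha> W1m = (\<lambda>x. \<psi> (B1 x))" "\<alpha> W2p = (\<lambda>x. \<psi> (A2 x))"
    "\<alpha> W2m = (\<lambda>x. \<psi> (B2 x))" "\<alpha> W3 = (\<lambda>x. \<psi> (A3 x))"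
    using A1 B1 A2 B2 A3 by auto
  note m' = m [unfolded eq] and rs' = rs [unfolded r_form_psi [OF A1(2)] r_form_psi [OF B1(2)] r_form_psi [OF A2(2)] r_form_psi [OF B2(2)]]
  obtain a1 b1 where a1: "\<And>x. A1 x = a1 *\<^sub>R x + b1 *\<^sub>R J x" using gh_W1_form [OF A1(1) m'(1)] by blast
  obtain a1' b1' where b1': "\<And>x. B1 x = a1' *\<^sub>R x + b1' *\<^sub>R J x" using gh_W1_form [OF B1(1) m'(2)] by blast
  \<comment> \<open>The identity is symmetric and \<open>J\<close> is skew, so the symmetry type of
    \<open>r_form\<close> singles out one of the two multiples.\<close>
  have "b1 = 0" using rs'(1) [of "e 0" "e 1"] by (simp add: a1 J_frame on)
  have "a1' = 0" using rs'(2) [of "e 0" "e 0"] by (simp add: b1' J_frame on)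
  have C: "C x = A1 x + B1 x + A2 x + B2 x + A3 x" for x
  proof (intro psi_nondegenerate ext)
    fix y z
    have "\<alpha> W4 = (\<lambda>x y z. 0)" using \<alpha>(3) U by blast
    then show "\<psi> (C x) y z = \<psi> (A1 x + B1 x + A2 x + B2 x + A3 x) y z"
      by (simp add: \<alpha>(2) sum_su3_class z5 eq)
  qed
  have c: "c x y = a1 * g x y + b1' * g (J x) y + g (A2 x) y + g (B2 x) y + g (A3 x) y" for x y
    by (simp add: c_def C a1 b1' \<open>b1 = 0\<close> \<open>a1' = 0\<close>)
  note comm = gh_W2_commutes [OF A2(1) m'(3)] gh_W2_commutes [OF B2(1) m'(4)] gh_W3_anticommutes [OF m'(5)]
  have inv: "g (A2 (J x)) (J y) = g (A2 x) y" "g (B2 (J x)) (J y) = g (B2 x) y" "g (A3 (J x)) (J y) = - g (A3 x) y" for x y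
    by (simp_all add: comm)
  \<comment> \<open>\<open>s\<close> is the symmetric J-invariant part of \<open>c\<close>: it sees
    neither the skew maps \<open>B1\<close> and \<open>B2\<close> nor \<open>A3\<close>, which
    anticommutes with \<open>J\<close>.\<close>
  have s: "s x y = a1 * g x y + g (A2 x) y" for x y
    unfolding s_def c inv
    using rs'(3) [of x y] rs'(4) [of x y] J_skew [of x y] sym [of y x] sym [of "J y" x] sym [of y "J x"]
    by (simp add: J_skew [of "J _"])
  have k: "k x y = b1' * g (J x) y + g (B2 x) y" for x y
    unfolding k_def c inv
    using rs'(3) [of x y] rs'(4) [of x y] J_skew [of x y] sym [of y x] sym [of "J y" x] sym [of y "J x"]
    by (simp add: J_skew [of "J _"])
  have bil: "bilinear (\<lambda>x y. g (A3 x) y)"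
    by (rule bilinearI) (simp_all add: linear_add [OF A3(1)] linear_cmul [OF A3(1)])
  note tr = trace_commuting [OF comm(1) A2(1)] trace_commuting [OF comm(2) B2(1)]
    gh_W2_traces [OF A2(1) m'(3)] gh_W2_traces [OF B2(1) m'(4)] sum_J_invariant [OF bil inv(3)]
  \<comment> \<open>The \<open>W2\<close> parts have complex trace zero and \<open>A3\<close>
    anticommutes with \<open>J\<close>, so only the multiple of the identity has a trace.\<close>
  have a: "a = a1"
    by (simp add: a_def c sum.distrib tr) (simp add: sum_6 on)
  have b: "b = b1'"
    by (simp add: b_def c sum.distrib tr) (simp add: sum_6 on)
  have zero: "A x = 0" if "(\<lambda>x. \<psi> (A x)) = (\<lambda>x y z. 0)" for A :: "real ^ 6 \<Rightarrow> real ^ 6" and x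
  proof (rule psi_nondegenerate)
    show "\<psi> (A x) = \<psi> 0" using fun_cong [OF that, of x] by (auto simp: fun_eq_iff)
  qed
  show ?R
  proof (intro conjI impI allI)
    assume "W1p \<notin> U"
    then have "A1 (e 0) = 0" using \<alpha>(3) zero eq by metis
    then have "g (A1 (e 0)) (e 0) = 0" by simp
    then show "a = 0" by (simp add: a a1 on)
  next
    assume "W1m \<notin> U"
    then have "B1 (e 0) = 0" using \<alpha>(3) zero eq by metis
    then have "g (B1 (e 0)) (e 1) = 0" by simp
    then show "b = 0" by (simp add: b b1' on J_frame)
  next
    fix x y assume "W2p \<notin> U"
    then have "A2 x = 0" using \<alpha>(3) zero eq by metis
    then show "s x y = a * g x y" by (simp add: s a)
  next
    fix x y assume "W2m \<notin> U"
    then have "B2 x = 0" using \<alpha>(3) zero eq by metis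
    then show "k x y = b * g (J x) y" by (simp add: k b)
  next
    fix x y assume "W3 \<notin> U"
    then have "A3 x = 0" "A3 (J x) = 0" using \<alpha>(3) zero eq by metis+
    then show "c x y = c (J x) (J y)" by (simp add: c comm J_skew [of x y])
  qed
next
  assume R: ?R
  have lin: "linear C" by fact
  note [simp] = linear_add [OF lin] linear_cmul [OF lin] linear_neg [OF lin]
  have "bilinear c" by (rule bilinearI) (simp_all add: c_def)
  note c_simps = bilinear_simps [OF this]
  have "bilinear (\<lambda>x y. s x y - a * g x y)"
    by (rule bilinearI) (simp_all add: s_def c_simps algebra_simps add_divide_distrib)
  then obtain A2 where A2: "linear A2" "\<And>x y. g (A2 x) y = s x y - a * g x y"
    by (rule operator_of_form) blast
  have "bilinear (\<lambda>x y. k x y - b * g (J x) y)"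
    by (rule bilinearI) (simp_all add: k_def c_simps algebra_simps add_divide_distrib diff_divide_distrib)
  then obtain B2 where B2: "linear B2" "\<And>x y. g (B2 x) y = k x y - b * g (J x) y"
    by (rule operator_of_form) blast
  have "bilinear (\<lambda>x y. (c x y - c (J x) (J y)) / 2)"
    by (rule bilinearI) (simp_all add: c_simps algebra_simps add_divide_distrib diff_divide_distrib)
  then obtain A3 where A3: "linear A3" "\<And>x y. g (A3 x) y = (c x y - c (J x) (J y)) / 2"
    by (rule operator_of_form) blast
  have C: "C x = (a *\<^sub>R x + 0 *\<^sub>R J x) + (0 *\<^sub>R x + b *\<^sub>R J x) + A2 x + B2 x + A3 x" for x
  proof (rule eqI)
    fix y
    show "g (C x) y = g ((a *\<^sub>R x + 0 *\<^sub>R J x) + (0 *\<^sub>R x + b *\<^sub>R J x) + A2 x + B2 x + A3 x) y"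
      unfolding g_simps A2(2) B2(2) A3(2) s_def k_def by (simp add: c_def field_simps)
  qed
  define \<alpha> where "\<alpha> = (\<lambda>W. case W of W1p \<Rightarrow> \<lambda>x. \<psi> (a *\<^sub>R x + 0 *\<^sub>R J x) | W1m \<Rightarrow> \<lambda>x. \<psi> (0 *\<^sub>R x + b *\<^sub>R J x)
    | W2p \<Rightarrow> \<lambda>x. \<psi> (A2 x) | W2m \<Rightarrow> \<lambda>x. \<psi> (B2 x) | W3 \<Rightarrow> \<lambda>x. \<psi> (A3 x) | W4 \<Rightarrow> \<lambda>x y z. 0 | W5 \<Rightarrow> \<lambda>x y z. 0)"
  have ssym: "s x y = s y x" and ksym: "k x y = - k y x" for x y by (simp_all add: s_def k_def field_simps)
  have inv: "s (J x) (J y) = s x y" "k (J x) (J y) = k x y" for x y by (simp_all add: s_def k_def c_simps)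
  have a6: "c (e 0) (e 0) + c (e 1) (e 1) + c (e 2) (e 2) + c (e 3) (e 3) + c (e 4) (e 4) + c (e 5) (e 5) = 6 * a"
    by (simp add: a_def sum_6)
  have b6: "c (e 0) (e 1) - c (e 1) (e 0) + c (e 2) (e 3) - c (e 3) (e 2) + c (e 4) (e 5) - c (e 5) (e 4) = 6 * b"
    by (simp add: b_def sum_6 J_frame c_simps)
  have W2: "(\<lambda>x. \<psi> (A2 x)) \<in> gh_W2 J" "(\<lambda>x. \<psi> (B2 x)) \<in> gh_W2 J"
  proof -
    show "(\<lambda>x. \<psi> (A2 x)) \<in> gh_W2 J"
    proof (rule gh_W2I [OF A2(1)])
      show "(\<Sum>i\<in>UNIV. g (A2 (e i)) (e i)) = 0"
        using a6 by (simp add: A2(2) sum_6 on) (simp add: s_def J_frame c_simps field_simps)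
      show "(\<Sum>i\<in>UNIV. g (A2 (e i)) (J (e i))) = 0"
        by (simp add: A2(2) sum_6 on J_frame) (simp add: s_def J_frame c_simps field_simps on)
    qed (simp add: A2(2) inv)
    show "(\<lambda>x. \<psi> (B2 x)) \<in> gh_W2 J"
    proof (rule gh_W2I [OF B2(1)])
      show "(\<Sum>i\<in>UNIV. g (B2 (e i)) (e i)) = 0"
        by (simp add: B2(2) sum_6 on J_frame k_def)
      show "(\<Sum>i\<in>UNIV. g (B2 (e i)) (J (e i))) = 0"
        using b6 by (simp add: B2(2) sum_6 on J_frame) (simp add: k_def J_frame c_simps field_simps on)
    qed (simp add: B2(2) inv, simp add: J_skew)
  qed
  have W3: "(\<lambda>x. \<psi> (A3 x)) \<in> gh_W3 g J"
  proof (rule gh_W3I [OF A3(1)])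
    show "g (A3 (J x)) (J y) = - g (A3 x) y" for x y by (simp add: A3(2) c_simps field_simps)
    \<comment> \<open>This is where \<open>symm\<close> excludes a \<open>W4\<close> component: the
      whole part anticommuting with \<open>J\<close> is symmetric.\<close>
    show "g (A3 x) y = g (A3 y) x" for x y using symm [of x y] by (simp add: A3(2))
  qed
  have sJ: "b * g (J x) y = - (b * g (J y) x)" for x y by (simp add: sym [of "J x"] J_skew)
  have sA: "g (A2 x) y = g (A2 y) x" for x y by (simp add: A2(2) ssym [of x y] sym [of x y])
  have sB: "g (B2 x) y = - g (B2 y) x" for x y using sJ [of x y] by (simp add: B2(2) ksym [of x y])
  have "\<alpha> K \<in> su3_space g J \<psi> K" for K
  proof -
    have "(\<lambda>x y z. 0) \<in> gh_W4 g J"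
      unfolding gh_W4_def gh_space_def
      by (auto intro!: trilinearI exI [of _ "\<lambda>x. 0"] simp: linear_iff)
    then show ?thesis
      using gh_W1I [of a 0] gh_W1I [of 0 b] W2 W3
      by (cases K) (auto simp: \<alpha>_def su3_space_def r_form_psi [of _ "\<lambda>x. a *\<^sub>R x"] r_form_psi [of _ "\<lambda>x. b *\<^sub>R J x"]
        r_form_psi [of _ A2] r_form_psi [of _ B2] intro: sA sB sJ sym)
  qed
  moreover have "\<psi> (C x) y z = (\<Sum>k\<in>UNIV. \<alpha> k x y z)" for x y z
    unfolding C [of x] by (simp add: sum_su3_class \<alpha>_def)
  moreover have "\<alpha> K = (\<lambda>x y z. 0)" if K: "K \<notin> U" for K
  proof -
    have psi0: "\<psi> 0 = (\<lambda>y z. 0)" by (intro ext) simp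
    show ?thesis
    proof (cases K)
      case W1p
      then show ?thesis using R K by (simp add: \<alpha>_def psi0)
    next
      case W1m
      then show ?thesis using R K by (simp add: \<alpha>_def psi0)
    next
      case W2p
      then have "A2 x = 0" for x using R K by (intro eqI) (simp add: A2)
      then show ?thesis using W2p by (simp add: \<alpha>_def psi0)
    next
      case W2m
      then have "B2 x = 0" for x using R K by (intro eqI) (simp add: B2)
      then show ?thesis using W2m by (simp add: \<alpha>_def psi0)
    next
      case W3
      then have "\<forall>x y. c x y = c (J x) (J y)" using R K by blast
      then have "A3 x = 0" for x by (intro eqI) (simp add: A3)
      then show ?thesis using W3 by (simp add: \<alpha>_def psi0)
    qed (simp_all add: \<alpha>_def)
  qed
  ultimately show ?L by blast
qed

text \<open>For \<open>K = \<nabla>\<^sub>x I\<close> the endomorphism \<open>- J K / 2\<close> is the intrinsic torsion \<open>\<xi>\<^sub>x\<close>.\<close>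

lemma xi_derivation:
  assumes K: "\<And>u y. g u (K y) = \<psi> d u y"
  shows "\<psi> (J (K y)) z w + \<psi> y (J (K z)) w + \<psi> y z (J (K w))
    = - 2 * (g d y * g (J z) w - g d z * g (J y) w + g d w * g (J y) z)"
  unfolding parseval [of d] parseval [of "J _"] sum_6
  unfolding psi re_volume_def wedge3_def wedge2_def J_coord K
  \<comment> \<open>By hypothesis the coordinates of \<open>K\<close> are themselves values of
    \<psi>, hence the second expansion.\<close>
  unfolding psi re_volume_def wedge3_def wedge2_def
  apply (simp add: on)
  by algebra

end

section \<open>Calculus in coordinates\<close>

text \<open>The mean value theorem in direction \<open>u\<close> is applied to the increment in
  direction \<open>v\<close>; then the derivative in direction \<open>u\<close> is linearised at
  \<open>x\<close>.\<close>

lemma second_difference: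
  fixes f :: "'a::real_normed_vector \<Rightarrow> real"
  assumes S: "open S" "x \<in> S" and f: "\<And>y. y \<in> S \<Longrightarrow> (f has_derivative f' y) (at y)"
    and f'': "((\<lambda>y. f' y u) has_derivative f'') (at x)" and "0 < \<epsilon>"
  shows "\<exists>\<delta>>0. \<forall>t. 0 < t \<and> t < \<delta> \<longrightarrow>
       \<bar>f (x + t *\<^sub>R u + t *\<^sub>R v) - f (x + t *\<^sub>R u) - f (x + t *\<^sub>R v) + f x - t\<^sup>2 * f'' v\<bar> \<le> \<epsilon> * t\<^sup>2"
    (is "\<exists>\<delta>>0. \<forall>t. _ \<longrightarrow> ?P t")
proof -
  \<comment> \<open>For s up to t, t * M bounds the sum of the two displacement norms at which the
    linearisation error is evaluated; the 1 keeps M positive.\<close>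
  define M where "M = 2 * norm u + norm v + 1"
  have M: "0 < M" using norm_ge_zero [of u] norm_ge_zero [of v] unfolding M_def by linarith
  interpret f'': bounded_linear f'' using f'' by (rule has_derivative_bounded_linear)
  obtain r where r: "0 < r" "ball x r \<subseteq> S" using S open_contains_ball by blast
  obtain d where d: "0 < d" "\<And>y. norm (y - x) < d \<Longrightarrow> norm (f' y u - f' x u - f'' (y - x)) \<le> \<epsilon> / M * norm (y - x)"
    using f'' \<open>0 < \<epsilon>\<close> M unfolding has_derivative_at_alt by (metis divide_pos_pos)
  define \<delta> where "\<delta> = min r d / M"
  have "0 < \<delta>" using r d M by (simp add: \<delta>_def)
  moreover have "?P t" if t: "0 < t" "t < \<delta>" for t
  proof -
    have bound: "norm (s *\<^sub>R u + w) \<le> t * (norm u + norm v)" if "0 \<le> s" "s \<le> t" "w = t *\<^sub>R v \<or> w = 0" for s w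
    proof -
      have "norm (s *\<^sub>R u + w) \<le> norm (s *\<^sub>R u) + norm w" by (rule norm_triangle_ineq)
      also have "\<dots> \<le> t * norm u + t * norm v"
        using that t by (intro add_mono) (auto intro: mult_right_mono)
      finally show ?thesis by (simp add: algebra_simps)
    qed
    have tM: "t * M < min r d" using t M by (simp add: \<delta>_def pos_less_divide_eq)
    have uv: "t * (norm u + norm v) \<le> t * M" using t by (intro mult_left_mono) (simp_all add: M_def)
    have small: "norm (s *\<^sub>R u + w) < min r d" if "0 \<le> s" "s \<le> t" "w = t *\<^sub>R v \<or> w = 0" for s w
      using bound [OF that] uv tM by linarith
    have inS: "x + s *\<^sub>R u + w \<in> S" if "0 \<le> s" "s \<le> t" "w = t *\<^sub>R v \<or> w = 0" for s w
    proof -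
      have "x + (s *\<^sub>R u + w) \<in> ball x r" using small [OF that] unfolding mem_ball by (subst dist_commute) (simp add: dist_norm)
      then show ?thesis using r by (auto simp: add.assoc)
    qed
    have der: "((\<lambda>s. f (x + s *\<^sub>R u + w)) has_derivative (\<lambda>h. f' (x + s *\<^sub>R u + w) (h *\<^sub>R u))) (at s)"
      if "0 \<le> s" "s \<le> t" "w = t *\<^sub>R v \<or> w = 0" for s w
    proof -
      have "((\<lambda>s. x + s *\<^sub>R u + w) has_derivative (\<lambda>h. h *\<^sub>R u)) (at s)"
        by (auto intro!: derivative_eq_intros)
      from has_derivative_compose [OF this, of f "f' (x + s *\<^sub>R u + w)"] f [OF inS [OF that]]
      show ?thesis by blast
    qed
    define F where "F s = f (x + s *\<^sub>R u + t *\<^sub>R v) - f (x + s *\<^sub>R u + 0)" for s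
    have lin: "f' y (h *\<^sub>R u) = h * f' y u" if "y \<in> S" for y h
      using linear_cmul [OF has_derivative_linear [OF f [OF that]]] by simp
    have FD: "(F has_derivative (\<lambda>h. f' (x + s *\<^sub>R u + t *\<^sub>R v) (h *\<^sub>R u) - f' (x + s *\<^sub>R u + 0) (h *\<^sub>R u))) (at s)"
      if "0 \<le> s" "s \<le> t" for s
      unfolding F_def using that by (intro has_derivative_diff der) auto
    have eq: "(\<lambda>h. f' (x + s *\<^sub>R u + t *\<^sub>R v) (h *\<^sub>R u) - f' (x + s *\<^sub>R u + 0) (h *\<^sub>R u))
        = (*) (f' (x + s *\<^sub>R u + t *\<^sub>R v) u - f' (x + s *\<^sub>R u + 0) u)" if "0 \<le> s" "s \<le> t" for s
      using lin [OF inS [OF that, of "t *\<^sub>R v"]] lin [OF inS [OF that, of 0]]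
      by (simp add: fun_eq_iff left_diff_distrib right_diff_distrib mult.commute)
    have "(F has_real_derivative (f' (x + s *\<^sub>R u + t *\<^sub>R v) u - f' (x + s *\<^sub>R u + 0) u)) (at s)"
      if "0 \<le> s" "s \<le> t" for s
      unfolding has_field_derivative_def by (rule has_derivative_eq_rhs [OF FD [OF that] eq [OF that]])
    from MVT2 [OF t(1) this] obtain s where s: "0 < s" "s < t"
      and F: "F t - F 0 = t * (f' (x + s *\<^sub>R u + t *\<^sub>R v) u - f' (x + s *\<^sub>R u + 0) u)"
      by (auto simp: mult.commute)
    have e: "\<bar>f' (x + s *\<^sub>R u + w) u - f' x u - f'' (s *\<^sub>R u + w)\<bar> \<le> \<epsilon> / M * norm (s *\<^sub>R u + w)"
      if "w = t *\<^sub>R v \<or> w = 0" for w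
      using d(2) [of "x + s *\<^sub>R u + w"] small [of s w] s that by (simp add: add.assoc)
    have n: "norm (s *\<^sub>R u + t *\<^sub>R v) + norm (s *\<^sub>R u + 0) \<le> t * M"
    proof -
      have "norm (s *\<^sub>R u) \<le> t * norm u" using s by (simp add: mult_right_mono)
      then show ?thesis
        using bound [of s "t *\<^sub>R v"] s t by (simp add: M_def algebra_simps)
    qed
    have "\<bar>f' (x + s *\<^sub>R u + t *\<^sub>R v) u - f' (x + s *\<^sub>R u + 0) u - t * f'' v\<bar>
      \<le> \<epsilon> / M * norm (s *\<^sub>R u + t *\<^sub>R v) + \<epsilon> / M * norm (s *\<^sub>R u + 0)"
      using e [of "t *\<^sub>R v"] e [of 0] by (simp add: f''.add f''.scaleR)
    also have "\<dots> = \<epsilon> / M * (norm (s *\<^sub>R u + t *\<^sub>R v) + norm (s *\<^sub>R u + 0))"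
      by (simp add: distrib_left)
    also have "\<dots> \<le> \<epsilon> / M * (t * M)"
      using n \<open>0 < \<epsilon>\<close> M by (intro mult_left_mono) simp_all
    also have "\<dots> = \<epsilon> * t" using M by simp
    finally have *: "\<bar>f' (x + s *\<^sub>R u + t *\<^sub>R v) u - f' (x + s *\<^sub>R u + 0) u - t * f'' v\<bar> \<le> \<epsilon> * t" .
    have "f (x + t *\<^sub>R u + t *\<^sub>R v) - f (x + t *\<^sub>R u) - f (x + t *\<^sub>R v) + f x - t\<^sup>2 * f'' v
      = t * (f' (x + s *\<^sub>R u + t *\<^sub>R v) u - f' (x + s *\<^sub>R u + 0) u - t * f'' v)"
      using F by (simp add: F_def power2_eq_square algebra_simps)
    then show ?thesis
      using mult_left_mono [OF *, of t] t by (simp add: abs_mult power2_eq_square mult.left_commute mult.commute)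
  qed
  ultimately show ?thesis by blast
qed

text \<open>The second difference is unchanged when \<open>u\<close> and \<open>v\<close> are
  exchanged, and it approximates both mixed derivatives.\<close>

lemma second_derivative_symmetric_real:
  fixes f :: "'a::real_normed_vector \<Rightarrow> real"
  assumes S: "open S" "x \<in> S" and f: "\<And>y. y \<in> S \<Longrightarrow> (f has_derivative f' y) (at y)"
    and f'': "\<And>u. ((\<lambda>y. f' y u) has_derivative (\<lambda>h. f'' h u)) (at x)"
  shows "f'' u v = f'' v u"
proof -
  have "\<bar>f'' u v - f'' v u\<bar> \<le> \<epsilon>" if "0 < \<epsilon>" for \<epsilon>
  proof -
    have e: "0 < \<epsilon> / 2" using that by simp
    obtain d1 where d1: "0 < d1" "\<And>t. 0 < t \<Longrightarrow> t < d1 \<Longrightarrow>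
       \<bar>f (x + t *\<^sub>R u + t *\<^sub>R v) - f (x + t *\<^sub>R u) - f (x + t *\<^sub>R v) + f x - t\<^sup>2 * f'' v u\<bar> \<le> \<epsilon> / 2 * t\<^sup>2"
      using second_difference [OF S f f'' [of u] e, of v] by blast
    obtain d2 where d2: "0 < d2" "\<And>t. 0 < t \<Longrightarrow> t < d2 \<Longrightarrow>
       \<bar>f (x + t *\<^sub>R v + t *\<^sub>R u) - f (x + t *\<^sub>R v) - f (x + t *\<^sub>R u) + f x - t\<^sup>2 * f'' u v\<bar> \<le> \<epsilon> / 2 * t\<^sup>2"
      using second_difference [OF S f f'' [of v] e, of u] by blast
    define t where "t = min d1 d2 / 2"
    have t: "0 < t" "t < d1" "t < d2" using d1(1) d2(1) by (auto simp: t_def)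
    have comm: "x + t *\<^sub>R v + t *\<^sub>R u = x + t *\<^sub>R u + t *\<^sub>R v" by simp
    have "\<bar>t\<^sup>2 * f'' u v - t\<^sup>2 * f'' v u\<bar> \<le> \<epsilon> * t\<^sup>2"
      using d1(2) [OF t(1,2)] d2(2) [OF t(1,3), unfolded comm] by linarith
    then have "t\<^sup>2 * \<bar>f'' u v - f'' v u\<bar> \<le> t\<^sup>2 * \<epsilon>"
      by (simp add: abs_mult flip: right_diff_distrib) (simp add: mult.commute)
    then show ?thesis using t by simp
  qed
  then have "\<bar>f'' u v - f'' v u\<bar> \<le> 0" by (rule field_le_epsilon) simp
  then show ?thesis by simp
qed

lemma second_derivative_symmetric:
  fixes f :: "'a::real_normed_vector \<Rightarrow> real ^ 'n::finite"
  assumes S: "open S" "x \<in> S" and f: "\<And>y. y \<in> S \<Longrightarrow> (f has_derivative f' y) (at y)"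
    and f'': "\<And>u. ((\<lambda>y. f' y u) has_derivative (\<lambda>h. f'' h u)) (at x)"
  shows "f'' u v = f'' v u"
proof (rule vec_eq_iff [THEN iffD2], rule allI)
  fix i
  have nth: "((\<lambda>y. h y $ i) has_derivative (\<lambda>k. h' k $ i)) (at y)"
    if "(h has_derivative h') (at y)" for h :: "'a \<Rightarrow> real ^ 'n" and h' y
    by (rule bounded_linear.has_derivative [OF bounded_linear_vec_nth that])
  show "f'' u v $ i = f'' v u $ i"
    by (rule second_derivative_symmetric_real [OF S nth [OF f] nth [OF f'']])
qed

lemma has_derivative_nhds_cong:
  assumes "(f has_derivative f') (at x)" "\<forall>\<^sub>F y in nhds x. f y = h y"
  shows "(h has_derivative f') (at x)"
proof (rule has_derivative_transform_eventually [OF assms(1)])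
  show "\<forall>\<^sub>F y in at x. f y = h y"
    using assms(2) by (simp add: eventually_nhds_conv_at)
  show "f x = h x" using assms(2) by (rule eventually_nhds_x_imp_x)
qed simp

lemma frechet_derivative_nhds_cong:
  assumes "\<forall>\<^sub>F y in nhds x. f y = h y"
  shows "frechet_derivative f (at x) = frechet_derivative h (at x)"
proof -
  have "\<forall>\<^sub>F y in nhds x. h y = f y" using assms by (rule eventually_mono) simp
  then show ?thesis
    unfolding frechet_derivative_def using assms has_derivative_nhds_cong by metis
qed

lemma differentiable_nhds_cong:
  "f differentiable at x \<Longrightarrow> \<forall>\<^sub>F y in nhds x. f y = h y \<Longrightarrow> h differentiable at x"
  unfolding differentiable_def using has_derivative_nhds_cong by blast

lemma vec_expand: "(\<Sum>i\<in>UNIV. x $ i *\<^sub>R axis i 1) = (x :: real ^ 'n::finite)"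
  using basis_expansion [of x] by (simp add: scalar_mult_eq_scaleR)

lemma linear_vec_expand:
  fixes f :: "real ^ 'n::finite \<Rightarrow> 'b::real_vector"
  assumes "linear f" shows "f x = (\<Sum>i\<in>UNIV. x $ i *\<^sub>R f (axis i 1))"
  using linear_sum [OF assms, of "\<lambda>i. x $ i *\<^sub>R axis i 1" UNIV]
  by (simp add: vec_expand linear_cmul [OF assms])

text \<open>A product rule for linear maps of which only the values on fixed vectors are known to be
  differentiable: expanding the argument in the standard basis leaves finitely many scalar
  products.\<close>

lemma has_derivative_apply:
  fixes L :: "'a::real_normed_vector \<Rightarrow> real ^ 'n::finite \<Rightarrow> 'b::real_normed_vector"
  assumes lin: "\<forall>\<^sub>F u in nhds x. linear (L u)"
    and dL: "\<And>a. ((\<lambda>u. L u a) has_derivative (\<lambda>h. dL h a)) (at x)"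
    and a: "(a has_derivative a') (at x)"
  shows "((\<lambda>u. L u (a u)) has_derivative (\<lambda>h. dL h (a x) + L x (a' h))) (at x)"
proof -
  have ex: "\<forall>\<^sub>F u in nhds x. (\<Sum>i\<in>UNIV. w u $ i *\<^sub>R L u (axis i 1)) = L u (w u)" for w :: "'a \<Rightarrow> real ^ 'n"
    using lin by (rule eventually_mono) (simp add: linear_vec_expand [symmetric])
  have linx: "linear (L x)" using lin by (rule eventually_nhds_x_imp_x)
  have D: "((\<lambda>u. L u (w u)) has_derivative (\<lambda>h. \<Sum>i\<in>UNIV. w x $ i *\<^sub>R dL h (axis i 1) + w' h $ i *\<^sub>R L x (axis i 1))) (at x)"
    if w: "(w has_derivative w') (at x)" for w w'
    by (rule has_derivative_nhds_cong [OF _ ex])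
       (intro has_derivative_sum has_derivative_scaleR dL bounded_linear.has_derivative [OF bounded_linear_vec_nth w])
  \<comment> \<open>Linearity of \<open>dL h\<close> is not assumed; uniqueness of the derivative
    for constant arguments supplies it.\<close>
  have "(\<lambda>h. dL h w) = (\<lambda>h. \<Sum>i\<in>UNIV. w $ i *\<^sub>R dL h (axis i 1))" for w
    using has_derivative_unique [OF dL [of w] D [OF has_derivative_const [of w]]] by simp
  then have *: "dL h w = (\<Sum>i\<in>UNIV. w $ i *\<^sub>R dL h (axis i 1))" for h w by (rule fun_cong)
  have "(\<lambda>h. dL h (a x) + L x (a' h))
      = (\<lambda>h. \<Sum>i\<in>UNIV. a x $ i *\<^sub>R dL h (axis i 1) + a' h $ i *\<^sub>R L x (axis i 1))"
    unfolding sum.distrib using * [of _ "a x"] linear_vec_expand [OF linx, of "a' _"] by simp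
  then show ?thesis using D [OF a] by (simp only:)
qed

lemma differentiable_prod':
  fixes f :: "'i \<Rightarrow> 'a::real_normed_vector \<Rightarrow> real"
  assumes "finite I" "\<And>i. i \<in> I \<Longrightarrow> f i differentiable at x"
  shows "(\<lambda>u. \<Prod>i\<in>I. f i u) differentiable at x"
  using assms by (induction I rule: finite_induct) (auto intro: differentiable_mult)

lemma differentiable_det:
  fixes A :: "'a::real_normed_vector \<Rightarrow> real ^ 'n::finite ^ 'n"
  assumes "\<And>i j. (\<lambda>u. A u $ i $ j) differentiable at x"
  shows "(\<lambda>u. det (A u)) differentiable at x"
  unfolding det_def
  by (intro differentiable_sum ballI differentiable_mult differentiable_const differentiable_prod' assms finite)

lemma differentiable_vec:
  fixes w :: "'a::real_normed_vector \<Rightarrow> real ^ 'n::finite"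
  assumes "\<And>i. (\<lambda>u. w u $ i) differentiable at x"
  shows "w differentiable at x"
proof -
  have "(\<lambda>u. \<Sum>i\<in>UNIV. w u $ i *\<^sub>R (axis i 1 :: real ^ 'n)) differentiable at x"
    by (intro differentiable_sum ballI differentiable_scaleR assms differentiable_const finite)
  then show ?thesis by (simp add: vec_expand)
qed

text \<open>Raising an index is a linear system with the Gram matrix of \<open>H\<close>.
  Definiteness makes the determinant nonzero, and by Cramer's rule the solution is a rational
  function of the data. It serves to differentiate fields that are only known through a
  tensor.\<close>

lemma differentiable_solve:
  fixes H :: "'a::real_normed_vector \<Rightarrow> (real ^ 'n::finite) form2"
  assumes H: "\<forall>\<^sub>F u in nhds x. inner_form (H u)"
    and dH: "\<And>a b. (\<lambda>u. H u a b) differentiable at x"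
    and dw: "\<And>a. (\<lambda>u. H u (w u) a) differentiable at x"
  shows "w differentiable at x"
proof (rule differentiable_vec)
  fix k
  define A :: "'a \<Rightarrow> real ^ 'n ^ 'n" where "A u = (\<chi> i j. H u (axis j 1) (axis i 1))" for u
  define b :: "'a \<Rightarrow> real ^ 'n" where "b u = (\<chi> i. H u (w u) (axis i 1))" for u
  let ?N = "\<lambda>u. \<chi> i j. if j = k then b u $ i else A u $ i $ j"
  have mult: "A u *v v = (\<chi> i. H u v (axis i 1))" if "inner_form (H u)" for u v
  proof -
    interpret inner_form "H u" by fact
    show ?thesis
      using linear_vec_expand [OF linear_g(2), of v]
      by (simp add: vec_eq_iff A_def matrix_vector_mult_def mult.commute)
  qed
  have det: "det (A u) \<noteq> 0" if "inner_form (H u)" for u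
  proof -
    interpret inner_form "H u" by fact
    have "v = 0" if "A u *v v = 0" for v
    proof (rule ccontr)
      assume "v \<noteq> 0"
      have "H u v (axis i 1) = 0" for i
        using that mult [OF \<open>inner_form (H u)\<close>, of v] by (metis vec_lambda_beta zero_index)
      then have "H u v v = 0" using linear_vec_expand [OF linear_g(1), of v v] by simp
      with pos [OF \<open>v \<noteq> 0\<close>] show False by simp
    qed
    then have "\<exists>B. B ** A u = mat 1" by (simp add: matrix_left_invertible_ker)
    then have "invertible (A u)" by (metis invertible_def matrix_left_right_inverse)
    then show ?thesis by (simp add: invertible_det_nz)
  qed
  have "\<forall>\<^sub>F u in nhds x. det (?N u) / det (A u) = w u $ k"
    using H
  proof (rule eventually_mono)
    fix u assume u: "inner_form (H u)"
    have "A u *v w u = b u" by (simp add: mult [OF u] b_def)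
    then have "w u = (\<chi> k. det (\<chi> i j. if j = k then b u $ i else A u $ i $ j) / det (A u))"
      using cramer [OF det [OF u]] by blast
    then have "w u $ k = (\<chi> k. det (\<chi> i j. if j = k then b u $ i else A u $ i $ j) / det (A u)) $ k" by simp
    then show "det (?N u) / det (A u) = w u $ k" by simp
  qed
  moreover have "(\<lambda>u. det (?N u) / det (A u)) differentiable at x"
  proof (intro differentiable_divide differentiable_det)
    show "(\<lambda>u. ?N u $ i $ j) differentiable at x" for i j
      by (cases "j = k") (simp_all add: A_def b_def dH dw)
    show "(\<lambda>u. A u $ i $ j) differentiable at x" for i j
      by (simp add: A_def dH)
    show "det (A x) \<noteq> 0" using det eventually_nhds_x_imp_x [OF H] by blast
  qed
  ultimately show "(\<lambda>u. w u $ k) differentiable at x"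
    by (rule differentiable_nhds_cong [rotated])
qed

lemma smooth_on_has_derivative:
  assumes "smooth_on S f" "x \<in> S"
  shows "(f has_derivative frechet_derivative f (at x)) (at x)"
  using assms frechet_derivative_works [of f "at x"]
  by (auto simp: smooth_on_def dest: spec [of _ "Suc 0"])

lemma smooth_on_has_second_derivative:
  assumes "smooth_on S f" "x \<in> S"
  shows "((\<lambda>x. frechet_derivative f (at x) v) has_derivative
    frechet_derivative (\<lambda>x. frechet_derivative f (at x) v) (at x)) (at x)"
proof -
  have "Ck_on (Suc (Suc 0)) S f" using assms by (auto simp: smooth_on_def)
  then have "(\<lambda>x. frechet_derivative f (at x) v) differentiable at x" using assms(2) by auto
  then show ?thesis by (rule frechet_derivative_works [THEN iffD1])
qed

section \<open>Charts and coordinate expressions\<close>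

lemma open_eventually_nhds: "open S \<Longrightarrow> x \<in> S \<Longrightarrow> (\<And>y. y \<in> S \<Longrightarrow> P y) \<Longrightarrow> \<forall>\<^sub>F y in nhds x. P y"
  by (auto simp: eventually_nhds)

locale atlas =
  fixes A :: "('m::topological_space, 'n::finite) chart set"
  assumes atlas: "smooth_atlas A"
begin

lemma chart: "c \<in> A \<Longrightarrow> is_chart c"
  using atlas by (simp add: smooth_atlas_def)

lemma open_chart: "c \<in> A \<Longrightarrow> open (fst c)"
  using chart by (simp add: is_chart_def)

lemma chart_inv_snd: "c \<in> A \<Longrightarrow> q \<in> fst c \<Longrightarrow> chart_inv c (snd c q) = q"
  using chart homeomorphism_apply1 unfolding is_chart_def by blast

lemma chart_inv_in: "c \<in> A \<Longrightarrow> u \<in> snd c ` fst c \<Longrightarrow> chart_inv c u \<in> fst c"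
  by (auto simp: chart_inv_snd [of c])

lemma open_image:
  assumes c: "c \<in> A" and W: "open W"
  shows "open (snd c ` (fst c \<inter> W))"
proof -
  have h: "homeomorphism (fst c) (snd c ` fst c) (snd c) (chart_inv c)" and o: "open (snd c ` fst c)"
    using chart [OF c] by (auto simp: is_chart_def)
  have "openin (top_of_set (fst c)) (fst c \<inter> W)" using W by auto
  then have "openin (top_of_set (snd c ` fst c)) (snd c ` (fst c \<inter> W))"
    using homeomorphism_imp_open_map [OF h] by blast
  then show ?thesis using o openin_open_trans by blast
qed

lemma chart_at: "chart_at A q \<in> A" "q \<in> fst (chart_at A q)"
proof -
  have "q \<in> (\<Union>c\<in>A. fst c)" using atlas unfolding smooth_atlas_def by simp
  then have "\<exists>c. c \<in> A \<and> q \<in> fst c" by blast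
  from someI_ex [OF this] show "chart_at A q \<in> A" "q \<in> fst (chart_at A q)"
    by (auto simp: chart_at_def)
qed

lemma eventually_chart:
  assumes "c \<in> A" "open W" "q \<in> fst c" "q \<in> W" "\<And>r. r \<in> fst c \<Longrightarrow> r \<in> W \<Longrightarrow> P (snd c r)"
  shows "\<forall>\<^sub>F u in nhds (snd c q). P u"
  by (rule open_eventually_nhds [OF open_image [OF assms(1,2)]]) (use assms in auto)

lemma transition_has_derivative:
  assumes "c \<in> A" "d \<in> A" "q \<in> fst c" "q \<in> fst d"
  shows "((snd d \<circ> chart_inv c) has_derivative frechet_derivative (snd d \<circ> chart_inv c) (at (snd c q))) (at (snd c q))"
  by (rule smooth_on_has_derivative [where S = "snd c ` (fst c \<inter> fst d)"])
     (use assms atlas in \<open>auto simp: smooth_atlas_def\<close>)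

lemma frechet_derivative_change_chart:
  fixes f :: "'m \<Rightarrow> 'v::real_normed_vector"
  assumes c: "c \<in> A" "q \<in> fst c" and d: "d \<in> A" "q \<in> fst d"
    and f: "(f \<circ> chart_inv d) differentiable at (snd d q)"
  shows "((f \<circ> chart_inv c) has_derivative frechet_derivative (f \<circ> chart_inv d) (at (snd d q)) \<circ>
    frechet_derivative (snd d \<circ> chart_inv c) (at (snd c q))) (at (snd c q))"
proof (rule has_derivative_nhds_cong)
  have "((f \<circ> chart_inv d) has_derivative frechet_derivative (f \<circ> chart_inv d) (at (snd d q)))
      (at ((snd d \<circ> chart_inv c) (snd c q)))"
    using f [unfolded frechet_derivative_works] by (simp add: chart_inv_snd [OF c])
  then show "((f \<circ> chart_inv d) \<circ> (snd d \<circ> chart_inv c) has_derivative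
      frechet_derivative (f \<circ> chart_inv d) (at (snd d q)) \<circ> frechet_derivative (snd d \<circ> chart_inv c) (at (snd c q)))
      (at (snd c q))"
    using transition_has_derivative [OF c(1) d(1) c(2) d(2)] diff_chain_at by blast
  show "\<forall>\<^sub>F u in nhds (snd c q). (f \<circ> chart_inv d \<circ> (snd d \<circ> chart_inv c)) u = (f \<circ> chart_inv c) u"
    by (rule eventually_chart [OF c(1) open_chart [OF d(1)] c(2) d(2)])
       (simp add: chart_inv_snd [OF c(1)] chart_inv_snd [OF d(1)])
qed

lemma frechet_derivative_identity:
  assumes "c \<in> A" "q \<in> fst c"
  shows "frechet_derivative (snd c \<circ> chart_inv c) (at (snd c q)) = (\<lambda>x. x)"
proof -
  have "\<forall>\<^sub>F u in nhds (snd c q). u = (snd c \<circ> chart_inv c) u"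
    by (rule eventually_chart [OF assms(1) open_UNIV assms(2)]) (simp_all add: chart_inv_snd [OF assms(1)])
  then have "((snd c \<circ> chart_inv c) has_derivative (\<lambda>x. x)) (at (snd c q))"
    by (rule has_derivative_nhds_cong [OF has_derivative_ident])
  then show ?thesis by (rule frechet_derivative_at [symmetric])
qed

lemma coord_vector_chart_at: "coord_vector A (chart_at A q) q x = x"
  by (simp add: coord_vector_def frechet_derivative_identity chart_at)

lemma components_chart_at: "components A (chart_at A q) q x = x"
  by (simp add: components_def differential_fun_def frechet_derivative_identity chart_at)

lemma linear_coord_vector:
  assumes "c \<in> A" "q \<in> fst c" shows "linear (coord_vector A c q)"
  unfolding coord_vector_def
  using transition_has_derivative [OF assms(1) chart_at(1) assms(2) chart_at(2)] has_derivative_linear by blast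

lemma components_coord_vector:
  assumes "c \<in> A" "q \<in> fst c" shows "components A c q (coord_vector A c q x) = x"
proof -
  let ?d = "chart_at A q"
  have "(snd c \<circ> chart_inv ?d) differentiable at (snd ?d q)"
    using transition_has_derivative [OF chart_at(1) assms(1) chart_at(2) assms(2)] differentiableI by blast
  from frechet_derivative_change_chart [OF assms chart_at this]
  have "frechet_derivative (snd c \<circ> chart_inv c) (at (snd c q)) =
      frechet_derivative (snd c \<circ> chart_inv ?d) (at (snd ?d q)) \<circ> frechet_derivative (snd ?d \<circ> chart_inv c) (at (snd c q))"
    by (rule frechet_derivative_at [symmetric])
  then show ?thesis
    by (simp add: frechet_derivative_identity [OF assms] components_def differential_fun_def coord_vector_def fun_eq_iff)
qed

lemma coord_vector_components:
  assumes "c \<in> A" "q \<in> fst c" shows "coord_vector A c q (components A c q x) = x"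
proof -
  have "inj (coord_vector A c q)"
    by (rule inj_on_inverseI) (rule components_coord_vector [OF assms])
  then have "surj (coord_vector A c q)"
    using linear_inj_imp_surj linear_coord_vector [OF assms] by blast
  then obtain y where "x = coord_vector A c q y" by blast
  then show ?thesis by (simp add: components_coord_vector [OF assms])
qed

lemma linear_components:
  assumes "c \<in> A" "q \<in> fst c" shows "linear (components A c q)"
  unfolding components_def differential_fun_def
  using transition_has_derivative [OF chart_at(1) assms(1) chart_at(2) assms(2)] has_derivative_linear by blast

lemma local2_chart_at: "local2 A (chart_at A p) T (snd (chart_at A p) p) x y = T p x y"
  by (simp add: local2_def Let_def chart_inv_snd chart_at coord_vector_chart_at)

lemma local3_chart_at: "local3 A (chart_at A p) T (snd (chart_at A p) p) x y z = T p x y z"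
  by (simp add: local3_def Let_def chart_inv_snd chart_at coord_vector_chart_at)

lemma local_end_chart_at: "local_end A (chart_at A p) T (snd (chart_at A p) p) x = T p x"
  by (simp add: local_end_def Let_def chart_inv_snd chart_at coord_vector_chart_at components_chart_at)

end

text \<open>Only differentiability at base points is demanded of the metric, so the induced metric
  on a hypersurface is an instance as soon as its first derivative is computed.\<close>

locale riemannian = atlas B for B :: "('b::topological_space, 'k::finite) chart set" +
  fixes g :: "'b \<Rightarrow> (real ^ 'k) form2"
  assumes metric: "\<And>p. inner_form (g p)"
    and metric_differentiable: "\<And>p x y. (\<lambda>u. local2 B (chart_at B p) g u x y) differentiable at (snd (chart_at B p) p)"
begin

abbreviation "ch p \<equiv> chart_at B p"
abbreviation "pt p \<equiv> snd (chart_at B p) p"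
abbreviation "dg p X x y \<equiv> frechet_derivative (\<lambda>u. local2 B (ch p) g u x y) (at (pt p)) X"
abbreviation "\<Gamma> p \<equiv> christoffel B g (ch p) (pt p)"

lemma has_derivative_g: "((\<lambda>u. local2 B (ch p) g u x y) has_derivative (\<lambda>X. dg p X x y)) (at (pt p))"
  using metric_differentiable frechet_derivative_works by blast

lemma inner_form_local2:
  assumes "u \<in> snd (ch p) ` fst (ch p)" shows "inner_form (local2 B (ch p) g u)"
proof -
  let ?q = "chart_inv (ch p) u"
  have q: "?q \<in> fst (ch p)" using chart_inv_in [OF chart_at(1) assms] .
  interpret inner_form "g ?q" by (rule metric)
  let ?e = "coord_vector B (ch p) ?q"
  have lin: "linear ?e" by (rule linear_coord_vector [OF chart_at(1) q])
  have nz: "?e x \<noteq> 0" if "x \<noteq> 0" for x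
    using components_coord_vector [OF chart_at(1) q, of x] linear_0 [OF linear_components [OF chart_at(1) q]] that by metis
  show ?thesis
    unfolding inner_form_def local2_def Let_def
    using sym pos nz by (auto intro!: bilinearI simp: linear_add [OF lin] linear_cmul [OF lin])
qed

lemma eventually_inner_form: "\<forall>\<^sub>F u in nhds (pt p). inner_form (local2 B (ch p) g u)"
  by (rule eventually_chart [OF chart_at(1) open_UNIV chart_at(2)]) (auto intro: inner_form_local2)

lemma linear_dg: "linear (\<lambda>X. dg p X x y)" "linear (\<lambda>x. dg p X x y)" "linear (\<lambda>y. dg p X x y)"
  and dg_sym: "dg p X x y = dg p X y x"
proof -
  show "linear (\<lambda>X. dg p X x y)" for x y using has_derivative_linear [OF has_derivative_g] .
  show s: "dg p X x y = dg p X y x" for X x y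
  proof -
    have "\<forall>\<^sub>F u in nhds (pt p). local2 B (ch p) g u x y = local2 B (ch p) g u y x"
      using eventually_inner_form by (rule eventually_mono) (rule inner_form.sym)
    from fun_cong [OF frechet_derivative_nhds_cong [OF this]] show ?thesis .
  qed
  show l: "linear (\<lambda>x. dg p X x y)" for X y
  proof (rule linearI)
    fix x x' and r :: real
    have "((\<lambda>u. local2 B (ch p) g u x y + local2 B (ch p) g u x' y) has_derivative (\<lambda>X. dg p X x y + dg p X x' y)) (at (pt p))"
      by (intro has_derivative_add has_derivative_g)
    moreover have "\<forall>\<^sub>F u in nhds (pt p). local2 B (ch p) g u x y + local2 B (ch p) g u x' y = local2 B (ch p) g u (x + x') y"
      using eventually_inner_form by (rule eventually_mono) (simp add: inner_form.g_simps)
    ultimately have "((\<lambda>u. local2 B (ch p) g u (x + x') y) has_derivative (\<lambda>X. dg p X x y + dg p X x' y)) (at (pt p))"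
      by (rule has_derivative_nhds_cong)
    from fun_cong [OF has_derivative_unique [OF this has_derivative_g], of X] show "dg p X (x + x') y = dg p X x y + dg p X x' y" by simp
    have "((\<lambda>u. r *\<^sub>R local2 B (ch p) g u x y) has_derivative (\<lambda>X. r *\<^sub>R dg p X x y)) (at (pt p))"
      by (intro has_derivative_scaleR_right has_derivative_g)
    moreover have "\<forall>\<^sub>F u in nhds (pt p). r *\<^sub>R local2 B (ch p) g u x y = local2 B (ch p) g u (r *\<^sub>R x) y"
      using eventually_inner_form by (rule eventually_mono) (simp add: inner_form.g_simps)
    ultimately have "((\<lambda>u. local2 B (ch p) g u (r *\<^sub>R x) y) has_derivative (\<lambda>X. r *\<^sub>R dg p X x y)) (at (pt p))"
      by (rule has_derivative_nhds_cong)
    from fun_cong [OF has_derivative_unique [OF this has_derivative_g], of X] show "dg p X (r *\<^sub>R x) y = r *\<^sub>R dg p X x y" by simp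
  qed
  have "(\<lambda>y. dg p X x y) = (\<lambda>y. dg p X y x)" by (intro ext) (rule s)
  then show "linear (\<lambda>y. dg p X x y)" using l by (simp only:)
qed

end

section \<open>The Levi-Civita connection\<close>

text \<open>Riesz representation from a basis in place of an orthonormal frame: the Gram map is
  injective by definiteness, hence surjective.\<close>

lemma (in inner_form) riesz_vec:
  fixes f :: "'v \<Rightarrow> real" and h :: "real ^ 'n::finite \<Rightarrow> 'v"
  assumes "linear f" "linear h" "bij h"
  shows "\<exists>!w. \<forall>z. g w z = f z"
proof -
  define T :: "real ^ 'n \<Rightarrow> real ^ 'n" where "T w = (\<chi> i. g (h w) (h (axis i 1)))" for w
  have lin: "linear (\<lambda>z. g w (h z))" "linear (\<lambda>z. f (h z))" for w
    using linear_compose [OF assms(2) linear_g(1)] linear_compose [OF assms(2,1)] by (simp_all add: o_def)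
  have T: "g w' (h z) = f' (h z)" if "\<And>i. g w' (h (axis i 1)) = f' (h (axis i 1))" "linear (\<lambda>z. f' (h z))" for w' f' z
    using linear_vec_expand [OF lin(1), of w' z] linear_vec_expand [OF that(2), of z] that(1) by simp
  have "linear T"
    by (simp add: T_def linear_iff vec_eq_iff linear_add [OF assms(2)] linear_cmul [OF assms(2)])
  moreover have "inj T"
  proof (rule injI)
    fix x y assume "T x = T y"
    then have e: "g (h x) (h (axis i 1)) = g (h y) (h (axis i 1))" for i by (simp add: T_def vec_eq_iff)
    have "g (h x) (h z) = g (h y) (h z)" for z by (rule T [OF e lin(1)])
    then have "h x = h y" using assms(3) by (intro eqI) (metis bij_pointE)
    then show "x = y" using assms(3) by (meson bij_def injD)
  qed
  ultimately have "surj T" by (rule linear_inj_imp_surj)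
  then obtain x where x: "T x = (\<chi> i. f (h (axis i 1)))" by (metis surjD)
  have "g (h x) (h z) = f (h z)" for z
    by (rule T [OF _ lin(2)]) (use x in \<open>simp add: T_def vec_eq_iff\<close>)
  then have "\<forall>z. g (h x) z = f z" using assms(3) by (metis bij_pointE)
  then show ?thesis by (auto intro: eqI)
qed

lemma eventually_nhds_compose:
  "isCont F x \<Longrightarrow> \<forall>\<^sub>F v in nhds (F x). P v \<Longrightarrow> \<forall>\<^sub>F u in nhds x. P (F u)"
  unfolding isCont_def tendsto_at_iff_tendsto_nhds by (rule eventually_compose_filterlim)

section \<open>Levi-Civita connection and covariant product rules along a map\<close>

context riemannian begin

lemma christoffel: "2 * g p (\<Gamma> p x y) z = dg p x y z + dg p y x z - dg p z x y"
proof -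
  interpret inner_form "g p" by (rule metric)
  have "linear (\<lambda>z. dg p x y z + dg p y x z - dg p z x y)"
    by (intro linear_compose_sub linear_compose_add linear_dg)
  then have "linear (\<lambda>z. (dg p x y z + dg p y x z - dg p z x y) / 2)"
    by (simp add: linear_iff add_divide_distrib)
  then have "\<exists>!w. \<forall>z. g p w z = (dg p x y z + dg p y x z - dg p z x y) / 2"
    by (rule riesz_vec [where h = "\<lambda>x. x"]) (simp_all add: linear_iff bij_def inj_def surj_def)
  then have "\<exists>!w. \<forall>z. 2 * g p w z = dg p x y z + dg p y x z - dg p z x y"
    by (simp add: eq_divide_eq mult.commute)
  from theI' [OF this] show ?thesis
    unfolding christoffel_def local2_chart_at by blast
qed

lemma christoffel_sym: "\<Gamma> p x y = \<Gamma> p y x"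
proof (rule inner_form.eqI [OF metric])
  fix z show "g p (\<Gamma> p x y) z = g p (\<Gamma> p y x) z"
    using christoffel [of p x y z] christoffel [of p y x z] dg_sym [of p x y z] by simp
qed

lemma metric_compatible: "dg p X x y = g p (\<Gamma> p X x) y + g p x (\<Gamma> p X y)"
  using christoffel [of p X x y] christoffel [of p X y x] dg_sym [of p x y X] dg_sym [of p X y x] dg_sym [of p X x y]
  by (simp add: inner_form.sym [OF metric, of p x])

text \<open>The Christoffel terms absorb the derivative of the metric. The map \<open>F\<close> into
  the chart is kept general: the identity serves for fields on the manifold, the local expression of
  the immersion for fields along it.\<close>

lemma covariant_product2:
  fixes F :: "'a::real_normed_vector \<Rightarrow> real ^ 'k"
  assumes F: "(F has_derivative F') (at x0)" "F x0 = pt q"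
    and a: "(a has_derivative a') (at x0)" and b: "(b has_derivative b') (at x0)"
  shows "((\<lambda>u. local2 B (ch q) g (F u) (a u) (b u)) has_derivative
    (\<lambda>h. g q (a' h + \<Gamma> q (F' h) (a x0)) (b x0) + g q (a x0) (b' h + \<Gamma> q (F' h) (b x0)))) (at x0)"
proof -
  interpret inner_form "g q" by (rule metric)
  have "isCont F x0" using F(1) has_derivative_continuous by blast
  then have ev: "\<forall>\<^sub>F u in nhds x0. inner_form (local2 B (ch q) g (F u))"
    by (rule eventually_nhds_compose) (simp add: F(2) eventually_inner_form)
  have at: "local2 B (ch q) g (F x0) = g q" by (intro ext) (simp add: F(2) local2_chart_at)
  have 0: "((\<lambda>u. local2 B (ch q) g (F u) x y) has_derivative (\<lambda>h. dg q (F' h) x y)) (at x0)" for x y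
    using has_derivative_compose [OF F(1), of "\<lambda>u. local2 B (ch q) g u x y"] has_derivative_g [of q x y] F(2) by simp
  have ev1: "\<forall>\<^sub>F u in nhds x0. linear (\<lambda>x. local2 B (ch q) g (F u) x y)" for y
    using ev by (rule eventually_mono) (rule inner_form.linear_g(2))
  have ev2: "\<forall>\<^sub>F u in nhds x0. linear (local2 B (ch q) g (F u) (a u))"
    using ev by (rule eventually_mono) (rule inner_form.linear_g(1))
  have 1: "((\<lambda>u. local2 B (ch q) g (F u) (a u) y) has_derivative (\<lambda>h. dg q (F' h) (a x0) y + g q (a' h) y)) (at x0)" for y
    using has_derivative_apply [where L = "\<lambda>u x. local2 B (ch q) g (F u) x y", OF ev1 0 a] by (simp add: at)
  have 2: "((\<lambda>u. local2 B (ch q) g (F u) (a u) (b u)) has_derivative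
      (\<lambda>h. dg q (F' h) (a x0) (b x0) + g q (a' h) (b x0) + g q (a x0) (b' h))) (at x0)"
    using has_derivative_apply [where L = "\<lambda>u. local2 B (ch q) g (F u) (a u)", OF ev2 1 b] by (simp add: at)
  then show ?thesis by (simp add: metric_compatible algebra_simps)
qed

definition regular3 :: "('b \<Rightarrow> (real ^ 'k) form3) \<Rightarrow> 'b \<Rightarrow> bool" where
  "regular3 T q \<longleftrightarrow> (\<forall>p. trilinear (T p)) \<and>
     (\<forall>x y z. (\<lambda>u. local3 B (ch q) T u x y z) differentiable at (pt q))"

lemma trilinear_local3:
  assumes "\<And>p. trilinear (T p)" "u \<in> snd (ch q) ` fst (ch q)"
  shows "trilinear (local3 B (ch q) T u)"
proof -
  let ?q = "chart_inv (ch q) u"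
  have q: "?q \<in> fst (ch q)" using chart_inv_in [OF chart_at(1) assms(2)] .
  have lin: "linear (coord_vector B (ch q) ?q)" by (rule linear_coord_vector [OF chart_at(1) q])
  note t = assms(1) [of ?q]
  show ?thesis
    unfolding local3_def Let_def
    by (rule trilinearI)
       (simp_all add: linear_add [OF lin] linear_cmul [OF lin] trilinear_simps [OF t])
qed

lemma covariant_product3:
  fixes F :: "'a::real_normed_vector \<Rightarrow> real ^ 'k"
  assumes T: "regular3 T q"
    and F: "(F has_derivative F') (at x0)" "F x0 = pt q"
    and a: "(a has_derivative a') (at x0)" and b: "(b has_derivative b') (at x0)" and c: "(c has_derivative c') (at x0)"
  shows "((\<lambda>u. local3 B (ch q) T (F u) (a u) (b u) (c u)) has_derivative
    (\<lambda>h. nabla3 B g T q (F' h) (a x0) (b x0) (c x0) + T q (a' h + \<Gamma> q (F' h) (a x0)) (b x0) (c x0)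
      + T q (a x0) (b' h + \<Gamma> q (F' h) (b x0)) (c x0) + T q (a x0) (b x0) (c' h + \<Gamma> q (F' h) (c x0)))) (at x0)"
proof -
  have tri: "trilinear (T p)" for p using T by (simp add: regular3_def)
  let ?D = "\<lambda>X x y z. frechet_derivative (\<lambda>u. local3 B (ch q) T u x y z) (at (pt q)) X"
  have D: "((\<lambda>u. local3 B (ch q) T u x y z) has_derivative (\<lambda>X. ?D X x y z)) (at (pt q))" for x y z
    using T frechet_derivative_works unfolding regular3_def by blast
  have evT: "\<forall>\<^sub>F u in nhds (pt q). trilinear (local3 B (ch q) T u)"
    by (rule eventually_chart [OF chart_at(1) open_UNIV chart_at(2)]) (auto intro: trilinear_local3 [OF tri])
  have "isCont F x0" using F(1) has_derivative_continuous by blast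
  then have ev: "\<forall>\<^sub>F u in nhds x0. trilinear (local3 B (ch q) T (F u))"
    by (rule eventually_nhds_compose) (simp add: F(2) evT)
  have ev1: "\<forall>\<^sub>F u in nhds x0. linear (\<lambda>x. local3 B (ch q) T (F u) x y z)" for y z
    using ev by (rule eventually_mono) (rule trilinearD(1))
  have ev2: "\<forall>\<^sub>F u in nhds x0. linear (\<lambda>y. local3 B (ch q) T (F u) (a u) y z)" for z
    using ev by (rule eventually_mono) (rule trilinearD(2))
  have ev3: "\<forall>\<^sub>F u in nhds x0. linear (\<lambda>z. local3 B (ch q) T (F u) (a u) (b u) z)"
    using ev by (rule eventually_mono) (rule trilinearD(3))
  have at: "local3 B (ch q) T (F x0) = T q" by (intro ext) (simp add: F(2) local3_chart_at)
  have 0: "((\<lambda>u. local3 B (ch q) T (F u) x y z) has_derivative (\<lambda>h. ?D (F' h) x y z)) (at x0)" for x y z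
    using has_derivative_compose [OF F(1), of "\<lambda>u. local3 B (ch q) T u x y z"] D [of x y z] F(2) by simp
  have 1: "((\<lambda>u. local3 B (ch q) T (F u) (a u) y z) has_derivative (\<lambda>h. ?D (F' h) (a x0) y z + T q (a' h) y z)) (at x0)" for y z
    using has_derivative_apply [where L = "\<lambda>u x. local3 B (ch q) T (F u) x y z", OF ev1 0 a] by (simp add: at)
  have 2: "((\<lambda>u. local3 B (ch q) T (F u) (a u) (b u) z) has_derivative
      (\<lambda>h. ?D (F' h) (a x0) (b x0) z + T q (a' h) (b x0) z + T q (a x0) (b' h) z)) (at x0)" for z
    using has_derivative_apply [where L = "\<lambda>u y. local3 B (ch q) T (F u) (a u) y z", OF ev2 1 b] by (simp add: at)
  have 3: "((\<lambda>u. local3 B (ch q) T (F u) (a u) (b u) (c u)) has_derivative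
      (\<lambda>h. ?D (F' h) (a x0) (b x0) (c x0) + T q (a' h) (b x0) (c x0) + T q (a x0) (b' h) (c x0) + T q (a x0) (b x0) (c' h))) (at x0)"
    using has_derivative_apply [where L = "\<lambda>u z. local3 B (ch q) T (F u) (a u) (b u) z", OF ev3 2 c] by (simp add: at)
  show ?thesis
    using 3 by (simp add: nabla3_def Let_def trilinear_simps [OF tri] algebra_simps)
qed

end

section \<open>Leibniz rules for combinations of tensors and for endomorphism fields\<close>

context riemannian begin

lemma differential_fun_has_derivative:
  assumes "(f \<circ> chart_inv (ch p)) differentiable at (pt p)"
  shows "((\<lambda>u. f (chart_inv (ch p) u)) has_derivative (\<lambda>x. differential_fun B f p x)) (at (pt p))"
  using assms unfolding differential_fun_def frechet_derivative_works by (simp add: o_def)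

lemma nabla3_combination:
  fixes f f' :: "'b \<Rightarrow> real"
  assumes T: "regular3 T p" "regular3 T' p"
    and f: "((\<lambda>u. f (chart_inv (ch p) u)) has_derivative df) (at (pt p))"
      "((\<lambda>u. f' (chart_inv (ch p) u)) has_derivative df') (at (pt p))"
  shows "nabla3 B g (\<lambda>q x y z. f q * T q x y z + f' q * T' q x y z) p X x y z =
    df X * T p x y z + f p * nabla3 B g T p X x y z + df' X * T' p x y z + f' p * nabla3 B g T' p X x y z"
proof -
  have 1: "((\<lambda>u. local3 B (ch p) T u x y z) has_derivative
      frechet_derivative (\<lambda>u. local3 B (ch p) T u x y z) (at (pt p))) (at (pt p))"
    if "regular3 T p" for T x y z
    using that frechet_derivative_works unfolding regular3_def by blast
  have at: "f (chart_inv (ch p) (pt p)) = f p" for f :: "'b \<Rightarrow> real"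
    by (simp add: chart_inv_snd chart_at)
  have l: "local3 B (ch p) (\<lambda>q x y z. f q * T q x y z + f' q * T' q x y z) u x y z =
      f (chart_inv (ch p) u) * local3 B (ch p) T u x y z + f' (chart_inv (ch p) u) * local3 B (ch p) T' u x y z" for u
    by (simp add: local3_def Let_def)
  have "((\<lambda>u. local3 B (ch p) (\<lambda>q x y z. f q * T q x y z + f' q * T' q x y z) u x y z) has_derivative
      (\<lambda>X. f p * frechet_derivative (\<lambda>u. local3 B (ch p) T u x y z) (at (pt p)) X + df X * T p x y z
       + (f' p * frechet_derivative (\<lambda>u. local3 B (ch p) T' u x y z) (at (pt p)) X + df' X * T' p x y z)))
      (at (pt p))"
    unfolding l
    using has_derivative_add [OF
        has_derivative_mult [OF f(1) 1 [OF T(1), of x y z]]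
        has_derivative_mult [OF f(2) 1 [OF T(2), of x y z]]]
    by (simp add: at local3_chart_at)
  from frechet_derivative_at [OF this, symmetric] show ?thesis
    by (simp add: nabla3_def Let_def algebra_simps)
qed

lemma has_derivative_local_end:
  assumes "\<And>y. (\<lambda>u. local_end B (ch p) J u y) differentiable at (pt p)"
  shows "((\<lambda>u. local_end B (ch p) J u y) has_derivative
    (\<lambda>X. nabla_end B g J p X y - \<Gamma> p X (J p y) + J p (\<Gamma> p X y))) (at (pt p))"
  using assms [of y] unfolding nabla_end_def Let_def frechet_derivative_works by simp

lemma local_end_apply:
  assumes "u \<in> snd (ch p) ` fst (ch p)"
  shows "coord_vector B (ch p) (chart_inv (ch p) u) (local_end B (ch p) J u y)
    = J (chart_inv (ch p) u) (coord_vector B (ch p) (chart_inv (ch p) u) y)"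
  unfolding local_end_def Let_def
  by (rule coord_vector_components [OF chart_at(1) chart_inv_in [OF chart_at(1) assms]])

lemma eventually_ch: "(\<And>u. u \<in> snd (ch p) ` fst (ch p) \<Longrightarrow> P u) \<Longrightarrow> \<forall>\<^sub>F u in nhds (pt p). P u"
  by (rule eventually_chart [OF chart_at(1) open_UNIV chart_at(2)]) auto

lemma nabla3_end:
  assumes T: "regular3 T p" and J: "\<And>y. (\<lambda>u. local_end B (ch p) J u y) differentiable at (pt p)"
    and lin: "\<And>q. linear (J q)"
  shows "regular3 (\<lambda>q x. T q (J q x)) p"
    and "nabla3 B g (\<lambda>q x. T q (J q x)) p X x y z = nabla3 B g T p X (J p x) y z + T p (nabla_end B g J p X x) y z"
proof -
  have tri: "trilinear (T q)" for q using T by (simp add: regular3_def)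
  let ?D = "\<lambda>x y z h. nabla3 B g T p h (J p x) y z
    + T p (nabla_end B g J p h x - \<Gamma> p h (J p x) + J p (\<Gamma> p h x) + \<Gamma> p h (J p x)) y z
    + T p (J p x) (0 + \<Gamma> p h y) z + T p (J p x) y (0 + \<Gamma> p h z)"
  have "((\<lambda>u. local3 B (ch p) T u (local_end B (ch p) J u x) y z) has_derivative ?D x y z) (at (pt p))" for x y z
    using covariant_product3 [OF T has_derivative_ident refl has_derivative_local_end [OF J, of x]
        has_derivative_const has_derivative_const, of y z]
    by (simp only: local_end_chart_at)
  moreover have "\<forall>\<^sub>F u in nhds (pt p). local3 B (ch p) T u (local_end B (ch p) J u x) y z =
      local3 B (ch p) (\<lambda>q x. T q (J q x)) u x y z" for x y z
    by (rule eventually_ch) (simp add: local3_def Let_def local_end_apply)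
  ultimately have D: "((\<lambda>u. local3 B (ch p) (\<lambda>q x. T q (J q x)) u x y z) has_derivative ?D x y z) (at (pt p))" for x y z
    by (rule has_derivative_nhds_cong)
  show "regular3 (\<lambda>q x. T q (J q x)) p"
    unfolding regular3_def
  proof (intro conjI allI)
    show "trilinear (\<lambda>x. T q (J q x))" for q
      using linear_compose [OF lin [of q] trilinearD(1) [OF tri]] trilinearD [OF tri [of q]]
      by (auto simp: trilinear_def o_def)
  qed (use D differentiableI in blast)
  show "nabla3 B g (\<lambda>q x. T q (J q x)) p X x y z = nabla3 B g T p X (J p x) y z + T p (nabla_end B g J p X x) y z"
    using fun_cong [OF frechet_derivative_at [OF D [of x y z]], of X]
    by (simp add: nabla3_def [of B g "\<lambda>q x. T q (J q x)"] Let_def trilinear_simps [OF tri])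
qed

text \<open>Since the metric is parallel, raising an index commutes with the covariant derivative.
  Differentiability of \<open>J\<close> is not assumed but recovered from its Kaehler form by
  \<open>differentiable_solve\<close>.\<close>

lemma nabla_end_kaehler:
  assumes d: "\<And>x y. (\<lambda>u. local2 B (ch p) (\<lambda>q. kaehler_form (g q) (J q)) u x y) differentiable at (pt p)"
  shows "(\<lambda>u. local_end B (ch p) J u y) differentiable at (pt p)"
    and "g p z (nabla_end B g J p X y) = nabla2 B g (\<lambda>q. kaehler_form (g q) (J q)) p X z y"
proof -
  interpret p: inner_form "g p" by (rule metric)
  have eq: "\<forall>\<^sub>F u in nhds (pt p). local2 B (ch p) (\<lambda>q. kaehler_form (g q) (J q)) u z y =
      local2 B (ch p) g u (local_end B (ch p) J u y) z" for y z
    by (rule eventually_ch)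
       (simp add: local2_def Let_def local_end_apply kaehler_form_def inner_form.sym [OF metric, of _ "J _ _"])
  show J: "(\<lambda>u. local_end B (ch p) J u y) differentiable at (pt p)" for y
    by (rule differentiable_solve [OF eventually_inner_form metric_differentiable])
       (rule differentiable_nhds_cong [OF d eq])
  have "((\<lambda>u. local2 B (ch p) g u (local_end B (ch p) J u y) z) has_derivative
      (\<lambda>X. g p (nabla_end B g J p X y - \<Gamma> p X (J p y) + J p (\<Gamma> p X y) + \<Gamma> p X (J p y)) z + g p (J p y) (0 + \<Gamma> p X z)))
      (at (pt p))"
    using covariant_product2 [OF has_derivative_ident refl has_derivative_local_end [OF J, of y] has_derivative_const, of z]
    by (simp only: local_end_chart_at)
  from fun_cong [OF frechet_derivative_at [OF this], of X]
  have "frechet_derivative (\<lambda>u. local2 B (ch p) (\<lambda>q. kaehler_form (g q) (J q)) u z y) (at (pt p)) X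
      = g p (nabla_end B g J p X y) z + g p (J p (\<Gamma> p X y)) z + g p (J p y) (\<Gamma> p X z)"
    unfolding frechet_derivative_nhds_cong [OF eq] by simp
  then show "g p z (nabla_end B g J p X y) = nabla2 B g (\<lambda>q. kaehler_form (g q) (J q)) p X z y"
    by (simp add: nabla2_def Let_def kaehler_form_def p.sym [of z] p.sym [of "\<Gamma> p X z"])
qed

end

section \<open>Hypersurfaces\<close>

locale hypersurface = A: atlas A + B: riemannian B g
  for A :: "('m::topological_space, 6) chart set" and B :: "('b::topological_space, 7) chart set" and g +
  fixes \<iota> :: "'m \<Rightarrow> 'b" and n :: "'m \<Rightarrow> real ^ 7"
  assumes smooth: "smooth_map A B \<iota>" and immersion: "inj (differential A B \<iota> p)"
    and unit_normal: "unit_normal_field A B g \<iota> n"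
begin

abbreviation "D p \<equiv> differential A B \<iota> p"
abbreviation "cA p \<equiv> chart_at A p"
abbreviation "u0 p \<equiv> snd (chart_at A p) p"
abbreviation "cB p \<equiv> chart_at B (\<iota> p)"
abbreviation "gM \<equiv> pullback2 A B \<iota> g"
abbreviation "II \<equiv> second_fundamental_form A B g \<iota> n"

text \<open>\<open>F p\<close> is \<open>\<iota>\<close> and \<open>N p\<close> is \<open>n\<close> in the preferred charts at \<open>p\<close> and \<open>\<iota> p\<close>; \<open>W p x y\<close> is the ambient
  covariant derivative in direction \<open>x\<close> of the pushforward of the coordinate field \<open>y\<close>.\<close>

definition F :: "'m \<Rightarrow> real ^ 6 \<Rightarrow> real ^ 7" where "F p = snd (cB p) \<circ> \<iota> \<circ> chart_inv (cA p)"
definition F' :: "'m \<Rightarrow> real ^ 6 \<Rightarrow> real ^ 6 \<Rightarrow> real ^ 7" where "F' p u = frechet_derivative (F p) (at u)"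
definition F'' :: "'m \<Rightarrow> real ^ 6 \<Rightarrow> real ^ 6 \<Rightarrow> real ^ 7" where
  "F'' p x y = frechet_derivative (\<lambda>u. F' p u y) (at (u0 p)) x"
definition N :: "'m \<Rightarrow> real ^ 6 \<Rightarrow> real ^ 7" where
  "N p u = components B (cB p) (\<iota> (chart_inv (cA p) u)) (n (chart_inv (cA p) u))"
definition W :: "'m \<Rightarrow> real ^ 6 \<Rightarrow> real ^ 6 \<Rightarrow> real ^ 7" where
  "W p x y = F'' p x y + B.\<Gamma> (\<iota> p) (D p x) (D p y)"
definition S :: "'m \<Rightarrow> (real ^ 6) set" where "S p = snd (cA p) ` (fst (cA p) \<inter> \<iota> -` fst (cB p))"

lemma open_vimage_chart:
  assumes "d \<in> B" shows "open (\<iota> -` fst d)"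
proof -
  have "continuous_on UNIV \<iota>" using smooth by (simp add: smooth_map_def)
  with B.open_chart [OF assms] show ?thesis by (rule open_vimage)
qed

lemma open_S: "open (S p)" and u0_S: "u0 p \<in> S p"
  unfolding S_def using A.open_image [OF A.chart_at(1) open_vimage_chart [OF B.chart_at(1)]]
    A.chart_at(2) B.chart_at(2) by auto

lemma eventually_S: "(\<And>u. u \<in> S p \<Longrightarrow> P u) \<Longrightarrow> \<forall>\<^sub>F u in nhds (u0 p). P u"
  by (rule open_eventually_nhds [OF open_S u0_S])

lemma S_D: "u \<in> S p \<Longrightarrow> chart_inv (cA p) u \<in> fst (cA p)" "u \<in> S p \<Longrightarrow> \<iota> (chart_inv (cA p) u) \<in> fst (cB p)"
  "u \<in> S p \<Longrightarrow> snd (cA p) (chart_inv (cA p) u) = u" "u \<in> S p \<Longrightarrow> u \<in> snd (cA p) ` fst (cA p)"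
  by (auto simp: S_def A.chart_inv_snd A.chart_at)

lemma smooth_local:
  assumes "c \<in> A" "d \<in> B"
  shows "smooth_on (snd c ` (fst c \<inter> \<iota> -` fst d)) (snd d \<circ> \<iota> \<circ> chart_inv c)"
  using smooth assms by (auto simp: smooth_map_def)

lemma F_has_derivative: "u \<in> S p \<Longrightarrow> (F p has_derivative F' p u) (at u)"
  unfolding F_def F'_def S_def
  by (rule smooth_on_has_derivative [OF smooth_local [OF A.chart_at(1) B.chart_at(1)]])

lemma F'_has_derivative: "((\<lambda>u. F' p u y) has_derivative (\<lambda>x. F'' p x y)) (at (u0 p))"
  unfolding F_def F'_def F''_def
  by (rule smooth_on_has_second_derivative [OF smooth_local [OF A.chart_at(1) B.chart_at(1)]])
     (use u0_S in \<open>simp add: S_def\<close>)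

lemma F''_sym: "F'' p x y = F'' p y x"
  by (rule second_derivative_symmetric [OF open_S u0_S F_has_derivative F'_has_derivative])

text \<open>Symmetry of second derivatives together with vanishing torsion; the symmetry of the
  second fundamental form and the Gauss formula depend on it.\<close>

lemma W_sym: "W p x y = W p y x"
  by (simp add: W_def F''_sym [of p x y] B.christoffel_sym [of "\<iota> p" "D p x"])

lemma F_u0: "F p (u0 p) = B.pt (\<iota> p)"
  by (simp add: F_def A.chart_inv_snd A.chart_at)

lemma F'_u0: "F' p (u0 p) = D p"
  by (simp add: F'_def F_def differential_def o_assoc)

lemma linear_D: "linear (D p)"
  using F_has_derivative [OF u0_S] has_derivative_linear by (metis F'_u0)

lemmas D_simps [simp] = linear_add [OF linear_D] linear_diff [OF linear_D] linear_cmul [OF linear_D]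
  linear_neg [OF linear_D] linear_0 [OF linear_D]

lemma D_inject: "D p x = D p y \<longleftrightarrow> x = y"
  using immersion by (auto dest: injD)

text \<open>At the nearby point \<open>q\<close> the differential is written in the preferred charts
  of \<open>q\<close> and of its image. Two changes of chart turn it into the derivative of the one
  fixed local expression \<open>F p\<close>.\<close>

lemma push:
  assumes u: "u \<in> S p"
  defines "q \<equiv> chart_inv (cA p) u"
  shows "components B (cB p) (\<iota> q) (D q (coord_vector A (cA p) q x)) = F' p u x"
proof -
  have q: "q \<in> fst (cA p)" "\<iota> q \<in> fst (cB p)" "snd (cA p) q = u"
    using S_D u by (auto simp: q_def)
  have "(snd (cB q) \<circ> \<iota> \<circ> chart_inv (cA q)) differentiable at (u0 q)"
    using F_has_derivative [OF u0_S [of q]] differentiableI by (auto simp: F_def)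
  then have 1: "((snd (cB q) \<circ> \<iota> \<circ> chart_inv (cA p)) has_derivative D q \<circ> coord_vector A (cA p) q) (at u)"
    using A.frechet_derivative_change_chart [where f = "snd (cB q) \<circ> \<iota>", OF A.chart_at(1) q(1) A.chart_at]
    by (simp add: q(3) differential_def coord_vector_def)
  have "(snd (cB q) \<circ> \<iota> \<circ> chart_inv (cA p)) u = B.pt (\<iota> q)"
    by (simp add: q_def)
  then have "((snd (cB p) \<circ> chart_inv (cB q)) \<circ> (snd (cB q) \<circ> \<iota> \<circ> chart_inv (cA p)) has_derivative
      components B (cB p) (\<iota> q) \<circ> (D q \<circ> coord_vector A (cA p) q)) (at u)"
    using diff_chain_at [OF 1] B.transition_has_derivative [OF B.chart_at(1) B.chart_at(1) B.chart_at(2) q(2)]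
    unfolding components_def differential_fun_def by (simp only:)
  moreover have "\<forall>\<^sub>F v in nhds u. ((snd (cB p) \<circ> chart_inv (cB q)) \<circ> (snd (cB q) \<circ> \<iota> \<circ> chart_inv (cA p))) v = F p v"
  proof -
    have "\<forall>\<^sub>F v in nhds (snd (cA p) q). ((snd (cB p) \<circ> chart_inv (cB q)) \<circ> (snd (cB q) \<circ> \<iota> \<circ> chart_inv (cA p))) v = F p v"
      by (rule A.eventually_chart [OF A.chart_at(1) open_vimage_chart [OF B.chart_at(1) [of "\<iota> q"]] q(1)])
         (auto simp: F_def A.chart_inv_snd A.chart_at B.chart_inv_snd B.chart_at)
    then show ?thesis by (simp only: q(3))
  qed
  ultimately have "(F p has_derivative components B (cB p) (\<iota> q) \<circ> (D q \<circ> coord_vector A (cA p) q)) (at u)"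
    by (rule has_derivative_nhds_cong)
  from has_derivative_unique [OF F_has_derivative [OF u] this] show ?thesis by simp
qed

lemma coord_push:
  assumes u: "u \<in> S p"
  defines "q \<equiv> chart_inv (cA p) u"
  shows "coord_vector B (cB p) (\<iota> q) (F' p u x) = D q (coord_vector A (cA p) q x)"
    and "coord_vector B (cB p) (\<iota> q) (N p u) = n q"
    and "chart_inv (cB p) (F p u) = \<iota> q"
  using S_D(2) [OF u] push [OF u, of x, symmetric] B.coord_vector_components [OF B.chart_at(1)]
  by (simp_all add: q_def N_def F_def B.chart_inv_snd [OF B.chart_at(1)])

lemma local2_pullback:
  assumes "u \<in> S p"
  shows "local2 A (cA p) (pullback2 A B \<iota> T) u x y = local2 B (cB p) T (F p u) (F' p u x) (F' p u y)"
  by (simp add: local2_def Let_def pullback2_def coord_push [OF assms])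

lemma local3_pullback:
  assumes "u \<in> S p"
  shows "local3 A (cA p) (pullback3 A B \<iota> (\<lambda>q. T (\<iota> q))) u x y z
    = local3 B (cB p) T (F p u) (F' p u x) (F' p u y) (F' p u z)"
  by (simp add: local3_def Let_def pullback3_def coord_push [OF assms])

lemma inner_form_gM: "inner_form (gM p)"
proof -
  interpret inner_form "g (\<iota> p)" by (rule B.metric)
  show ?thesis
    unfolding inner_form_def pullback2_def
    using sym pos D_inject [of p _ 0] by (auto intro!: bilinearI)
qed

lemma gM_has_derivative:
  "((\<lambda>u. local2 A (cA p) gM u x y) has_derivative
    (\<lambda>h. g (\<iota> p) (W p h x) (D p y) + g (\<iota> p) (D p x) (W p h y))) (at (u0 p))"
proof (rule has_derivative_nhds_cong)
  show "((\<lambda>u. local2 B (cB p) g (F p u) (F' p u x) (F' p u y)) has_derivative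
    (\<lambda>h. g (\<iota> p) (W p h x) (D p y) + g (\<iota> p) (D p x) (W p h y))) (at (u0 p))"
    using B.covariant_product2 [OF F_has_derivative [OF u0_S] F_u0 F'_has_derivative [of p x] F'_has_derivative [of p y]]
    by (simp add: F'_u0 W_def)
qed (rule eventually_S, simp add: local2_pullback)

sublocale M: riemannian A gM
  by (intro riemannian.intro riemannian_axioms.intro A.atlas_axioms inner_form_gM differentiableI [OF gM_has_derivative])

lemma normal: "g (\<iota> p) (n p) (n p) = 1" "g (\<iota> p) (n p) (D p x) = 0" "g (\<iota> p) (D p x) (n p) = 0"
  using unit_normal inner_form.sym [OF B.metric] by (auto simp: unit_normal_field_def)

text \<open>Six coordinates are fed to the differential and the last one multiplies the normal: an
  injective endomorphism of seven-space, hence surjective.\<close>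

lemma tangent_normal_decomposition: obtains y t where "w = D p y + t *\<^sub>R n p"
proof -
  interpret inner_form "g (\<iota> p)" by (rule B.metric)
  define s :: "6 \<Rightarrow> 7" where "s i = (if i = 0 then 0 else if i = 1 then 1 else if i = 2 then 2 else if i = 3 then 3
    else if i = 4 then 4 else 5)" for i
  define L :: "real ^ 7 \<Rightarrow> real ^ 7" where "L v = D p (\<chi> i. v $ s i) + v $ 6 *\<^sub>R n p" for v
  have "linear L"
  proof (rule linearI)
    fix x y :: "real ^ 7" and r :: real
    have "(\<chi> i. (x + y) $ s i) = (\<chi> i. x $ s i) + (\<chi> i. y $ s i)" "(\<chi> i. (r *\<^sub>R x) $ s i) = r *\<^sub>R (\<chi> i. x $ s i)"
      by (simp_all add: vec_eq_iff)
    then show "L (x + y) = L x + L y" "L (r *\<^sub>R x) = r *\<^sub>R L x"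
      by (simp_all add: L_def algebra_simps)
  qed
  moreover have "inj L"
    unfolding linear_injective_0 [OF \<open>linear L\<close>]
  proof (intro allI impI)
    fix v assume v: "L v = 0"
    then have "g (\<iota> p) (L v) (n p) = 0" by simp
    then have 6: "v $ 6 = 0" by (simp add: L_def normal)
    with v have "(\<chi> i. v $ s i) = 0" using D_inject [of p _ 0] by (simp add: L_def)
    then have "\<forall>i. v $ s i = 0" by (simp add: vec_eq_iff)
    then show "v = 0" using 6 by (simp add: vec_eq_iff forall_6 forall_7 s_def)
  qed
  ultimately have "surj L" by (rule linear_inj_imp_surj)
  then obtain v where "w = L v" by blast
  then show thesis using that by (simp add: L_def)
qed

lemma ambient_eqI:
  assumes "\<And>z. g (\<iota> p) v (D p z) = g (\<iota> p) w (D p z)" "g (\<iota> p) v (n p) = g (\<iota> p) w (n p)"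
  shows "v = w"
proof (rule inner_form.eqI [OF B.metric])
  interpret inner_form "g (\<iota> p)" by (rule B.metric)
  fix z
  obtain y t where "z = D p y + t *\<^sub>R n p" by (rule tangent_normal_decomposition)
  then show "g (\<iota> p) v z = g (\<iota> p) w z" by (simp add: assms)
qed

lemma second_fundamental_form: "II p x y = g (\<iota> p) (W p x y) (n p)"
proof -
  have "frechet_derivative ((\<lambda>q. components B (cB p) (\<iota> q) (D q (coord_vector A (cA p) q y))) \<circ> chart_inv (cA p)) (at (u0 p))
      = frechet_derivative (\<lambda>u. F' p u y) (at (u0 p))"
    by (rule frechet_derivative_nhds_cong, rule eventually_S) (simp add: push)
  then show ?thesis
    by (simp add: second_fundamental_form_def nabla_along_def Let_def differential_fun_def F''_def W_def A.coord_vector_chart_at)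
qed

lemma II_sym: "II p x y = II p y x"
  by (simp add: second_fundamental_form W_sym)

text \<open>\<open>W\<close> is symmetric and compatible with the induced metric, so its tangential
  part satisfies the Koszul identity of that metric.\<close>

lemma gauss: "W p x y = D p (M.\<Gamma> p x y) + II p x y *\<^sub>R n p"
proof (rule ambient_eqI)
  interpret g: inner_form "g (\<iota> p)" by (rule B.metric)
  have dgM: "M.dg p x y z = g (\<iota> p) (W p x y) (D p z) + g (\<iota> p) (D p y) (W p x z)" for x y z
    using fun_cong [OF frechet_derivative_at [OF gM_has_derivative [of p y z]], of x] by simp
  fix z
  show "g (\<iota> p) (W p x y) (D p z) = g (\<iota> p) (D p (M.\<Gamma> p x y) + II p x y *\<^sub>R n p) (D p z)"
    using M.christoffel [of p x y z] unfolding dgM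
    by (simp add: normal pullback2_def W_sym [of p z] W_sym [of p y x] g.sym [of "D p _" "W p _ _"])
qed (simp add: second_fundamental_form inner_form.g_simps [OF B.metric] normal)

definition Dn :: "'m \<Rightarrow> real ^ 6 \<Rightarrow> real ^ 7" where
  "Dn p x = frechet_derivative (N p) (at (u0 p)) x + B.\<Gamma> (\<iota> p) (D p x) (n p)"

lemma N_has_derivative: "(N p has_derivative frechet_derivative (N p) (at (u0 p))) (at (u0 p))"
  unfolding N_def
  by (rule smooth_on_has_derivative [where S = "S p"])
     (use unit_normal u0_S A.chart_at(1) B.chart_at(1) in \<open>auto simp: unit_normal_field_def smooth_along_def S_def\<close>)

lemma N_u0: "N p (u0 p) = n p"
  by (simp add: N_def A.chart_inv_snd A.chart_at B.components_chart_at)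

text \<open>Both equations come from differentiating a constant: the normal has length one and is
  orthogonal to pushed forward coordinate fields.\<close>

lemma weingarten: "g (\<iota> p) (Dn p x) (n p) = 0" "g (\<iota> p) (Dn p x) (D p y) = - II p x y"
proof -
  interpret g: inner_form "g (\<iota> p)" by (rule B.metric)
  note D = B.covariant_product2 [OF F_has_derivative [OF u0_S, of p] F_u0 N_has_derivative [of p]]
  have "((\<lambda>u. local2 B (cB p) g (F p u) (N p u) (N p u)) has_derivative
      (\<lambda>h. g (\<iota> p) (Dn p h) (n p) + g (\<iota> p) (n p) (Dn p h))) (at (u0 p))"
    using D [OF N_has_derivative [of p]] by (simp add: N_u0 F'_u0 Dn_def)
  moreover have "\<forall>\<^sub>F u in nhds (u0 p). local2 B (cB p) g (F p u) (N p u) (N p u) = 1"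
    by (rule eventually_S) (simp add: local2_def Let_def coord_push normal)
  ultimately have "((\<lambda>u. 1) has_derivative (\<lambda>h. g (\<iota> p) (Dn p h) (n p) + g (\<iota> p) (n p) (Dn p h))) (at (u0 p))"
    by (rule has_derivative_nhds_cong)
  from fun_cong [OF has_derivative_unique [OF this has_derivative_const], of x]
  show "g (\<iota> p) (Dn p x) (n p) = 0" by (simp add: g.sym [of "n p"])
  have "((\<lambda>u. local2 B (cB p) g (F p u) (N p u) (F' p u y)) has_derivative
      (\<lambda>h. g (\<iota> p) (Dn p h) (D p y) + g (\<iota> p) (n p) (W p h y))) (at (u0 p))"
    using D [OF F'_has_derivative [of p y]] by (simp add: N_u0 F'_u0 Dn_def W_def)
  moreover have "\<forall>\<^sub>F u in nhds (u0 p). local2 B (cB p) g (F p u) (N p u) (F' p u y) = 0"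
    by (rule eventually_S) (simp add: local2_def Let_def coord_push normal)
  ultimately have "((\<lambda>u. 0) has_derivative (\<lambda>h. g (\<iota> p) (Dn p h) (D p y) + g (\<iota> p) (n p) (W p h y))) (at (u0 p))"
    by (rule has_derivative_nhds_cong)
  from fun_cong [OF has_derivative_unique [OF this has_derivative_const], of x]
  show "g (\<iota> p) (Dn p x) (D p y) = - II p x y"
    by (simp add: second_fundamental_form g.sym [of "n p"] eq_neg_iff_add_eq_0)
qed

text \<open>By \<open>gauss\<close> the tangential parts of \<open>W\<close> cancel against the
  Christoffel terms of the hypersurface; the normal parts leave the terms with
  \<open>II\<close>.\<close>

lemma pullback3_regular:
  assumes T: "B.regular3 T (\<iota> p)" and tri: "\<And>q. trilinear (T q)"
  shows "M.regular3 (pullback3 A B \<iota> (\<lambda>q. T (\<iota> q))) p"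
    and "nabla3 A gM (pullback3 A B \<iota> (\<lambda>q. T (\<iota> q))) p x y z w =
      nabla3 B g T (\<iota> p) (D p x) (D p y) (D p z) (D p w)
      + II p x y * T (\<iota> p) (n p) (D p z) (D p w) + II p x z * T (\<iota> p) (D p y) (n p) (D p w)
      + II p x w * T (\<iota> p) (D p y) (D p z) (n p)"
    (is ?nabla)
proof -
  let ?D = "\<lambda>y z w x. nabla3 B g T (\<iota> p) (D p x) (D p y) (D p z) (D p w)
      + T (\<iota> p) (W p x y) (D p z) (D p w) + T (\<iota> p) (D p y) (W p x z) (D p w)
      + T (\<iota> p) (D p y) (D p z) (W p x w)"
  have D: "((\<lambda>u. local3 A (cA p) (pullback3 A B \<iota> (\<lambda>q. T (\<iota> q))) u y z w) has_derivative ?D y z w) (at (u0 p))" for y z w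
  proof (rule has_derivative_nhds_cong)
    show "((\<lambda>u. local3 B (cB p) T (F p u) (F' p u y) (F' p u z) (F' p u w)) has_derivative ?D y z w) (at (u0 p))"
      using B.covariant_product3 [OF T F_has_derivative [OF u0_S] F_u0 F'_has_derivative [of p y]
          F'_has_derivative [of p z] F'_has_derivative [of p w]] by (simp add: F'_u0 W_def)
  qed (rule eventually_S, simp add: local3_pullback)
  show "M.regular3 (pullback3 A B \<iota> (\<lambda>q. T (\<iota> q))) p"
    unfolding M.regular3_def
  proof (intro conjI allI)
    show "trilinear (pullback3 A B \<iota> (\<lambda>q. T (\<iota> q)) q)" for q
      using linear_compose [OF linear_D trilinearD(1) [OF tri]] linear_compose [OF linear_D trilinearD(2) [OF tri]]
        linear_compose [OF linear_D trilinearD(3) [OF tri]]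
      by (simp add: trilinear_def pullback3_def [abs_def] o_def)
  qed (use D differentiableI in blast)
  show ?nabla
    using fun_cong [OF frechet_derivative_at [OF D [of y z w]], of x]
    by (simp add: nabla3_def [of A] Let_def pullback3_def [of _ _ _ _ p] gauss trilinear_simps [OF tri])
qed

text \<open>As for pullbacks, but one slot is already filled with \<open>n\<close>: the normal parts
  of \<open>W\<close> fill a second one with \<open>n\<close> and vanish, while the derivative of
  \<open>n\<close> contributes a term.\<close>

lemma nabla2_kaehler:
  assumes T: "B.regular3 T (\<iota> p)" and tri: "\<And>q. trilinear (T q)" and skew: "\<And>q x y. T q x x y = 0"
    and J: "\<And>q y z. gM q y (J q z) = T (\<iota> q) (n q) (D q z) (D q y)"
  shows "(\<lambda>u. local2 A (cA p) (\<lambda>q. kaehler_form (gM q) (J q)) u y z) differentiable at (u0 p)"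
    and "T (\<iota> p) (n p) (D p z) (n p) = 0 \<Longrightarrow>
      nabla2 A gM (\<lambda>q. kaehler_form (gM q) (J q)) p x y z =
      nabla3 B g T (\<iota> p) (D p x) (n p) (D p z) (D p y) + T (\<iota> p) (Dn p x) (D p z) (D p y)"
proof -
  let ?D = "\<lambda>x. nabla3 B g T (\<iota> p) (D p x) (n p) (D p z) (D p y)
      + T (\<iota> p) (Dn p x) (D p z) (D p y) + T (\<iota> p) (n p) (W p x z) (D p y)
      + T (\<iota> p) (n p) (D p z) (W p x y)"
  have D: "((\<lambda>u. local2 A (cA p) (\<lambda>q. kaehler_form (gM q) (J q)) u y z) has_derivative ?D) (at (u0 p))"
  proof (rule has_derivative_nhds_cong)
    show "((\<lambda>u. local3 B (cB p) T (F p u) (N p u) (F' p u z) (F' p u y)) has_derivative ?D) (at (u0 p))"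
      using B.covariant_product3 [OF T F_has_derivative [OF u0_S] F_u0 N_has_derivative
          F'_has_derivative [of p z] F'_has_derivative [of p y]] by (simp add: F'_u0 N_u0 W_def Dn_def)
  qed (rule eventually_S, simp add: local2_def local3_def Let_def kaehler_form_def J coord_push)
  then show "(\<lambda>u. local2 A (cA p) (\<lambda>q. kaehler_form (gM q) (J q)) u y z) differentiable at (u0 p)"
    by (rule differentiableI)
  assume "T (\<iota> p) (n p) (D p z) (n p) = 0"
  then show "nabla2 A gM (\<lambda>q. kaehler_form (gM q) (J q)) p x y z =
      nabla3 B g T (\<iota> p) (D p x) (n p) (D p z) (D p y) + T (\<iota> p) (Dn p x) (D p z) (D p y)"
    using fun_cong [OF frechet_derivative_at [OF D], of x]
    by (simp add: nabla2_def [of A] Let_def kaehler_form_def J gauss trilinear_simps [OF tri] skew)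
qed

end

section \<open>The covariant derivative of a \<open>G\<^sub>2\<close>-structure\<close>

lemma wedge3_has_derivative:
  assumes "\<And>x. ((\<lambda>u. a u x) has_derivative (\<lambda>h. a' h x)) (at u0)"
    and "\<And>x. ((\<lambda>u. b u x) has_derivative (\<lambda>h. b' h x)) (at u0)"
    and "\<And>x. ((\<lambda>u. c u x) has_derivative (\<lambda>h. c' h x)) (at u0)"
  shows "((\<lambda>u. wedge3 (a u) (b u) (c u) x y z) has_derivative
    (\<lambda>h. wedge3 (a' h) (b u0) (c u0) x y z + wedge3 (a u0) (b' h) (c u0) x y z + wedge3 (a u0) (b u0) (c' h) x y z)) (at u0)"
  unfolding wedge3_def wedge2_def
  by (rule has_derivative_eq_rhs)
     (rule has_derivative_add has_derivative_diff has_derivative_mult assms | rule ext, simp add: algebra_simps)+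

lemma wedge3_derivation:
  "wedge3 a b c (A x) y z + wedge3 a b c x (A y) z + wedge3 a b c x y (A z)
    = wedge3 (\<lambda>x. a (A x)) b c x y z + wedge3 a (\<lambda>x. b (A x)) c x y z + wedge3 a b (\<lambda>x. c (A x)) x y z"
  by (simp add: wedge3_def wedge2_def algebra_simps)

lemma wedge3_add:
  "wedge3 (\<lambda>x. a x + a' x) b c x y z = wedge3 a b c x y z + wedge3 a' b c x y z"
  "wedge3 a (\<lambda>x. b x + b' x) c x y z = wedge3 a b c x y z + wedge3 a b' c x y z"
  "wedge3 a b (\<lambda>x. c x + c' x) x y z = wedge3 a b c x y z + wedge3 a b c' x y z"
  by (simp_all add: wedge3_def wedge2_def algebra_simps)

locale g2_manifold = riemannian B g for B :: "('b::topological_space, 7) chart set" and g +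
  fixes \<phi> :: "'b \<Rightarrow> (real ^ 7) form3"
  assumes g2: "g2_structure B g \<phi>"
begin

lemma trilinear_phi: "trilinear (\<phi> q)"
  using g2 by (simp add: g2_structure_def three_form_def)

lemma regular_phi: "regular3 \<phi> q"
proof -
  have "smooth_on (snd (ch q) ` fst (ch q)) (\<lambda>u. local3 B (ch q) \<phi> u x y z)" for x y z
    using g2 chart_at(1) by (simp add: g2_structure_def three_form_def)
  from smooth_on_has_derivative [OF this] show ?thesis
    using trilinear_phi chart_at(2) differentiableI unfolding regular3_def by blast
qed

lemma frame_exists: "\<exists>e. g2_frame (g q) e (\<phi> q)"
proof -
  obtain e where "orthonormal (g q) e" "\<phi> q = g2_form (g q) e"
    using g2 unfolding g2_structure_def by blast
  then have "g2_frame (g q) e (\<phi> q)"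
    using metric by (simp add: g2_frame_def g2_frame_axioms_def frame_def frame_axioms_def)
  then show ?thesis by blast
qed

text \<open>In a local adapted frame \<phi> has constant coefficients, so its covariant derivative
  comes only from that of the frame. The connection matrix of an orthonormal frame is skew, and
  \<open>derivation_dual\<close> applies.\<close>

lemma nabla3_phi: "\<exists>R. \<forall>x y z. nabla3 B g \<phi> q X x y z = star_phi (g q) (\<phi> q) R x y z"
proof -
  obtain U e where U: "open U" "q \<in> U" and sm: "\<And>i. smooth_vector_field_on B U (\<lambda>q. e q i)"
    and e: "\<And>r. r \<in> U \<Longrightarrow> orthonormal (g r) (e r)" "\<And>r. r \<in> U \<Longrightarrow> \<phi> r = g2_form (g r) (e r)"
    using g2 unfolding g2_structure_def by metis
  interpret inner_form "g q" by (rule metric)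
  interpret q: g2_frame "g q" "e q" "\<phi> q" by unfold_locales (use e U in auto)
  define E where "E i u = components B (ch q) (chart_inv (ch q) u) (e (chart_inv (ch q) u) i)" for i u
  define E' where "E' i = frechet_derivative (E i) (at (pt q))" for i
  have E': "(E i has_derivative E' i) (at (pt q))" for i
    unfolding E'_def E_def
    by (rule smooth_on_has_derivative [where S = "snd (ch q) ` (fst (ch q) \<inter> U)"])
       (use sm [of i] chart_at U(2) in \<open>auto simp: smooth_vector_field_on_def\<close>)
  have Eq: "E i (pt q) = e q i" for i
    by (simp add: E_def chart_inv_snd chart_at components_chart_at)
  have ev: "\<forall>\<^sub>F u in nhds (pt q). P u"
    if "\<And>r. r \<in> fst (ch q) \<Longrightarrow> r \<in> U \<Longrightarrow> P (snd (ch q) r)" for P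
    by (rule eventually_chart [where W = U and q = q]) (use U chart_at that in auto)
  have coord_E: "coord_vector B (ch q) r (E i (snd (ch q) r)) = e r i" if "r \<in> fst (ch q)" for r i
    using that by (simp add: E_def chart_inv_snd chart_at coord_vector_components)
  \<comment> \<open>\<epsilon> is the covariant derivative of the frame in direction
    \<open>X\<close>, and \<open>a\<close> is its connection matrix.\<close>
  define \<epsilon> where "\<epsilon> i = E' i X + \<Gamma> q X (e q i)" for i
  define a where "a i j = g q (\<epsilon> i) (e q j)" for i j
  have skew: "a i j = - a j i" for i j
  proof -
    have "((\<lambda>u. local2 B (ch q) g u (E i u) (E j u)) has_derivative
        (\<lambda>h. g q (E' i h + \<Gamma> q h (e q i)) (e q j) + g q (e q i) (E' j h + \<Gamma> q h (e q j)))) (at (pt q))"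
      using covariant_product2 [OF has_derivative_ident refl E' [of i] E' [of j]] by (simp only: Eq)
    moreover have "\<forall>\<^sub>F u in nhds (pt q). local2 B (ch q) g u (E i u) (E j u) = (if i = j then 1 else 0)"
      by (rule ev) (simp add: local2_def Let_def chart_inv_snd chart_at coord_E e(1) [unfolded orthonormal_def])
    ultimately have "((\<lambda>u. if i = j then 1 else 0) has_derivative
        (\<lambda>h. g q (E' i h + \<Gamma> q h (e q i)) (e q j) + g q (e q i) (E' j h + \<Gamma> q h (e q j)))) (at (pt q))"
      by (rule has_derivative_nhds_cong)
    from fun_cong [OF has_derivative_unique [OF this has_derivative_const], of X]
    show ?thesis by (simp add: a_def \<epsilon>_def sym [of "e q i"] algebra_simps)
  qed
  define \<beta> where "\<beta> i u x = local2 B (ch q) g u (E i u) x" for i u x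
  have \<beta>q: "\<beta> i (pt q) = g q (e q i)" for i
    by (intro ext) (simp add: \<beta>_def Eq local2_chart_at)
  have \<beta>: "((\<lambda>u. \<beta> i u x) has_derivative (\<lambda>h. g q (E' i h + \<Gamma> q h (e q i)) x + g q (e q i) (0 + \<Gamma> q h x))) (at (pt q))" for i x
    unfolding \<beta>_def
    using covariant_product2 [OF has_derivative_ident refl E' [of i] has_derivative_const] by (simp only: Eq)
  let ?\<beta>' = "\<lambda>i h x. g q (E' i h + \<Gamma> q h (e q i)) x + g q (e q i) (0 + \<Gamma> q h x)"
  define \<alpha> where "\<alpha> i x = g q (\<epsilon> i) x" for i x
  \<comment> \<open>The derivative of each coframe component splits into the covariant part \<alpha>
    and the Christoffel part \<gamma>; the latter cancels against the correction terms in
    \<open>nabla3\<close>.\<close>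
  define \<gamma> where "\<gamma> i x = g q (e q i) (\<Gamma> q X x)" for i x
  have \<beta>': "?\<beta>' i X = (\<lambda>x. \<alpha> i x + \<gamma> i x)" for i
    by (intro ext) (simp add: \<alpha>_def \<epsilon>_def \<gamma>_def)
  have D: "((\<lambda>u. \<Sum>i\<in>UNIV. wedge3 (\<beta> i u) (\<beta> (i + 1) u) (\<beta> (i + 3) u) x y z) has_derivative
      (\<lambda>h. \<Sum>i\<in>UNIV. wedge3 (?\<beta>' i h) (g q (e q (i + 1))) (g q (e q (i + 3))) x y z
        + wedge3 (g q (e q i)) (?\<beta>' (i + 1) h) (g q (e q (i + 3))) x y z
        + wedge3 (g q (e q i)) (g q (e q (i + 1))) (?\<beta>' (i + 3) h) x y z)) (at (pt q))" for x y z
    by (rule has_derivative_sum, rule wedge3_has_derivative [OF \<beta> \<beta> \<beta>, unfolded \<beta>q])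
  have eq: "\<forall>\<^sub>F u in nhds (pt q). (\<Sum>i\<in>UNIV. wedge3 (\<beta> i u) (\<beta> (i + 1) u) (\<beta> (i + 3) u) x y z) = local3 B (ch q) \<phi> u x y z" for x y z
    by (rule ev) (simp add: \<beta>_def local2_def local3_def Let_def chart_inv_snd chart_at coord_E e(2) g2_form_def
        wedge3_def wedge2_def)
  have D': "frechet_derivative (\<lambda>u. local3 B (ch q) \<phi> u x y z) (at (pt q)) X =
      (\<Sum>i\<in>UNIV. wedge3 (?\<beta>' i X) (g q (e q (i + 1))) (g q (e q (i + 3))) x y z
        + wedge3 (g q (e q i)) (?\<beta>' (i + 1) X) (g q (e q (i + 3))) x y z
        + wedge3 (g q (e q i)) (g q (e q (i + 1))) (?\<beta>' (i + 3) X) x y z)" for x y z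
    by (rule fun_cong [OF frechet_derivative_at [OF has_derivative_nhds_cong [OF D eq]], symmetric])
  have "nabla3 B g \<phi> q X x y z = (\<Sum>i\<in>UNIV. wedge3 (\<alpha> i) (g q (e q (i + 1))) (g q (e q (i + 3))) x y z
        + wedge3 (g q (e q i)) (\<alpha> (i + 1)) (g q (e q (i + 3))) x y z
        + wedge3 (g q (e q i)) (g q (e q (i + 1))) (\<alpha> (i + 3)) x y z)" for x y z
  proof -
    have "\<phi> q (\<Gamma> q X x) y z + \<phi> q x (\<Gamma> q X y) z + \<phi> q x y (\<Gamma> q X z) =
      (\<Sum>i\<in>UNIV. wedge3 (\<gamma> i) (g q (e q (i + 1))) (g q (e q (i + 3))) x y z
        + wedge3 (g q (e q i)) (\<gamma> (i + 1)) (g q (e q (i + 3))) x y z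
        + wedge3 (g q (e q i)) (g q (e q (i + 1))) (\<gamma> (i + 3)) x y z)"
      unfolding q.phi g2_form_def \<gamma>_def wedge3_derivation [of _ _ _ "\<Gamma> q X", symmetric]
      by (simp add: sum.distrib)
    then show ?thesis
      unfolding nabla3_def Let_def D' \<beta>' wedge3_add sum.distrib by simp
  qed
  moreover have "\<alpha> i x = (\<Sum>j\<in>UNIV. a i j * g q (e q j) x)" for i x
    unfolding \<alpha>_def a_def by (subst q.parseval) (simp add: sym [of "e q _" "\<epsilon> i"])
  ultimately show ?thesis
    using q.derivation_dual [of a \<alpha>, OF skew] by (simp add: q.star_phi)
qed

text \<open>Taking the inner product with contractions of the dual form identifies \<open>R\<close>:
  the factor 4 of \<open>inner3_dual\<close> meets the 1/4 of \<open>rbar\<close>.\<close>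

lemma nabla3_phi_rbar:
  "\<exists>R. (\<forall>x y z. nabla3 B g \<phi> q X x y z = star_phi (g q) (\<phi> q) R x y z) \<and> (\<forall>y. g q R y = rbar B g \<phi> q X y)"
proof -
  obtain R where R: "\<And>x y z. nabla3 B g \<phi> q X x y z = star_phi (g q) (\<phi> q) R x y z"
    using nabla3_phi by blast
  obtain e where "g2_frame (g q) e (\<phi> q)" using frame_exists by blast
  then interpret g2_frame "g q" e "\<phi> q" .
  have "nabla3 B g \<phi> q X = g2_dual_form (g q) e R" using R by (intro ext) (simp add: star_phi)
  then have "g q R y = rbar B g \<phi> q X y" for y
    by (simp add: rbar_def star_phi inner3_dual)
  with R show ?thesis by blast
qed

end

section \<open>The induced SU(3)-structure in an adapted frame\<close>

locale g2_hypersurface = hypersurface A B g \<iota> n + g2_manifold B g \<phi>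
  for A :: "('m::topological_space, 6) chart set" and B :: "('b::topological_space, 7) chart set"
    and g \<iota> n \<phi>
begin

abbreviation "st p \<equiv> star_phi (g (\<iota> p)) (\<phi> (\<iota> p))"
abbreviation "J \<equiv> induced_I A B g \<phi> \<iota> n"
abbreviation "\<Phi> \<equiv> pullback3 A B \<iota> (\<lambda>q. \<phi> (\<iota> q))"

lemma tangent: "g (\<iota> p) w (n p) = 0 \<Longrightarrow> \<exists>y. D p y = w"
proof -
  interpret inner_form "g (\<iota> p)" by (rule B.metric)
  assume w: "g (\<iota> p) w (n p) = 0"
  obtain y t where "w = D p y + t *\<^sub>R n p" by (rule tangent_normal_decomposition)
  with w show ?thesis by (auto simp: normal)
qed

text \<open>The cross product with \<open>n\<close> is orthogonal to \<open>n\<close>, hence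
  tangent; this gives the definite description of \<open>J\<close> a value.\<close>

lemma D_J: "D p (J p x) = cross_product (g (\<iota> p)) (\<phi> (\<iota> p)) (n p) (D p x)"
proof -
  obtain e where "g2_frame (g (\<iota> p)) e (\<phi> (\<iota> p))" using frame_exists by blast
  then interpret q: g2_frame "g (\<iota> p)" e "\<phi> (\<iota> p)" .
  have "g (\<iota> p) (q.P (n p) (D p x)) (n p) = 0" by (simp add: q.P)
  then obtain w where w: "D p w = q.P (n p) (D p x)" using tangent by blast
  have "J p x = w"
    unfolding induced_I_def w [symmetric] by (rule the_equality) (simp_all add: D_inject)
  then show ?thesis by (simp only: w)
qed

lemma gM_J: "gM p y (J p z) = \<phi> (\<iota> p) (n p) (D p z) (D p y)"
proof -
  obtain e where "g2_frame (g (\<iota> p)) e (\<phi> (\<iota> p))" using frame_exists by blast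
  then interpret q: g2_frame "g (\<iota> p)" e "\<phi> (\<iota> p)" .
  show ?thesis by (simp add: pullback2_def D_J q.sym [of "D p y"] q.P)
qed

text \<open>In a frame starting with \<open>n\<close>, the terms of \<phi> without \<open>n\<close>
  are the real part of a complex volume form. The contraction of the dual form with \<open>n\<close>
  is the imaginary part, and its tangential part is minus half the square of the Kaehler
  form.\<close>

lemma adapted_su3_frame:
  "\<exists>f E. g2_frame (g (\<iota> p)) f (\<phi> (\<iota> p)) \<and> su3_frame (gM p) E (J p) (\<Phi> p) \<and>
    (\<forall>x y z. st p (n p) (D p x) (D p y) (D p z) = - \<Phi> p (J p x) y z) \<and>
    (\<forall>a y z w. st p (D p a) (D p y) (D p z) (D p w) = - (gM p (J p a) y * gM p (J p z) w
      - gM p (J p a) z * gM p (J p y) w + gM p (J p a) w * gM p (J p y) z)) \<and>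
    (\<forall>b :: (real ^ 7) form2. (\<Sum>i\<in>UNIV. b (f i) (f i)) = b (n p) (n p) + (\<Sum>i\<in>UNIV. b (D p (E i)) (D p (E i))))"
proof -
  obtain e where "g2_frame (g (\<iota> p)) e (\<phi> (\<iota> p))" using frame_exists by blast
  then interpret e: g2_frame "g (\<iota> p)" e "\<phi> (\<iota> p)" .
  obtain f where f: "g2_frame (g (\<iota> p)) f (\<phi> (\<iota> p))" "f 0 = n p"
    using e.adapted_frame [OF normal(1)] by blast
  from f(1) interpret f: g2_frame "g (\<iota> p)" f "\<phi> (\<iota> p)" .
  \<comment> \<open>The pairs (1, 3), (2, 6), (4, 5) complete 0 to the lines of \<phi> through it,
    so the cross product with \<open>n\<close> maps the first member of each pair to the
    second.\<close>
  define s :: "6 \<Rightarrow> 7" where "s i = (if i = 0 then 1 else if i = 1 then 3 else if i = 2 then 2 else if i = 3 then 6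
    else if i = 4 then 4 else 5)" for i
  have s: "s 0 = 1" "s 1 = 3" "s 2 = 2" "s 3 = 6" "s 4 = 4" "s 5 = 5" by (simp_all add: s_def)
  have s0: "s i \<noteq> 0" for i by (simp add: s_def)
  have "\<exists>y. D p y = f (s i)" for i
    by (rule tangent) (simp add: f(2) [symmetric] f.on s0)
  then obtain E where E: "\<And>i. D p (E i) = f (s i)" by metis
  have inj: "s i = s j \<longleftrightarrow> i = j" for i j
    using exhaust_6 [of i] exhaust_6 [of j] by (auto simp: s)
  interpret inner_form "gM p" by (rule inner_form_gM)
  interpret E: frame "gM p" E
    by unfold_locales (simp add: orthonormal_def pullback2_def E f.on inj)
  have coord: "g (\<iota> p) (f 0) (D p x) = 0" "g (\<iota> p) (f 1) (D p x) = gM p (E 0) x"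
    "g (\<iota> p) (f 3) (D p x) = gM p (E 1) x" "g (\<iota> p) (f 2) (D p x) = gM p (E 2) x"
    "g (\<iota> p) (f 6) (D p x) = gM p (E 3) x" "g (\<iota> p) (f 4) (D p x) = gM p (E 4) x"
    "g (\<iota> p) (f 5) (D p x) = gM p (E 5) x" for x
    by (simp_all add: f(2) normal pullback2_def E s)
  have on0: "g (\<iota> p) (f 0) (f 0) = 1" "g (\<iota> p) (f 1) (f 0) = 0" "g (\<iota> p) (f 2) (f 0) = 0" "g (\<iota> p) (f 3) (f 0) = 0"
    "g (\<iota> p) (f 4) (f 0) = 0" "g (\<iota> p) (f 5) (f 0) = 0" "g (\<iota> p) (f 6) (f 0) = 0"
    by (simp_all add: f.on)
  have Jc: "gM p (E 0) (J p x) = - gM p (E 1) x" "gM p (E 1) (J p x) = gM p (E 0) x"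
    "gM p (E 2) (J p x) = - gM p (E 3) x" "gM p (E 3) (J p x) = gM p (E 2) x"
    "gM p (E 4) (J p x) = - gM p (E 5) x" "gM p (E 5) (J p x) = gM p (E 4) x" for x
    unfolding coord [symmetric] D_J f.P_coord cross7_def wedge2_def f(2) [symmetric]
    by (simp_all add: numeral_7 on0 coord)
  have J: "J p x = - gM p (E 1) x *\<^sub>R E 0 + gM p (E 0) x *\<^sub>R E 1 - gM p (E 3) x *\<^sub>R E 2
      + gM p (E 2) x *\<^sub>R E 3 - gM p (E 5) x *\<^sub>R E 4 + gM p (E 4) x *\<^sub>R E 5" for x
    using E.expand [of "J p x"] by (simp add: sum_6 Jc)
  have Phi: "\<Phi> p x y z = re_volume (gM p) E x y z" for x y z
    unfolding pullback3_def f.phi g2_form_def re_volume_def sum_7 wedge3_def wedge2_def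
    by (simp add: numeral_7 coord) algebra
  interpret E: su3_frame "gM p" E "J p" "\<Phi> p"
    by unfold_locales (simp_all add: J Phi [THEN ext, THEN ext, THEN ext] fun_eq_iff)
  have st1: "st p (n p) (D p x) (D p y) (D p z) = - \<Phi> p (J p x) y z" for x y z
    unfolding f.star_phi Phi g2_dual_form_def re_volume_def sum_7 wedge4_def wedge3_def wedge2_def f(2) [symmetric]
    by (simp add: numeral_7 coord on0 Jc) algebra
  have st2: "st p (D p a) (D p y) (D p z) (D p w) = - (gM p (J p a) y * gM p (J p z) w
      - gM p (J p a) z * gM p (J p y) w + gM p (J p a) w * gM p (J p y) z)" for a y z w
    unfolding f.star_phi E.parseval [of "J p _"] g2_dual_form_def sum_7 sum_6 wedge4_def wedge3_def wedge2_def
    by (simp add: numeral_7 coord Jc) algebra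
  have "(\<Sum>i\<in>UNIV. b (f i) (f i)) = b (n p) (n p) + (\<Sum>i\<in>UNIV. b (D p (E i)) (D p (E i)))" for b :: "(real ^ 7) form2"
    by (simp add: sum_7 sum_6 E s f(2))
  then show ?thesis using f(1) E.su3_frame_axioms st1 st2 by blast
qed

end

section \<open>Rotation by the angle and the conditions at one point\<close>

context su3_frame begin

text \<open>The new frame multiplies the first complex coordinate by a + i b, hence the complex
  volume form by the same unit number.\<close>

lemma rotate:
  fixes a b :: real
  assumes ab: "a\<^sup>2 + b\<^sup>2 = 1"
  shows "su3_frame g (e(0 := a *\<^sub>R e 0 - b *\<^sub>R e 1, 1 := b *\<^sub>R e 0 + a *\<^sub>R e 1)) J
    (\<lambda>x y z. a * \<psi> x y z + b * \<psi> (J x) y z)"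
proof -
  let ?e = "e(0 := a *\<^sub>R e 0 - b *\<^sub>R e 1, 1 := b *\<^sub>R e 0 + a *\<^sub>R e 1)"
  have e: "?e 0 = a *\<^sub>R e 0 - b *\<^sub>R e 1" "?e 1 = b *\<^sub>R e 0 + a *\<^sub>R e 1" "?e 2 = e 2" "?e 3 = e 3"
    "?e 4 = e 4" "?e 5 = e 5" by simp_all
  have ab': "a * a + b * b = 1" "b * b + a * a = 1" using ab by (simp_all add: power2_eq_square)
  have on': "orthonormal g ?e"
    unfolding orthonormal_def forall_6 e by (simp add: on ab' algebra_simps)
  have J': "J x = - g (?e 1) x *\<^sub>R ?e 0 + g (?e 0) x *\<^sub>R ?e 1 - g (?e 3) x *\<^sub>R ?e 2
      + g (?e 2) x *\<^sub>R ?e 3 - g (?e 5) x *\<^sub>R ?e 4 + g (?e 4) x *\<^sub>R ?e 5" for x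
  proof (rule coord_eqI)
    have "g (e 1) x = (a * a + b * b) * g (e 1) x" "g (e 0) x = (a * a + b * b) * g (e 0) x"
      by (simp_all add: ab')
    then show "g (e 0) (J x) = g (e 0) (- g (?e 1) x *\<^sub>R ?e 0 + g (?e 0) x *\<^sub>R ?e 1 - g (?e 3) x *\<^sub>R ?e 2
      + g (?e 2) x *\<^sub>R ?e 3 - g (?e 5) x *\<^sub>R ?e 4 + g (?e 4) x *\<^sub>R ?e 5)"
      "g (e 1) (J x) = g (e 1) (- g (?e 1) x *\<^sub>R ?e 0 + g (?e 0) x *\<^sub>R ?e 1 - g (?e 3) x *\<^sub>R ?e 2
      + g (?e 2) x *\<^sub>R ?e 3 - g (?e 5) x *\<^sub>R ?e 4 + g (?e 4) x *\<^sub>R ?e 5)"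
      unfolding e by (simp_all add: J_coord on algebra_simps)
  qed (simp_all only: e, simp_all add: J_coord on)
  have "(\<lambda>x y z. a * \<psi> x y z + b * \<psi> (J x) y z) = re_volume g ?e"
    unfolding psi re_volume_def e
    by (intro ext) (simp add: wedge3_def wedge2_def J_coord algebra_simps)
  with J' on' show ?thesis
    by (intro su3_frame.intro su3_frame_axioms.intro frame.intro frame_axioms.intro inner_form_axioms)
qed

text \<open>Here \<open>q\<close> stands for the second fundamental form and \<open>r\<close> for
  the pulled back tensor. The J-invariant parts of both mix through the angle, but the
  anti-invariant part of \<open>C\<close> is a rotated copy of one form \<open>Q\<close>; hence the
  condition for \<open>W3\<close> does not involve the angle.\<close>

lemma type_conditions:
  fixes q r :: "(real ^ 6) form2" and c s :: real
  assumes q: "bilinear q" "\<And>x y. q x y = q y x" and r: "bilinear r" "\<And>x y. r x y = r y x"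
    and C: "linear C" "\<And>x y. g (C x) y = c * (q x y + r x (J y)) + s * (q x (J y) - r x y)"
    and cs: "c\<^sup>2 + s\<^sup>2 = 1" and U: "W4 \<notin> U"
  defines "tq \<equiv> \<Sum>i\<in>UNIV. q (e i) (e i)" and "tr \<equiv> \<Sum>i\<in>UNIV. r (e i) (e i)"
  shows "(\<exists>\<alpha>. (\<forall>k. \<alpha> k \<in> su3_space g J \<psi> k) \<and> (\<forall>x y z. \<psi> (C x) y z = (\<Sum>k\<in>UNIV. \<alpha> k x y z)) \<and>
        (\<forall>k. k \<notin> U \<longrightarrow> \<alpha> k = (\<lambda>x y z. 0))) \<longleftrightarrow>
    (W1p \<notin> U \<longrightarrow> c * tq - s * tr = 0) \<and> (W1m \<notin> U \<longrightarrow> c * tr + s * tq = 0) \<and>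
    (W2p \<notin> U \<longrightarrow> (\<forall>x y. 3 * c * (q x y + q (J x) (J y)) - 3 * s * (r x y + r (J x) (J y)) = (c * tq - s * tr) * g x y)) \<and>
    (W2m \<notin> U \<longrightarrow> (\<forall>x y. 3 * c * (r x y + r (J x) (J y)) + 3 * s * (q x y + q (J x) (J y)) = (c * tr + s * tq) * g x y)) \<and>
    (W3 \<notin> U \<longrightarrow> (\<forall>x y. - r (J x) y - r x (J y) = q x y - q (J x) (J y)))"
proof -
  note [simp] = bilinear_simps [OF q(1)] bilinear_simps [OF r(1)]
  define k where "k x y = g (C x) y" for x y
  have k: "k x y = c * (q x y + r x (J y)) + s * (q x (J y) - r x y)" for x y by (simp add: k_def C)
  have z: "(\<Sum>i\<in>UNIV. b (e i) (J (e i))) = 0" if "bilinear b" "\<And>x y. b x y = b y x" for b :: "(real ^ 6) form2"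
    by (simp add: sum_6 J_frame bilinear_rneg [OF that(1)] that(2) [of "e 1" "e 0"] that(2) [of "e 3" "e 2"] that(2) [of "e 5" "e 4"])
  have a: "(\<Sum>i\<in>UNIV. k (e i) (e i)) / 6 = (c * tq - s * tr) / 6"
    using z [OF q] z [OF r] unfolding k tq_def tr_def
    by (simp add: sum.distrib sum_subtractf flip: sum_distrib_left)
  have b: "(\<Sum>i\<in>UNIV. k (e i) (J (e i))) / 6 = - (c * tr + s * tq) / 6"
    using z [OF q] z [OF r] unfolding k tq_def tr_def
    by (simp add: sum.distrib sum_subtractf sum_negf flip: sum_distrib_left)
  have qr: "q y x = q x y" "r y x = r x y" "q (J y) (J x) = q (J x) (J y)" "r (J y) (J x) = r (J x) (J y)"
    "q y (J x) = q (J x) y" "r y (J x) = r (J x) y" "q (J y) x = q x (J y)" "r (J y) x = r x (J y)" for x y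
    using q(2) r(2) by blast+
  have S: "(k x y + k y x + k (J x) (J y) + k (J y) (J x)) / 4
      = (c * (q x y + q (J x) (J y)) - s * (r x y + r (J x) (J y))) / 2" for x y
    unfolding k using qr [of y x] by (simp add: field_simps)
  have K: "(k x y - k y x + k (J x) (J y) - k (J y) (J x)) / 4
      = (c * (r x (J y) - r (J x) y) + s * (q x (J y) - q (J x) y)) / 2" for x y
    unfolding k using qr [of y x] by (simp add: field_simps)
  define Q where "Q x y = q x y - q (J x) (J y) + r x (J y) + r (J x) y" for x y
  have kQ: "k x y - k (J x) (J y) = c * Q x y + s * Q x (J y)" for x y
    unfolding k Q_def by (simp add: algebra_simps)
  have symm: "k x y - k (J x) (J y) = k y x - k (J y) (J x)" for x y
    unfolding kQ Q_def using qr [of y x] by (simp add: algebra_simps)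
  note D = su3_decomposition [OF C(1) symm [unfolded k_def] U, folded k_def]
  have 2: "(\<forall>x y. (k x y + k y x + k (J x) (J y) + k (J y) (J x)) / 4 = (\<Sum>i\<in>UNIV. k (e i) (e i)) / 6 * g x y) \<longleftrightarrow>
    (\<forall>x y. 3 * c * (q x y + q (J x) (J y)) - 3 * s * (r x y + r (J x) (J y)) = (c * tq - s * tr) * g x y)"
  proof -
    have eqv: "X / 2 = Y / 6 * G \<longleftrightarrow> 3 * X = Y * G" for X Y G :: real by (auto simp: field_simps)
    show ?thesis unfolding S a eqv by (simp only: right_diff_distrib mult.assoc)
  qed
  have 3: "(\<forall>x y. (k x y - k y x + k (J x) (J y) - k (J y) (J x)) / 4 = (\<Sum>i\<in>UNIV. k (e i) (J (e i))) / 6 * g (J x) y) \<longleftrightarrow>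
    (\<forall>x y. 3 * c * (r x y + r (J x) (J y)) + 3 * s * (q x y + q (J x) (J y)) = (c * tr + s * tq) * g x y)"
    (is "?A \<longleftrightarrow> ?B")
  proof
    \<comment> \<open>Replacing y by \<open>J y\<close> turns a condition on the skew J-invariant
      part into one on symmetric forms.\<close>
    assume A: ?A
    show ?B
    proof (intro allI)
      fix x y
      have "(c * (r x (J (J y)) - r (J x) (J y)) + s * (q x (J (J y)) - q (J x) (J y))) / 2 = - (c * tr + s * tq) / 6 * g (J x) (J y)"
        using A [rule_format, of x "J y"] unfolding K b .
      then show "3 * c * (r x y + r (J x) (J y)) + 3 * s * (q x y + q (J x) (J y)) = (c * tr + s * tq) * g x y"
        by (simp add: field_simps)
    qed
  next
    assume B: ?B
    show ?A
    proof (intro allI)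
      fix x y
      have F: "3 * (c * (r x (J y) - r (J x) y) + s * (q x (J y) - q (J x) y)) = - ((c * tr + s * tq) * g (J x) y)"
        using B [rule_format, of x "J y"] by (simp add: J_skew distrib_left mult.assoc)
      have eqv: "X / 2 = - T / 6 * G \<longleftrightarrow> 3 * X = - (T * G)" for X T G :: real by (auto simp: field_simps)
      show "(k x y - k y x + k (J x) (J y) - k (J y) (J x)) / 4 = (\<Sum>i\<in>UNIV. k (e i) (J (e i))) / 6 * g (J x) y"
        unfolding K b eqv by (rule F)
    qed
  qed
  have 4: "(\<forall>x y. k x y = k (J x) (J y)) \<longleftrightarrow> (\<forall>x y. - r (J x) y - r x (J y) = q x y - q (J x) (J y))"
  proof
    assume k0: "\<forall>x y. k x y = k (J x) (J y)"
    have Q0: "Q x y = 0" for x y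
    proof -
      have 1: "c * Q x y + s * Q x (J y) = 0" "c * Q x (J y) + s * Q x (J (J y)) = 0"
        using k0 [rule_format, of x y] k0 [rule_format, of x "J y"] kQ [of x y] kQ [of x "J y"] by linarith+
      have "Q x (J (J y)) = - Q x y" by (simp add: Q_def)
      \<comment> \<open>The two equations are a rotation applied to Q x y and Q x (J y); this
        combination inverts it.\<close>
      with 1 have "c * (c * Q x y + s * Q x (J y)) - s * (c * Q x (J y) - s * Q x y) = 0" by simp
      then have "(c\<^sup>2 + s\<^sup>2) * Q x y = 0" by (simp add: power2_eq_square algebra_simps)
      then show ?thesis by (simp add: cs)
    qed
    show "\<forall>x y. - r (J x) y - r x (J y) = q x y - q (J x) (J y)"
    proof (intro allI)
      fix x y show "- r (J x) y - r x (J y) = q x y - q (J x) (J y)"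
        using Q0 [of x y] unfolding Q_def by linarith
    qed
  next
    assume *: "\<forall>x y. - r (J x) y - r x (J y) = q x y - q (J x) (J y)"
    have "Q x y = 0" for x y
      using *[rule_format, of x y] unfolding Q_def by simp
    then show "\<forall>x y. k x y = k (J x) (J y)" using kQ by simp
  qed
  have 5: "(\<Sum>i\<in>UNIV. k (e i) (e i)) / 6 = 0 \<longleftrightarrow> c * tq - s * tr = 0" unfolding a by simp
  have 6: "(\<Sum>i\<in>UNIV. k (e i) (J (e i))) / 6 = 0 \<longleftrightarrow> c * tr + s * tq = 0" unfolding b by (simp add: neg_eq_iff_add_eq_0)
  show ?thesis unfolding D 2 3 4 5 6 ..
qed

end

section \<open>Torsion of the hypersurface and the components of the Kaehler derivative\<close>

locale x3_hypersurface = g2_hypersurface A B g \<iota> n \<phi>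
  for A :: "('m::topological_space, 6) chart set" and B :: "('b::topological_space, 7) chart set"
    and g \<iota> n \<phi> +
  fixes \<theta> :: "'m \<Rightarrow> real"
  assumes X3: "type_X3 B g \<phi>" and smooth_angle: "smooth_function A \<theta>"
begin

abbreviation "r \<equiv> pullback2 A B \<iota> (rbar B g \<phi>)"
abbreviation "\<rho> p x \<equiv> rbar B g \<phi> (\<iota> p) (D p x) (n p)"
abbreviation "rnn p \<equiv> rbar B g \<phi> (\<iota> p) (n p) (n p)"
abbreviation "h \<equiv> mean_curvature A B g \<iota> n"
abbreviation "\<psi>p \<equiv> psi_plus A B g \<phi> \<iota> n \<theta>"
abbreviation "\<psi>m \<equiv> psi_minus A B g \<phi> \<iota> n \<theta>"
abbreviation "\<omega> \<equiv> \<lambda>q. kaehler_form (gM q) (J q)"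
abbreviation "d\<theta> \<equiv> differential_fun A \<theta>"

lemma rbar_sym: "rbar B g \<phi> q x y = rbar B g \<phi> q y x"
  using X3 by (simp add: type_X3_def)

text \<open>The representing vector gives linearity in the second argument; for the first argument
  the symmetry in type X3 is used.\<close>

lemma bilinear_rbar: "bilinear (rbar B g \<phi> q)"
proof -
  interpret inner_form "g q" by (rule B.metric)
  have l: "linear (rbar B g \<phi> q x)" for x
  proof -
    obtain R where "\<forall>y. g q R y = rbar B g \<phi> q x y" using nabla3_phi_rbar [of q x] by blast
    then have "rbar B g \<phi> q x = g q R" by (intro ext) simp
    then show ?thesis by (simp only: linear_g)
  qed
  moreover have "linear (\<lambda>x. rbar B g \<phi> q x y)" for y
  proof -
    have eq: "(\<lambda>x. rbar B g \<phi> q x y) = rbar B g \<phi> q y" by (intro ext) (rule rbar_sym)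
    show ?thesis unfolding eq by (rule l)
  qed
  ultimately show ?thesis by (simp add: bilinear_def)
qed

lemma bilinear_r: "bilinear (r p)" and r_sym: "r p x y = r p y x"
proof -
  note b = bilinear_rbar [of "\<iota> p"]
  show "bilinear (r p)"
    unfolding pullback2_def
    by (rule bilinearI) (simp_all add: bilinear_simps [OF b])
  show "r p x y = r p y x" unfolding pullback2_def by (rule rbar_sym)
qed

lemma bilinear_II: "bilinear (II p)"
proof -
  interpret inner_form "g (\<iota> p)" by (rule B.metric)
  have II: "II p x y = - g (\<iota> p) (Dn p x) (D p y)" for x y by (simp add: weingarten)
  have l: "linear (II p x)" for x unfolding linear_iff II by simp
  moreover have "linear (\<lambda>x. II p x y)" for y
  proof -
    have eq: "(\<lambda>x. II p x y) = II p y" by (intro ext) (rule II_sym)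
    show ?thesis unfolding eq by (rule l)
  qed
  ultimately show ?thesis by (simp add: bilinear_def)
qed

lemma su3_frame_Phi: "\<exists>E. su3_frame (gM p) E (J p) (\<Phi> p)"
  using adapted_su3_frame [of p] by blast

lemma linear_J: "linear (J p)"
proof -
  obtain E where "su3_frame (gM p) E (J p) (\<Phi> p)" using su3_frame_Phi by blast
  then show ?thesis by (rule su3_frame.linear_J)
qed

lemma phi_self: "\<phi> q x x y = 0" "\<phi> q x y x = 0"
proof -
  obtain e where "g2_frame (g q) e (\<phi> q)" using frame_exists by blast
  then interpret q: g2_frame "g q" e "\<phi> q" .
  show "\<phi> q x x y = 0" "\<phi> q x y x = 0" by simp_all
qed

lemma differentiable_omega: "(\<lambda>u. local2 A (cA p) \<omega> u y z) differentiable at (u0 p)"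
  by (rule nabla2_kaehler(1) [OF regular_phi trilinear_phi phi_self(1) gM_J])

text \<open>The vector R with \<langle>R, y\<rangle> = r(x, y) is split into a tangential part a and
  a multiple of n, and the derivative of n is tangential, say b; then d = - b - J a. The normal
  component of R, which is r(x, n), enters only the derivative of the pulled back \<phi>.\<close>

lemma torsion:
  "\<exists>d. (\<forall>y. gM p d y = II p x y + r p x (J p y)) \<and> (\<forall>y z. nabla2 A gM \<omega> p x y z = \<Phi> p d y z) \<and>
    (\<forall>y z w. nabla3 A gM \<Phi> p x y z w = - \<rho> p x * \<Phi> p (J p y) z w
      + gM p d y * gM p (J p z) w - gM p d z * gM p (J p y) w + gM p d w * gM p (J p y) z)"
proof -
  obtain f E where f: "g2_frame (g (\<iota> p)) f (\<phi> (\<iota> p))" and E: "su3_frame (gM p) E (J p) (\<Phi> p)"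
    and st1: "\<And>x y z. st p (n p) (D p x) (D p y) (D p z) = - \<Phi> p (J p x) y z"
    and st2: "\<And>a y z w. st p (D p a) (D p y) (D p z) (D p w) = - (gM p (J p a) y * gM p (J p z) w
      - gM p (J p a) z * gM p (J p y) w + gM p (J p a) w * gM p (J p y) z)"
    using adapted_su3_frame [of p] by (elim exE conjE) (rule that, simp_all)
  interpret f: g2_frame "g (\<iota> p)" f "\<phi> (\<iota> p)" by fact
  interpret E: su3_frame "gM p" E "J p" "\<Phi> p" by fact
  obtain R where "(\<forall>y z w. nabla3 B g \<phi> (\<iota> p) (D p x) y z w = st p R y z w) \<and>
    (\<forall>y. g (\<iota> p) R y = rbar B g \<phi> (\<iota> p) (D p x) y)"
    using nabla3_phi_rbar [of "\<iota> p" "D p x"] by (rule exE)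
  then have R: "\<And>y z w. nabla3 B g \<phi> (\<iota> p) (D p x) y z w = st p R y z w"
    "\<And>y. g (\<iota> p) R y = rbar B g \<phi> (\<iota> p) (D p x) y" by simp_all
  obtain a t where Ra: "R = D p a + t *\<^sub>R n p" by (rule tangent_normal_decomposition)
  have t: "t = \<rho> p x" using R(2) [of "n p"] by (simp add: Ra normal)
  have a: "gM p a y = r p x y" for y using R(2) [of "D p y"] by (simp add: Ra normal pullback2_def)
  obtain b where b: "D p b = Dn p x" using tangent weingarten(1) by blast
  have bII: "gM p b y = - II p x y" for y using weingarten(2) [of p x y] by (simp add: pullback2_def b)
  let ?d = "- b - J p a"
  have 1: "gM p ?d y = II p x y + r p x (J p y)" for y
    using E.J_skew [of a y] by (simp add: bII a)
  have "nabla2 A gM \<omega> p x y z = nabla3 B g \<phi> (\<iota> p) (D p x) (n p) (D p z) (D p y) + \<phi> (\<iota> p) (Dn p x) (D p z) (D p y)" for y z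
    by (rule nabla2_kaehler(2) [OF regular_phi trilinear_phi phi_self(1) gM_J phi_self(2)])
  moreover have "st p R (n p) (D p z) (D p y) = - \<Phi> p (J p a) y z" for y z
  proof -
    have "st p R (n p) (D p z) (D p y) = st p (D p a) (n p) (D p z) (D p y)"
      by (simp add: Ra f.star_phi)
    also have "\<dots> = - st p (n p) (D p a) (D p z) (D p y)"
      unfolding f.star_phi by (rule f.dual_skew(1))
    also have "\<dots> = - \<Phi> p (J p a) y z"
      unfolding st1 using E.psi_skew(2) [of "J p a" z y] by simp
    finally show ?thesis .
  qed
  moreover have "\<phi> (\<iota> p) (Dn p x) (D p z) (D p y) = - \<Phi> p b y z" for y z
    unfolding b [symmetric] using E.psi_skew(2) [of b z y] by (simp add: pullback3_def)
  ultimately have 2: "nabla2 A gM \<omega> p x y z = \<Phi> p ?d y z" for y z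
    by (simp add: R(1))
  have \<kappa>: "\<phi> (\<iota> p) (n p) (D p y) (D p z) = gM p (J p y) z" for y z
    by (simp add: gM_J [symmetric] E.sym)
  have 3: "nabla3 A gM \<Phi> p x y z w = - \<rho> p x * \<Phi> p (J p y) z w
      + gM p ?d y * gM p (J p z) w - gM p ?d z * gM p (J p y) w + gM p ?d w * gM p (J p y) z" for y z w
  proof -
    have "nabla3 A gM \<Phi> p x y z w = st p R (D p y) (D p z) (D p w)
      + II p x y * \<phi> (\<iota> p) (n p) (D p z) (D p w) + II p x z * \<phi> (\<iota> p) (D p y) (n p) (D p w)
      + II p x w * \<phi> (\<iota> p) (D p y) (D p z) (n p)"
      unfolding pullback3_regular(2) [OF regular_phi trilinear_phi] R(1) ..
    also have "\<phi> (\<iota> p) (D p y) (n p) (D p w) = - gM p (J p y) w"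
      unfolding \<kappa> [symmetric] by (rule f.phi_skew(1))
    also have "\<phi> (\<iota> p) (D p y) (D p z) (n p) = gM p (J p y) z"
      unfolding \<kappa> [symmetric] by (rule f.phi_cyc)
    also have "st p R (D p y) (D p z) (D p w) =
        st p (D p a) (D p y) (D p z) (D p w) + t * st p (n p) (D p y) (D p z) (D p w)"
      by (simp add: Ra f.star_phi)
    finally show ?thesis
      unfolding st1 st2 t \<kappa> by (simp add: bII algebra_simps)
  qed
  show ?thesis by (intro exI [of _ ?d] conjI allI 1 2 3)
qed

lemma psi_plus: "\<psi>p p x y z = cos (\<theta> p) * \<Phi> p x y z + sin (\<theta> p) * \<Phi> p (J p x) y z"
  and psi_minus: "\<psi>m p x y z = sin (\<theta> p) * \<Phi> p x y z - cos (\<theta> p) * \<Phi> p (J p x) y z"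
proof -
  have "st p (n p) (D p x) (D p y) (D p z) = - \<Phi> p (J p x) y z"
    using adapted_su3_frame [of p] by blast
  then show "\<psi>p p x y z = cos (\<theta> p) * \<Phi> p x y z + sin (\<theta> p) * \<Phi> p (J p x) y z"
    "\<psi>m p x y z = sin (\<theta> p) * \<Phi> p x y z - cos (\<theta> p) * \<Phi> p (J p x) y z"
    by (simp_all add: psi_plus_def psi_minus_def pullback3_def)
qed

text \<open>The ambient trace of r vanishes, so its tangential trace is minus its normal entry. This
  is how r(n, n) enters the conditions.\<close>

lemma traces:
  assumes "frame (gM p) E"
  shows "(\<Sum>i\<in>UNIV. II p (E i) (E i)) = 6 * h p" "(\<Sum>i\<in>UNIV. r p (E i) (E i)) = - rnn p"
proof -
  interpret E: frame "gM p" E by fact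
  show "(\<Sum>i\<in>UNIV. II p (E i) (E i)) = 6 * h p"
    by (simp add: mean_curvature_def E.trace_form_frame bilinear_II)
  obtain f F where f: "g2_frame (g (\<iota> p)) f (\<phi> (\<iota> p))" and F: "su3_frame (gM p) F (J p) (\<Phi> p)"
    and sum: "\<forall>b :: (real ^ 7) form2. (\<Sum>i\<in>UNIV. b (f i) (f i)) = b (n p) (n p) + (\<Sum>i\<in>UNIV. b (D p (F i)) (D p (F i)))"
    using adapted_su3_frame [of p] by blast
  interpret f: g2_frame "g (\<iota> p)" f "\<phi> (\<iota> p)" by fact
  interpret F: su3_frame "gM p" F "J p" "\<Phi> p" by fact
  have "(\<Sum>i\<in>UNIV. r p (E i) (E i)) = (\<Sum>i\<in>UNIV. r p (F i) (F i))"
    by (rule F.sum_frames [OF assms bilinear_r])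
  moreover have "rnn p + (\<Sum>i\<in>UNIV. r p (F i) (F i)) = 0"
  proof -
    have "trace_form (g (\<iota> p)) (rbar B g \<phi> (\<iota> p)) = 0" using X3 by (simp add: type_X3_def)
    then show ?thesis
      using sum [rule_format, of "rbar B g \<phi> (\<iota> p)"] f.trace_form_frame [OF bilinear_rbar [of "\<iota> p"]]
      unfolding pullback2_def by linarith
  qed
  ultimately show "(\<Sum>i\<in>UNIV. r p (E i) (E i)) = - rnn p" by simp
qed

text \<open>One clause per class absent from \<open>U\<close>, so that sums lacking several classes
  give conjunctions. \<open>W5\<close> is not a condition on \<open>C\<close> and is treated
  separately.\<close>

definition type_condition :: "su3_class set \<Rightarrow> 'm \<Rightarrow> bool" where
  "type_condition U p \<longleftrightarrow>
    (W1p \<notin> U \<longrightarrow> sin (\<theta> p) * rnn p = - 6 * h p * cos (\<theta> p)) \<and>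
    (W1m \<notin> U \<longrightarrow> cos (\<theta> p) * rnn p = 6 * h p * sin (\<theta> p)) \<and>
    (W2p \<notin> U \<longrightarrow> (\<forall>x y. - 3 * sin (\<theta> p) * (r p x y + I_both (J p) (r p) x y)
                   + 3 * cos (\<theta> p) * (II p x y + I_both (J p) (II p) x y)
                   = (6 * h p * cos (\<theta> p) + sin (\<theta> p) * rnn p) * gM p x y)) \<and>
    (W2m \<notin> U \<longrightarrow> (\<forall>x y. 3 * cos (\<theta> p) * (r p x y + I_both (J p) (r p) x y)
                   + 3 * sin (\<theta> p) * (II p x y + I_both (J p) (II p) x y)
                   = (6 * h p * sin (\<theta> p) - cos (\<theta> p) * rnn p) * gM p x y)) \<and>
    (W3 \<notin> U \<longrightarrow> (\<forall>x y. I_first (J p) (r p) x y + I_second (J p) (r p) x y = II p x y - I_both (J p) (II p) x y))"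

lemma component_conditions:
  assumes "W4 \<notin> U"
  shows "(\<exists>\<alpha>. (\<forall>k. \<alpha> k \<in> su3_space (gM p) (J p) (\<psi>p p) k) \<and>
        (\<forall>x y z. nabla2 A gM \<omega> p x y z = (\<Sum>k\<in>UNIV. \<alpha> k x y z)) \<and> (\<forall>k. k \<notin> U \<longrightarrow> \<alpha> k = (\<lambda>x y z. 0))) \<longleftrightarrow>
    type_condition U p"
proof -
  define c s where "c = cos (\<theta> p)" and "s = sin (\<theta> p)"
  have cs: "c\<^sup>2 + s\<^sup>2 = 1" by (simp add: c_def s_def)
  obtain E0 where "su3_frame (gM p) E0 (J p) (\<Phi> p)" using su3_frame_Phi by blast
  then interpret E0: su3_frame "gM p" E0 "J p" "\<Phi> p" .
  have eq: "\<psi>p p = (\<lambda>x y z. c * \<Phi> p x y z + s * \<Phi> p (J p x) y z)"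
    by (intro ext) (simp add: psi_plus c_def s_def)
  obtain E where "su3_frame (gM p) E (J p) (\<psi>p p)" using E0.rotate [OF cs, folded eq] by blast
  then interpret E: su3_frame "gM p" E "J p" "\<psi>p p" .
  let ?b = "\<lambda>x y. c * (II p x y + r p x (J p y)) + s * (II p x (J p y) - r p x y)"
  have "bilinear ?b"
    by (rule bilinearI) (simp_all add: bilinear_simps [OF bilinear_II] bilinear_simps [OF bilinear_r] algebra_simps linear_add [OF linear_J] linear_cmul [OF linear_J])
  then obtain C where C: "linear C" "\<And>x y. gM p (C x) y = ?b x y" by (rule E.operator_of_form) blast
  have N: "nabla2 A gM \<omega> p x y z = \<psi>p p (C x) y z" for x y z
  proof -
    obtain d where d: "\<And>y. gM p d y = II p x y + r p x (J p y)" "\<And>y z. nabla2 A gM \<omega> p x y z = \<Phi> p d y z"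
      using torsion [of p x] by (elim exE conjE) (rule that, simp_all)
    \<comment> \<open>Contracting with \<open>\<psi>p\<close> inserts c + s J into the first slot of
      \<open>\<Phi>\<close>; C x has to undo this rotation of d.\<close>
    have Cx: "C x = c *\<^sub>R d - s *\<^sub>R J p d"
    proof (rule E0.eqI)
      fix y
      have JD: "gM p (J p d) y = r p x y - II p x (J p y)"
        using E.J_skew [of d y] by (simp add: d(1) bilinear_rneg [OF bilinear_r])
      show "gM p (C x) y = gM p (c *\<^sub>R d - s *\<^sub>R J p d) y"
        by (simp add: C d(1) JD bilinear_rneg [OF bilinear_r] algebra_simps)
    qed
    have "\<psi>p p (C x) y z = (c\<^sup>2 + s\<^sup>2) * \<Phi> p d y z"
      unfolding eq Cx by (simp add: power2_eq_square algebra_simps)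
    then show ?thesis by (simp add: cs d(2))
  qed
  have e1: "s * rnn p = - 6 * h p * c \<longleftrightarrow> c * (6 * h p) - s * - rnn p = 0"
    and e2: "c * rnn p = 6 * h p * s \<longleftrightarrow> c * - rnn p + s * (6 * h p) = 0"
    by (auto simp: algebra_simps)
  have e3: "- 3 * s * (r p x y + I_both (J p) (r p) x y) + 3 * c * (II p x y + I_both (J p) (II p) x y)
      = (6 * h p * c + s * rnn p) * gM p x y \<longleftrightarrow>
    3 * c * (II p x y + II p (J p x) (J p y)) - 3 * s * (r p x y + r p (J p x) (J p y))
      = (c * (6 * h p) - s * - rnn p) * gM p x y"
    and e4: "3 * c * (r p x y + I_both (J p) (r p) x y) + 3 * s * (II p x y + I_both (J p) (II p) x y)
      = (6 * h p * s - c * rnn p) * gM p x y \<longleftrightarrow>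
    3 * c * (r p x y + r p (J p x) (J p y)) + 3 * s * (II p x y + II p (J p x) (J p y))
      = (c * - rnn p + s * (6 * h p)) * gM p x y"
    and e5: "I_first (J p) (r p) x y + I_second (J p) (r p) x y = II p x y - I_both (J p) (II p) x y \<longleftrightarrow>
      - r p (J p x) y - r p x (J p y) = II p x y - II p (J p x) (J p y)" for x y
    by (simp_all add: I_both_def I_first_def I_second_def algebra_simps)
  show ?thesis
    unfolding type_condition_def c_def [symmetric] s_def [symmetric] N e1 e2 e3 e4 e5
    by (rule E.type_conditions [OF bilinear_II II_sym bilinear_r r_sym C cs assms, unfolded traces [OF E.frame_axioms]])
qed

end

section \<open>The W5 part\<close>

context x3_hypersurface begin

lemma differentiable_angle: "(\<theta> \<circ> chart_inv (cA p)) differentiable at (u0 p)"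
proof -
  have "smooth_on (snd (cA p) ` fst (cA p)) (\<theta> \<circ> chart_inv (cA p))"
    using smooth_angle A.chart_at(1) by (simp add: smooth_function_def)
  from smooth_on_has_derivative [OF this] show ?thesis using A.chart_at(2) differentiableI by blast
qed

lemma linear_d\<theta>: "linear (d\<theta> p)"
  unfolding differential_fun_def
  using differentiable_angle frechet_derivative_works has_derivative_linear by blast

lemma regular_Phi: "M.regular3 \<Phi> p"
  by (rule pullback3_regular(1) [OF regular_phi trilinear_phi])

lemma nabla_J:
  shows "(\<lambda>u. local_end A (cA p) J u y) differentiable at (u0 p)"
    and "gM p z (nabla_end A gM J p x y) = nabla2 A gM \<omega> p x z y"
  by (rule M.nabla_end_kaehler [OF differentiable_omega])+

text \<open>By \<open>xi_derivation\<close> the terms of \<open>torsion\<close> with d are exactly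
  the action of \<xi> on \<open>\<Phi>\<close>. What survives is the normal component of r and the
  derivative of the angle, both acting as an infinitesimal rotation of the complex volume
  form.\<close>

lemma nabla_psi:
  fixes p x
  defines "\<xi> \<equiv> \<lambda>y. (- 1 / 2) *\<^sub>R J p (nabla_end A gM J p x y)"
  shows "nabla3 A gM \<psi>p p x y z w - \<psi>p p (\<xi> y) z w - \<psi>p p y (\<xi> z) w - \<psi>p p y z (\<xi> w)
      = (\<rho> p x - d\<theta> p x) * \<psi>m p y z w"
    and "nabla3 A gM \<psi>m p x y z w - \<psi>m p (\<xi> y) z w - \<psi>m p y (\<xi> z) w - \<psi>m p y z (\<xi> w)
      = - (\<rho> p x - d\<theta> p x) * \<psi>p p y z w"
proof -
  define K where "K y = nabla_end A gM J p x y" for y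
  obtain E where "su3_frame (gM p) E (J p) (\<Phi> p)" using su3_frame_Phi by blast
  then interpret E: su3_frame "gM p" E "J p" "\<Phi> p" .
  obtain d where "(\<forall>y. gM p d y = II p x y + r p x (J p y)) \<and> (\<forall>y z. nabla2 A gM \<omega> p x y z = \<Phi> p d y z) \<and>
    (\<forall>y z w. nabla3 A gM \<Phi> p x y z w = - \<rho> p x * \<Phi> p (J p y) z w
      + gM p d y * gM p (J p z) w - gM p d z * gM p (J p y) w + gM p d w * gM p (J p y) z)"
    using torsion [of p x] by (rule exE)
  then have om: "nabla2 A gM \<omega> p x y z = \<Phi> p d y z"
    and Phi: "nabla3 A gM \<Phi> p x y z w = - \<rho> p x * \<Phi> p (J p y) z w
      + gM p d y * gM p (J p z) w - gM p d z * gM p (J p y) w + gM p d w * gM p (J p y) z" for y z w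
    by simp_all
  have K: "gM p u (K y) = \<Phi> p d u y" for u y by (simp add: K_def nabla_J(2) om)
  \<comment> \<open>Needed for the J-rotated term of \<psi>, whose derivative involves \<xi> behind
    \<open>J\<close>.\<close>
  have KJ: "K (J p y) = - J p (K y)" for y
  proof (rule E.eqI)
    fix u
    have "gM p u (K (J p y)) = gM p (J p u) (K y)" by (simp only: K E.psi_J)
    also have "\<dots> = - gM p u (J p (K y))" by (simp add: E.J_skew)
    finally show "gM p (K (J p y)) u = gM p (- J p (K y)) u" by (simp add: E.sym [of _ u])
  qed
  have Phi': "nabla3 A gM \<Phi> p x y z w = - \<rho> p x * \<Phi> p (J p y) z w
      - (\<Phi> p (J p (K y)) z w + \<Phi> p y (J p (K z)) w + \<Phi> p y z (J p (K w))) / 2" for y z w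
    unfolding Phi E.xi_derivation [OF K] by (simp add: field_simps)
  have T': "M.regular3 (\<lambda>q x. \<Phi> q (J q x)) p"
    "nabla3 A gM (\<lambda>q x. \<Phi> q (J q x)) p x y z w = nabla3 A gM \<Phi> p x (J p y) z w + \<Phi> p (K y) z w" for y z w
    unfolding K_def by (rule M.nabla3_end [OF regular_Phi nabla_J(1) linear_J])+
  have \<xi>: "\<xi> y = (- 1 / 2) *\<^sub>R J p (K y)" for y by (simp add: \<xi>_def K_def)
  have fp: "\<psi>p = (\<lambda>q x y z. cos (\<theta> q) * \<Phi> q x y z + sin (\<theta> q) * \<Phi> q (J q x) y z)"
    by (intro ext) (rule psi_plus)
  have fm: "\<psi>m = (\<lambda>q x y z. sin (\<theta> q) * \<Phi> q x y z + - cos (\<theta> q) * \<Phi> q (J q x) y z)"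
    by (intro ext) (simp add: psi_minus)
  have at: "chart_inv (cA p) (u0 p) = p" by (simp add: A.chart_inv_snd A.chart_at)
  note D\<theta> = M.differential_fun_has_derivative [OF differentiable_angle [of p]]
  note comb = M.nabla3_combination [OF regular_Phi T'(1)]
  have np: "nabla3 A gM \<psi>p p x y z w = - sin (\<theta> p) * d\<theta> p x * \<Phi> p y z w + cos (\<theta> p) * nabla3 A gM \<Phi> p x y z w
      + cos (\<theta> p) * d\<theta> p x * \<Phi> p (J p y) z w + sin (\<theta> p) * (nabla3 A gM \<Phi> p x (J p y) z w + \<Phi> p (K y) z w)"
    unfolding fp comb [OF has_derivative_cos [OF D\<theta>] has_derivative_sin [OF D\<theta>]] T'(2) by (simp add: at)
  have nm: "nabla3 A gM \<psi>m p x y z w = cos (\<theta> p) * d\<theta> p x * \<Phi> p y z w + sin (\<theta> p) * nabla3 A gM \<Phi> p x y z w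
      + sin (\<theta> p) * d\<theta> p x * \<Phi> p (J p y) z w + - cos (\<theta> p) * (nabla3 A gM \<Phi> p x (J p y) z w + \<Phi> p (K y) z w)"
    unfolding fm comb [OF has_derivative_sin [OF D\<theta>] has_derivative_minus [OF has_derivative_cos [OF D\<theta>]]] T'(2)
    by (simp add: at)
  show "nabla3 A gM \<psi>p p x y z w - \<psi>p p (\<xi> y) z w - \<psi>p p y (\<xi> z) w - \<psi>p p y z (\<xi> w)
      = (\<rho> p x - d\<theta> p x) * \<psi>m p y z w"
    unfolding np psi_plus psi_minus \<xi> Phi' by (simp add: KJ field_simps)
  show "nabla3 A gM \<psi>m p x y z w - \<psi>m p (\<xi> y) z w - \<psi>m p y (\<xi> z) w - \<psi>m p y z (\<xi> w)
      = - (\<rho> p x - d\<theta> p x) * \<psi>p p y z w"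
    unfolding nm psi_plus psi_minus \<xi> Phi' by (simp add: KJ field_simps)
qed

text \<open>This holds for every \<eta>, because \<open>J\<close> acts trivially on the Kaehler form
  as a derivation; so \<eta> is determined by the three-forms alone.\<close>

lemma parallel_omega: "parallel2_at A gM (eta_xi A gM J \<eta> p) \<omega> p"
  unfolding parallel2_at_def
proof (intro allI)
  fix x y z
  obtain E where "su3_frame (gM p) E (J p) (\<Phi> p)" using su3_frame_Phi by blast
  then interpret E: su3_frame "gM p" E "J p" "\<Phi> p" .
  obtain d where "\<forall>y z. nabla2 A gM \<omega> p x y z = \<Phi> p d y z"
    using torsion [of p x] by blast
  then have om: "nabla2 A gM \<omega> p x y z = \<Phi> p d y z" for y z by simp
  have K: "gM p u (nabla_end A gM J p x y) = \<Phi> p d u y" for u y by (simp add: nabla_J(2) om)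
  show "nabla2 A gM \<omega> p x y z - kaehler_form (gM p) (J p) (eta_xi A gM J \<eta> p x y) z
      - kaehler_form (gM p) (J p) y (eta_xi A gM J \<eta> p x z) = 0"
    using E.psi_skew(2) [of d z y] E.sym [of "nabla_end A gM J p x y" z]
    by (simp add: kaehler_form_def eta_xi_def om K E.J_skew [of y z] E.sym [of "J p y" "nabla_end A gM J p x z"])
qed

text \<open>As a derivation \<open>J\<close> multiplies the complex volume form by 3 i; these are
  the real and imaginary parts.\<close>

lemma psi_derivation:
  "\<psi>p p (J p y) z w + \<psi>p p y (J p z) w + \<psi>p p y z (J p w) = - 3 * \<psi>m p y z w"
  "\<psi>m p (J p y) z w + \<psi>m p y (J p z) w + \<psi>m p y z (J p w) = 3 * \<psi>p p y z w"
proof -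
  obtain E where "su3_frame (gM p) E (J p) (\<Phi> p)" using su3_frame_Phi by blast
  then interpret E: su3_frame "gM p" E "J p" "\<Phi> p" .
  show "\<psi>p p (J p y) z w + \<psi>p p y (J p z) w + \<psi>p p y z (J p w) = - 3 * \<psi>m p y z w"
    "\<psi>m p (J p y) z w + \<psi>m p y (J p z) w + \<psi>m p y z (J p w) = 3 * \<psi>p p y z w"
    unfolding psi_plus psi_minus by (simp_all add: E.psi_J)
qed

lemmas Phi_simps = trilinear_simps [OF regular_Phi [unfolded M.regular3_def, THEN conjunct1, rule_format]]

lemma psi_linear:
  "\<psi>p p (s *\<^sub>R x + y) z w = s * \<psi>p p x z w + \<psi>p p y z w" "\<psi>p p z (s *\<^sub>R x + y) w = s * \<psi>p p z x w + \<psi>p p z y w"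
  "\<psi>p p z w (s *\<^sub>R x + y) = s * \<psi>p p z w x + \<psi>p p z w y"
  "\<psi>m p (s *\<^sub>R x + y) z w = s * \<psi>m p x z w + \<psi>m p y z w" "\<psi>m p z (s *\<^sub>R x + y) w = s * \<psi>m p z x w + \<psi>m p z y w"
  "\<psi>m p z w (s *\<^sub>R x + y) = s * \<psi>m p z w x + \<psi>m p z w y"
  unfolding psi_plus psi_minus
  by (simp_all add: Phi_simps linear_add [OF linear_J] linear_cmul [OF linear_J] algebra_simps)

text \<open>On two frame triples the values are sin \<theta> and cos \<theta>, which do not vanish
  together. This gives the uniqueness of \<eta>.\<close>

lemma psi_minus_nonzero: "\<exists>y z w. \<psi>m p y z w \<noteq> 0"
proof (rule ccontr)
  assume "\<not> ?thesis"
  then have 0: "\<psi>m p y z w = 0" for y z w by blast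
  obtain E where "su3_frame (gM p) E (J p) (\<Phi> p)" using su3_frame_Phi by blast
  then interpret E: su3_frame "gM p" E "J p" "\<Phi> p" .
  have "\<Phi> p (E 0) (E 2) (E 4) = 1" "\<Phi> p (E 1) (E 2) (E 4) = 0"
    by (simp_all add: E.psi re_volume_def wedge3_def wedge2_def E.on)
  then have "sin (\<theta> p) = 0" "cos (\<theta> p) = 0"
    using 0 [of "E 0" "E 2" "E 4"] 0 [of "E 1" "E 2" "E 4"] by (simp_all add: psi_minus E.J_frame)
  then show False using sin_cos_squared_add [of "\<theta> p"] by simp
qed

lemma parallel_psi:
  "nabla3 A gM \<psi>p p x y z w - \<psi>p p (eta_xi A gM J \<eta> p x y) z w - \<psi>p p y (eta_xi A gM J \<eta> p x z) w
      - \<psi>p p y z (eta_xi A gM J \<eta> p x w) = (\<rho> p x - d\<theta> p x + 3 * I_one (J p) \<eta> x) * \<psi>m p y z w"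
  "nabla3 A gM \<psi>m p x y z w - \<psi>m p (eta_xi A gM J \<eta> p x y) z w - \<psi>m p y (eta_xi A gM J \<eta> p x z) w
      - \<psi>m p y z (eta_xi A gM J \<eta> p x w) = - (\<rho> p x - d\<theta> p x + 3 * I_one (J p) \<eta> x) * \<psi>p p y z w"
proof -
  let ?i = "I_one (J p) \<eta> x"
  have "?i * (\<psi>p p (J p y) z w + \<psi>p p y (J p z) w + \<psi>p p y z (J p w)) = ?i * (- 3 * \<psi>m p y z w)"
    by (simp only: psi_derivation)
  then show "nabla3 A gM \<psi>p p x y z w - \<psi>p p (eta_xi A gM J \<eta> p x y) z w - \<psi>p p y (eta_xi A gM J \<eta> p x z) w
      - \<psi>p p y z (eta_xi A gM J \<eta> p x w) = (\<rho> p x - d\<theta> p x + 3 * ?i) * \<psi>m p y z w"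
    using nabla_psi(1) [of p x y z w] unfolding eta_xi_def psi_linear by (simp only: algebra_simps)
  have "?i * (\<psi>m p (J p y) z w + \<psi>m p y (J p z) w + \<psi>m p y z (J p w)) = ?i * (3 * \<psi>p p y z w)"
    by (simp only: psi_derivation)
  then show "nabla3 A gM \<psi>m p x y z w - \<psi>m p (eta_xi A gM J \<eta> p x y) z w - \<psi>m p y (eta_xi A gM J \<eta> p x z) w
      - \<psi>m p y z (eta_xi A gM J \<eta> p x w) = - (\<rho> p x - d\<theta> p x + 3 * ?i) * \<psi>p p y z w"
    using nabla_psi(2) [of p x y z w] unfolding eta_xi_def psi_linear
    by (simp only: algebra_simps minus_add_distrib minus_diff_eq)
qed

lemma J_J: "J p (J p x) = - x"
proof -
  obtain E where "su3_frame (gM p) E (J p) (\<Phi> p)" using su3_frame_Phi by blast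
  then show ?thesis by (rule su3_frame.J_J)
qed

text \<open>By \<open>parallel_psi\<close> one scalar factor governs both three-forms; the formula
  solves its vanishing for \<eta>, using that \<open>J\<close> squares to minus the
  identity.\<close>

lemma W5_part: "W5_part A gM J \<psi>p \<psi>m p y = (d\<theta> p (J p y) - \<rho> p (J p y)) / 3"
proof -
  define \<eta> where "\<eta> y = (d\<theta> p (J p y) - \<rho> p (J p y)) / 3" for y
  note lin = linear_add [OF linear_d\<theta>] linear_cmul [OF linear_d\<theta>] linear_neg [OF linear_d\<theta>]
    bilinear_ladd [OF bilinear_rbar] bilinear_lmul [OF bilinear_rbar] bilinear_lneg [OF bilinear_rbar]
    linear_add [OF linear_J] linear_cmul [OF linear_J]
  have "W5_part A gM J \<psi>p \<psi>m p = \<eta>"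
    unfolding W5_part_def
  proof (rule the_equality)
    have "\<rho> p x - d\<theta> p x + 3 * I_one (J p) \<eta> x = 0" for x
      by (simp add: I_one_def \<eta>_def J_J lin)
    moreover have "linear \<eta>"
      unfolding linear_iff \<eta>_def by (simp add: lin algebra_simps add_divide_distrib diff_divide_distrib)
    ultimately show "linear \<eta> \<and> parallel2_at A gM (eta_xi A gM J \<eta> p) \<omega> p \<and>
        parallel3_at A gM (eta_xi A gM J \<eta> p) \<psi>p p \<and> parallel3_at A gM (eta_xi A gM J \<eta> p) \<psi>m p"
      by (simp add: parallel_omega parallel3_at_def parallel_psi)
  next
    fix \<eta>' assume \<eta>': "linear \<eta>' \<and> parallel2_at A gM (eta_xi A gM J \<eta>' p) \<omega> p \<and>
        parallel3_at A gM (eta_xi A gM J \<eta>' p) \<psi>p p \<and> parallel3_at A gM (eta_xi A gM J \<eta>' p) \<psi>m p"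
    then have "(\<rho> p x - d\<theta> p x + 3 * I_one (J p) \<eta>' x) * \<psi>m p y z w = 0" for x y z w
      by (auto simp: parallel3_at_def parallel_psi)
    then have *: "\<rho> p x - d\<theta> p x + 3 * I_one (J p) \<eta>' x = 0" for x
      using psi_minus_nonzero by (metis mult_eq_0_iff)
    have "\<eta>' y = \<eta> y" for y
      using * [of "J p y"] linear_neg [of \<eta>' y] \<eta>' by (simp add: I_one_def \<eta>_def J_J)
    then show "\<eta>' = \<eta>" by blast
  qed
  then show ?thesis by (simp add: \<eta>_def)
qed

lemma W5_part_zero: "(\<forall>y. W5_part A gM J \<psi>p \<psi>m p y = 0) \<longleftrightarrow> (\<forall>x. d\<theta> p x = \<rho> p x)"
proof
  assume *: "\<forall>y. W5_part A gM J \<psi>p \<psi>m p y = 0"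
  show "\<forall>x. d\<theta> p x = \<rho> p x"
  proof
    fix x show "d\<theta> p x = \<rho> p x"
      using * [rule_format, of "J p x"]
      by (simp add: W5_part J_J linear_neg [OF linear_d\<theta>] bilinear_lneg [OF bilinear_rbar])
  qed
qed (simp add: W5_part)

lemma induced_type_iff:
  assumes "W4 \<notin> U"
  shows "induced_su3_type A B g \<phi> \<iota> n \<theta> U \<longleftrightarrow>
    (\<forall>p. type_condition U p) \<and> (W5 \<notin> U \<longrightarrow> (\<forall>p x. d\<theta> p x = \<rho> p x))"
  unfolding induced_su3_type_def su3_type_def component_conditions [OF assms] W5_part_zero ..

end

section \<open>Joint conditions and the theorem\<close>

text \<open>A rotation is invertible: when both classes with the same index are absent, their two
  conditions mixing r and B through \<theta> are equivalent to the unmixed ones.\<close>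

lemma rotated_equations:
  fixes X Y a b c s :: real
  assumes "c\<^sup>2 + s\<^sup>2 = 1"
  shows "- s * X + c * Y = c * a - s * b \<and> c * X + s * Y = s * a + c * b \<longleftrightarrow> X = b \<and> Y = a"
proof
  assume *: "- s * X + c * Y = c * a - s * b \<and> c * X + s * Y = s * a + c * b"
  then have "c * (c * X + s * Y) - s * (- s * X + c * Y) = c * (s * a + c * b) - s * (c * a - s * b)"
    "s * (c * X + s * Y) + c * (- s * X + c * Y) = s * (s * a + c * b) + c * (c * a - s * b)" by simp_all
  then have "(c\<^sup>2 + s\<^sup>2) * X = (c\<^sup>2 + s\<^sup>2) * b" "(c\<^sup>2 + s\<^sup>2) * Y = (c\<^sup>2 + s\<^sup>2) * a"
    by (simp_all add: power2_eq_square algebra_simps)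
  then show "X = b \<and> Y = a" by (simp add: assms)
qed (simp add: algebra_simps)

lemma riemannian_if_riemannian_manifold:
  assumes "riemannian_manifold B g" shows "riemannian B g"
proof -
  interpret atlas B using assms by unfold_locales (simp add: riemannian_manifold_def)
  have m: "riemannian_metric B g" using assms by (simp add: riemannian_manifold_def)
  show ?thesis
  proof unfold_locales
    fix p x y
    show "bilinear (g p)" "g p x y = g p y x" "x \<noteq> 0 \<Longrightarrow> g p x x > 0"
      using m by (auto simp: riemannian_metric_def)
    have "smooth_on (snd (chart_at B p) ` fst (chart_at B p)) (\<lambda>u. local2 B (chart_at B p) g u x y)"
      using m chart_at(1) by (simp add: riemannian_metric_def)
    from smooth_on_has_derivative [OF this] show "(\<lambda>u. local2 B (chart_at B p) g u x y) differentiable at (snd (chart_at B p) p)"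
      using chart_at(2) differentiableI by blast
  qed
qed

theorem theorem4p9:
  fixes A :: "('m::{t2_space, second_countable_topology}, 6) chart set"
    and B :: "('b::{t2_space, second_countable_topology}, 7) chart set"
    and g :: "'b \<Rightarrow> real ^ 7 \<Rightarrow> real ^ 7 \<Rightarrow> real"
    and \<phi> :: "'b \<Rightarrow> real ^ 7 \<Rightarrow> real ^ 7 \<Rightarrow> real ^ 7 \<Rightarrow> real"
    and \<iota> :: "'m \<Rightarrow> 'b"
    and n :: "'m \<Rightarrow> real ^ 7"
    and \<theta> :: "'m \<Rightarrow> real"
  assumes "riemannian_manifold B g"
    and "g2_structure B g \<phi>"
    and "type_X3 B g \<phi>"
    and "immersed_hypersurface A B \<iota>"
    and "unit_normal_field A B g \<iota> n"
    and "smooth_function A \<theta>"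
  shows
    "let T = induced_su3_type A B g \<phi> \<iota> n \<theta>;
         J = induced_I A B g \<phi> \<iota> n;
         gM = pullback2 A B \<iota> g;
         r = pullback2 A B \<iota> (rbar B g \<phi>);
         rnn = (\<lambda>p. rbar B g \<phi> (\<iota> p) (n p) (n p));
         II = second_fundamental_form A B g \<iota> n;
         h = mean_curvature A B g \<iota> n
     in
       T {W1p, W1m, W2p, W2m, W3, W5}
     \<and> (T {W1p, W1m, W2p, W2m, W3} \<longleftrightarrow>
          (\<forall>p x. differential_fun A \<theta> p x = rbar B g \<phi> (\<iota> p) (differential A B \<iota> p x) (n p)))
     \<and> (T {W1p, W1m, W2p, W2m, W5} \<longleftrightarrow>
          (\<forall>p x y. I_first (J p) (r p) x y + I_second (J p) (r p) x y
                   = II p x y - I_both (J p) (II p) x y))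
     \<and> (T {W1p, W1m, W2p, W3, W5} \<longleftrightarrow>
          (\<forall>p x y. 3 * cos (\<theta> p) * (r p x y + I_both (J p) (r p) x y)
                   + 3 * sin (\<theta> p) * (II p x y + I_both (J p) (II p) x y)
                   = (6 * h p * sin (\<theta> p) - cos (\<theta> p) * rnn p) * gM p x y))
     \<and> (T {W1p, W1m, W2m, W3, W5} \<longleftrightarrow>
          (\<forall>p x y. - 3 * sin (\<theta> p) * (r p x y + I_both (J p) (r p) x y)
                   + 3 * cos (\<theta> p) * (II p x y + I_both (J p) (II p) x y)
                   = (6 * h p * cos (\<theta> p) + sin (\<theta> p) * rnn p) * gM p x y))
     \<and> (T {W1p, W2p, W2m, W3, W5} \<longleftrightarrow>
          (\<forall>p. cos (\<theta> p) * rnn p = 6 * h p * sin (\<theta> p)))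
     \<and> (T {W1m, W2p, W2m, W3, W5} \<longleftrightarrow>
          (\<forall>p. sin (\<theta> p) * rnn p = - 6 * h p * cos (\<theta> p)))
     \<and> (T {W1p, W1m, W3, W5} \<longleftrightarrow>
          (\<forall>p x y. 3 * (r p x y + I_both (J p) (r p) x y) = - rnn p * gM p x y)
          \<and> (\<forall>p x y. II p x y + I_both (J p) (II p) x y = 2 * h p * gM p x y))
     \<and> (T {W2p, W2m, W3, W5} \<longleftrightarrow>
          (\<forall>p. rnn p = 0) \<and> minimal_variety A B g \<iota> n)"
proof -
  interpret atlas A using assms(4) by unfold_locales (simp add: immersed_hypersurface_def)
  interpret riemannian B g by (rule riemannian_if_riemannian_manifold [OF assms(1)])
  interpret x3_hypersurface A B g \<iota> n \<phi> \<theta>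
    by unfold_locales (use assms in \<open>auto simp: immersed_hypersurface_def\<close>)
  \<comment> \<open>\<open>rot\<close> treats the two \<open>W2\<close> conditions at a point,
    \<open>rot0\<close> the two \<open>W1\<close> conditions.\<close>
  have rot: "3 * cos (\<theta> p) * Y - 3 * sin (\<theta> p) * (X + X') = (6 * h p * cos (\<theta> p) + sin (\<theta> p) * rnn p) * G \<and>
      3 * cos (\<theta> p) * (X + X') + 3 * sin (\<theta> p) * Y = (6 * h p * sin (\<theta> p) - cos (\<theta> p) * rnn p) * G \<longleftrightarrow>
      3 * X + 3 * X' = - (rnn p * G) \<and> Y = 2 * h p * G" for p X X' Y G
    using rotated_equations [of "cos (\<theta> p)" "sin (\<theta> p)" "3 * (X + X')" "3 * Y" "6 * h p * G" "- rnn p * G"]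
    by (auto simp: algebra_simps)
  have rot0: "sin (\<theta> p) * rnn p = - (6 * h p * cos (\<theta> p)) \<and> cos (\<theta> p) * rnn p = 6 * h p * sin (\<theta> p) \<longleftrightarrow>
      rnn p = 0 \<and> h p = 0" for p
    using rotated_equations [of "cos (\<theta> p)" "sin (\<theta> p)" "- rnn p" "6 * h p" 0 0]
    by (auto simp: algebra_simps)
  show ?thesis
    unfolding Let_def minimal_variety_def
    by (intro conjI) (simp_all add: induced_type_iff type_condition_def rot rot0 flip: all_conj_distrib)
qed

end
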